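(* Let $U$ be a reflexive separable Banach space, let $\xi\sim\mathcal N(0,\Sigma)$ be a centered $m$-dimensional Gaussian random vector on a probability space $(\Omega,\mathcal F,\mathbb P)$, and let $g\colon U\times\mathbb R^m\to\mathbb R$ be locally Lipschitzian and jointly convex in both variables $(u,z)$. Let $\bar u\in U$ satisfy $g(\bar u,0)<0$ and assume the set $M:=\{z\in\mathbb R^m\mid g(\bar u,z)\le 0\}$ is bounded. Then, with $\varphi(u):=\mathbb P(\omega\mid g(u,\xi(\omega))\le 0)$, \[ \partial^C\varphi(\bar u)=\int_{\mathbb S^{m-1}}\partial^C_u e(\bar u,v)\,d\mu_\zeta(v). \]
   Context: $\Sigma^{1/2}$ denotes a root of the covariance matrix $\Sigma$. The radial probability function is $e(u,v):=\mu_\eta\{r\ge 0\mid g(u,r\Sigma^{1/2}v)\le 0\}$ for $u\in U$, $v\in\mathbb S^{m-1}$, where $\mu_\eta$ is the chi distribution with $m$ degrees of freedom. $\mu_\zeta$ is the uniform distribution on the unit sphere $\mathbb S^{m-1}$. $\partial^C$ denotes the Clarke subdifferential and $\partial^C_u$ the partial Clarke subdifferential with respect to $u$. The integral is an Aumann integral: it is the set of all $x^*\in U^*$ for which there is a measurable selection $v\mapsto \hat x^*_v\in\partial^C_u e(\bar u,v)$ ($\mu_\zeta$-a.e.) with $x^*(h)=\int_{\mathbb S^{m-1}}\hat x^*_v(h)\,d\mu_\zeta(v)$ for all $h\in U$. *)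

theory Defs
  imports "HOL-Analysis.Analysis" "HOL-Probability.Probability"
begin

definition reflexive_space :: "'a::real_normed_vector itself \<Rightarrow> bool" where
  "reflexive_space _ \<longleftrightarrow>
     (\<forall>\<Phi> :: ('a \<Rightarrow>\<^sub>L real) \<Rightarrow>\<^sub>L real. \<exists>u::'a. \<forall>x. blinfun_apply \<Phi> x = blinfun_apply x u)"

definition separable_space :: "'a::metric_space itself \<Rightarrow> bool" where
  "separable_space _ \<longleftrightarrow> (\<exists>D :: 'a set. countable D \<and> closure D = UNIV)"

definition locally_lipschitz :: "('a::metric_space \<Rightarrow> real) \<Rightarrow> bool" where
  "locally_lipschitz f \<longleftrightarrow>
     (\<forall>x. \<exists>\<epsilon>>0. \<exists>K. \<forall>y\<in>ball x \<epsilon>. \<forall>z\<in>ball x \<epsilon>. \<bar>f y - f z\<bar> \<le> K * dist y z)"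

definition clarke_dd :: "('a::real_normed_vector \<Rightarrow> real) \<Rightarrow> 'a \<Rightarrow> 'a \<Rightarrow> ereal" where
  "clarke_dd f x h =
     Limsup (nhds x \<times>\<^sub>F at_right 0) (\<lambda>(y, t). ereal ((f (y + t *\<^sub>R h) - f y) / t))"

definition clarke_subdiff :: "('a::real_normed_vector \<Rightarrow> real) \<Rightarrow> 'a \<Rightarrow> ('a \<Rightarrow>\<^sub>L real) set" where
  "clarke_subdiff f x = {x'. \<forall>h. ereal (blinfun_apply x' h) \<le> clarke_dd f x h}"

definition normal_law :: "real \<Rightarrow> real measure" where
  "normal_law s2 = (if s2 = 0 then return borel 0
                    else density lborel (\<lambda>x. ennreal (normal_density 0 (sqrt s2) x)))"

definition centered_gaussian ::
  "'o measure \<Rightarrow> ('o \<Rightarrow> real^'m) \<Rightarrow> real^'m^'m \<Rightarrow> bool" where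
  "centered_gaussian M \<xi> \<Sigma> \<longleftrightarrow>
     \<xi> \<in> borel_measurable M \<and>
     (\<forall>a. distr M borel (\<lambda>\<omega>. a \<bullet> \<xi> \<omega>) = normal_law (a \<bullet> (\<Sigma> *v a)))"

definition chi_density :: "nat \<Rightarrow> real \<Rightarrow> real" where
  "chi_density m r = (if 0 \<le> r then
      r ^ (m - 1) * exp (- (r\<^sup>2) / 2) / (2 powr (real m / 2 - 1) * Gamma (real m / 2))
    else 0)"

definition chi_measure :: "nat \<Rightarrow> real measure" where
  "chi_measure m = density lborel (\<lambda>r. ennreal (chi_density m r))"

definition uniform_sphere :: "('a::euclidean_space) measure" where
  "uniform_sphere = distr (uniform_measure lborel (ball 0 1)) borel (\<lambda>x. x /\<^sub>R norm x)"

text \<open>Radial probability function e(u,v), with L a root of Sigma.\<close>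
definition radial_prob ::
  "('u \<Rightarrow> real^'m \<Rightarrow> real) \<Rightarrow> real^'m^'m \<Rightarrow> 'u \<Rightarrow> real^'m \<Rightarrow> real" where
  "radial_prob g L u v = measure (chi_measure CARD('m)) {r. 0 \<le> r \<and> g u (r *\<^sub>R (L *v v)) \<le> 0}"

definition aumann_integral ::
  "'v measure \<Rightarrow> ('v \<Rightarrow> ('u::real_normed_vector \<Rightarrow>\<^sub>L real) set) \<Rightarrow> ('u \<Rightarrow>\<^sub>L real) set" where
  "aumann_integral \<mu> F = {x'. \<exists>s. s \<in> borel_measurable \<mu> \<and> (AE v in \<mu>. s v \<in> F v) \<and>
       (\<forall>h. integrable \<mu> (\<lambda>v. blinfun_apply (s v) h) \<and>
            blinfun_apply x' h = (\<integral>v. blinfun_apply (s v) h \<partial>\<mu>))}"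

end

theory Submission
  imports Defs "HOL-Library.Function_Algebras"
begin

text \<open>
  In polar coordinates \<open>\<xi> = L (\<eta> \<zeta>)\<close> with \<open>\<eta>\<close> chi distributed and \<open>\<zeta>\<close> uniform on the sphere, so
  \<open>\<phi> u = \<integral> e u v\<close>. For \<open>u\<close> near \<open>ubar\<close> and \<open>L v \<noteq> 0\<close> one has \<open>e u v = F (\<rho> u)\<close> with \<open>F\<close> the chi distribution
  function and \<open>\<rho>\<close> the root of the convex function \<open>r \<mapsto> g u (r L v)\<close>; joint convexity of \<open>g\<close> makes \<open>\<rho>\<close> concave
  in \<open>u\<close>. Hence \<open>- e\<close> is Clarke regular, and since \<open>\<rho>\<close> has a relative Lipschitz constant independent of
  \<open>v\<close> while \<open>r\<close> times the chi density is bounded, \<open>e\<close> is Lipschitz in \<open>u\<close> uniformly in \<open>v\<close>. Dominated convergence then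
  gives equality of the Clarke derivative of \<open>\<phi>\<close> with the integral of those of \<open>e\<close>, and Strassen's
  theorem turns a functional below an integral of sublinear functions into the integral of
  a measurable selection.
\<close>

section \<open>The Hahn-Banach theorem\<close>

text \<open>For general Lipschitz integrands only one inclusion holds: the subdifferential of the
  integral lies in the integral of the subdifferentials. The reverse needs one sequence of base
  points and steps that realises the Clarke derivative for every \<open>v\<close> at once. Backward
  difference quotients at \<open>ubar\<close> with steps 1/(n+1) do this, because each e(., v) is,
  near \<open>ubar\<close>, a nondecreasing function of a concave radius. A second obstacle is that
  \<Sigma> may be singular. The law of \<xi> then has no density, \<open>L v\<close> can vanish or
  be arbitrarily short, and the radii may be unbounded in \<open>v\<close>. So the law is identified
  with the image of the standard Gaussian under \<open>L\<close> by characteristic functions, which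
  fits a definition through one-dimensional projections, and directions with \<open>L v = 0\<close>,
  where e is constant for u near \<open>ubar\<close>, are treated apart. Reflexivity together with
  separability makes the dual separable. A selection whose value at each \<open>h\<close> is
  measurable is then Borel measurable for the dual norm, as the Aumann integral demands.\<close>

definition sublinear_on :: "'a::real_vector set \<Rightarrow> ('a \<Rightarrow> real) \<Rightarrow> bool" where
  "sublinear_on X q \<longleftrightarrow> (\<forall>x\<in>X. \<forall>y\<in>X. q (x + y) \<le> q x + q y) \<and>
     (\<forall>x\<in>X. \<forall>t>0. q (t *\<^sub>R x) \<le> t * q x)"

lemma sublinear_on_zero:
  assumes "subspace X" "sublinear_on X q"
  shows "q 0 = 0"
proof -
  have "0 \<in> X" using assms(1) by (rule subspace_0)
  then have "q (0 + 0) \<le> q 0 + q 0" "q ((1/2) *\<^sub>R 0) \<le> (1/2) * q 0"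
    using assms(2) unfolding sublinear_on_def by (blast, meson half_gt_zero zero_less_one)
  then show ?thesis by simp
qed

text \<open>The one-sided condition is applied with the factor \<open>t\<close> and then with
  \<open>1/t\<close>. Asking only for an inequality in \<open>sublinear_on\<close> is convenient
  because pointwise infima inherit it directly.\<close>

lemma sublinear_on_scale:
  assumes "subspace X" "sublinear_on X q" "x \<in> X" "t \<ge> 0"
  shows "q (t *\<^sub>R x) = t * q x"
proof (cases "t = 0")
  case True
  then show ?thesis using sublinear_on_zero[OF assms(1,2)] by simp
next
  case False
  then have t: "t > 0" using assms by simp
  have a: "q (t *\<^sub>R x) \<le> t * q x"
    using assms t unfolding sublinear_on_def by blast
  have "t *\<^sub>R x \<in> X" using assms by (simp add: subspace_scale)
  then have "q ((1/t) *\<^sub>R (t *\<^sub>R x)) \<le> (1/t) * q (t *\<^sub>R x)"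
    using assms(2) t unfolding sublinear_on_def by (meson divide_pos_pos zero_less_one)
  then have "t * q x \<le> q (t *\<^sub>R x)"
    using t by (simp add: field_simps)
  with a show ?thesis by simp
qed

lemma sublinear_on_lower:
  assumes "subspace X" "sublinear_on X q" "x \<in> X"
  shows "- q (- x) \<le> q x"
proof -
  have "- x \<in> X" using assms by (simp add: subspace_neg)
  then have "q (x + - x) \<le> q x + q (- x)"
    using assms unfolding sublinear_on_def by blast
  then show ?thesis using sublinear_on_zero[OF assms(1,2)] by simp
qed

text \<open>The convex cone \<open>T\<close> collects pairs \<open>(s, r)\<close> that stand for a constraint \<open>F s \<le> r\<close> on
  functionals \<open>F\<close> dominated by the new sublinear function: the graph of a functional to be extended,
  or a ray when minimal sublinear functions are shown to be additive.\<close>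

lemma sublinear_on_inf_convolution:
  fixes q :: "'a::real_vector \<Rightarrow> real" and T :: "('a \<times> real) set"
  assumes X: "subspace X" and q: "sublinear_on X q"
    and T0: "(0, 0) \<in> T"
    and Tadd: "\<And>a b. a \<in> T \<Longrightarrow> b \<in> T \<Longrightarrow> a + b \<in> T"
    and Tscale: "\<And>a t. a \<in> T \<Longrightarrow> t > 0 \<Longrightarrow> t *\<^sub>R a \<in> T"
    and TX: "\<And>s r. (s, r) \<in> T \<Longrightarrow> s \<in> X \<and> - r \<le> q (- s)"
  obtains q' where "sublinear_on X q'" "\<And>x s r. x \<in> X \<Longrightarrow> (s, r) \<in> T \<Longrightarrow> q' x \<le> q (x - s) + r"
proof
  define q' where "q' x = (INF a\<in>T. q (x - fst a) + snd a)" for x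
  \<comment> \<open>Subadditivity at \<open>(x - s) + (- x) = - s\<close>, combined with
    \<open>- r \<le> q (- s)\<close>, gives a lower bound independent of the pair, so the infimum is
    a genuine real infimum.\<close>
  have bdd: "- q (- x) \<le> q (x - fst a) + snd a" if "x \<in> X" "a \<in> T" for x a
  proof -
    have s: "fst a \<in> X" "- snd a \<le> q (- fst a)" using TX[of "fst a" "snd a"] that by auto
    have "x - fst a \<in> X" "- x \<in> X" using that s X by (auto simp: subspace_diff subspace_neg)
    then have "q ((x - fst a) + - x) \<le> q (x - fst a) + q (- x)"
      using q unfolding sublinear_on_def by blast
    then show ?thesis using s by simp
  qed
  have bb: "bdd_below ((\<lambda>a. q (x - fst a) + snd a) ` T)" if "x \<in> X" for x
    using bdd[OF that] by (auto intro!: bdd_belowI)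
  show le: "q' x \<le> q (x - s) + r" if "x \<in> X" "(s, r) \<in> T" for x s r
    unfolding q'_def using cINF_lower[OF bb[OF that(1)] that(2)] by simp
  have T: "T \<noteq> {}" using T0 by auto
  show "sublinear_on X q'"
    unfolding sublinear_on_def
  proof (intro conjI ballI allI impI)
    fix x y assume xy: "x \<in> X" "y \<in> X"
    have *: "q' (x + y) \<le> (q (x - fst a) + snd a) + (q (y - fst b) + snd b)"
      if "a \<in> T" "b \<in> T" for a b
    proof -
      have ab: "fst a \<in> X" "fst b \<in> X" using TX that by (metis prod.collapse)+
      have "q' (x + y) \<le> q ((x + y) - fst (a + b)) + snd (a + b)"
        using xy Tadd[OF that] X by (intro le) (simp_all add: subspace_add del: fst_add snd_add)
      also have "q ((x + y) - fst (a + b)) = q ((x - fst a) + (y - fst b))"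
        by (simp add: algebra_simps)
      also have "\<dots> \<le> q (x - fst a) + q (y - fst b)"
        using q ab xy X unfolding sublinear_on_def by (auto simp: subspace_diff)
      finally show ?thesis by simp
    qed
    have "q' (x + y) - (q (y - fst b) + snd b) \<le> q' x" if "b \<in> T" for b
      unfolding q'_def[of x] by (rule cINF_greatest[OF T]) (use *[OF _ that] in force)
    then have "q' (x + y) - q' x \<le> q' y"
      unfolding q'_def[of y] by (intro cINF_greatest[OF T]) force
    then show "q' (x + y) \<le> q' x + q' y" by simp
  next
    fix x and t :: real assume x: "x \<in> X" and t: "t > 0"
    have "q' (t *\<^sub>R x) / t \<le> q' x"
      unfolding q'_def[of x]
    proof (rule cINF_greatest[OF T])
      fix a assume a: "a \<in> T"
      have aX: "fst a \<in> X" using TX a by (metis prod.collapse)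
      have "q' (t *\<^sub>R x) \<le> q (t *\<^sub>R x - fst (t *\<^sub>R a)) + snd (t *\<^sub>R a)"
        using x Tscale[OF a t] X by (intro le) (simp_all add: subspace_scale del: fst_scaleR snd_scaleR)
      also have "q (t *\<^sub>R x - fst (t *\<^sub>R a)) = q (t *\<^sub>R (x - fst a))"
        by (simp add: algebra_simps)
      also have "\<dots> \<le> t * q (x - fst a)"
        using q t x aX X unfolding sublinear_on_def by (auto simp: subspace_diff)
      finally show "q' (t *\<^sub>R x) / t \<le> q (x - fst a) + snd a"
        using t by (simp add: field_simps)
    qed
    then show "q' (t *\<^sub>R x) \<le> t * q' x" using t by (simp add: field_simps)
  qed
qed

text \<open>Zorn's lemma with the pointwise order reversed: a chain of sublinear functions below
  \<open>p\<close> has its pointwise infimum as bound, which is finite because each member satisfies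
  \<open>q x \<ge> - q (- x) \<ge> - p (- x)\<close>.\<close>

lemma minimal_sublinear_exists:
  fixes p :: "'a::real_vector \<Rightarrow> real"
  assumes X: "subspace X" and p: "sublinear_on X p"
  obtains q where "sublinear_on X q" "\<And>x. x \<in> X \<Longrightarrow> q x \<le> p x"
    "\<And>q' x. sublinear_on X q' \<Longrightarrow> (\<And>x. x \<in> X \<Longrightarrow> q' x \<le> q x) \<Longrightarrow> x \<in> X \<Longrightarrow> q' x = q x"
proof -
  \<comment> \<open>Members are set to 0 off \<open>X\<close>. Otherwise agreement on
    \<open>X\<close> would not give equality of functions and the order would fail to be
    antisymmetric.\<close>
  define A where "A = {q. sublinear_on X q \<and> (\<forall>x\<in>X. q x \<le> p x) \<and> (\<forall>x. x \<notin> X \<longrightarrow> q x = 0)}"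
  define P where "P q r \<longleftrightarrow> (\<forall>x. r x \<le> q x)" for q r :: "'a \<Rightarrow> real"
  have cut: "sublinear_on X (\<lambda>x. if x \<in> X then q x else 0)" if "sublinear_on X q" for q
    using that X unfolding sublinear_on_def by (auto simp: subspace_add subspace_scale)
  have po: "partial_order_on A (relation_of P A)"
    by (rule partial_order_on_relation_ofI) (auto simp: P_def fun_eq_iff intro: order_trans antisym)
  have "\<exists>m\<in>A. \<forall>a\<in>A. P m a \<longrightarrow> a = m"
  proof (rule predicate_Zorn[OF po])
    fix C assume C: "C \<in> Chains (relation_of P A)"
    show "\<exists>u\<in>A. \<forall>a\<in>C. P a u"
    proof (cases "C = {}")
      case True
      have "(\<lambda>x. if x \<in> X then p x else 0) \<in> A" using cut[OF p] by (auto simp: A_def)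
      then show ?thesis using True by blast
    next
      case False
      have CA: "C \<subseteq> A" and tot: "P q r \<or> P r q" if "q \<in> C" "r \<in> C" for q r
        using C that unfolding Chains_def relation_of_def by auto
      have CA: "q \<in> A" if "q \<in> C" for q using CA that by blast
      define u where "u x = (if x \<in> X then (INF q\<in>C. q x) else 0)" for x
      have bb: "bdd_below ((\<lambda>q. q x) ` C)" if x: "x \<in> X" for x
      proof (rule bdd_belowI2)
        fix q assume "q \<in> C"
        then have q: "q \<in> A" by (rule CA)
        have "- x \<in> X" using x X by (simp add: subspace_neg)
        then have "q (- x) \<le> p (- x)" using q by (auto simp: A_def)
        moreover have "- q (- x) \<le> q x" using q x X by (intro sublinear_on_lower) (auto simp: A_def)
        ultimately show "- p (- x) \<le> q x" by linarith
      qed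
      have le: "u x \<le> q x" if "q \<in> C" for q x
        using cINF_lower[OF bb that] CA[OF that] by (auto simp: u_def A_def)
      have "sublinear_on X u"
        unfolding sublinear_on_def
      proof (intro conjI ballI allI impI)
        fix x y assume xy: "x \<in> X" "y \<in> X"
        \<comment> \<open>Two members of a chain are comparable, so the smaller one serves both
          arguments and its own subadditivity can be used.\<close>
        have *: "u (x + y) \<le> q x + r y" if "q \<in> C" "r \<in> C" for q r
        proof -
          obtain s where s: "s \<in> C" "s x \<le> q x" "s y \<le> r y"
            using tot[OF \<open>q \<in> C\<close> \<open>r \<in> C\<close>] \<open>q \<in> C\<close> \<open>r \<in> C\<close> unfolding P_def by blast
          have "u (x + y) \<le> s (x + y)" by (rule le[OF s(1)])
          also have "\<dots> \<le> s x + s y"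
            using CA[OF s(1)] xy by (auto simp: A_def sublinear_on_def)
          finally show ?thesis using s by linarith
        qed
        have "u (x + y) - r y \<le> u x" if "r \<in> C" for r
          using xy by (auto simp: u_def[of x] intro!: cINF_greatest False dest: *[OF _ that])
        then have "u (x + y) - u x \<le> u y"
          using xy by (auto simp: u_def[of y] intro!: cINF_greatest False) force
        then show "u (x + y) \<le> u x + u y" by simp
      next
        fix x and t :: real assume x: "x \<in> X" and t: "t > 0"
        have "u (t *\<^sub>R x) / t \<le> q x" if "q \<in> C" for q
        proof -
          have "u (t *\<^sub>R x) \<le> q (t *\<^sub>R x)" by (rule le[OF that])
          also have "\<dots> \<le> t * q x" using CA[OF that] x t by (auto simp: A_def sublinear_on_def)
          finally show ?thesis using t by (simp add: field_simps)
        qed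
        then have "u (t *\<^sub>R x) / t \<le> u x"
          using x by (auto simp: u_def[of x] intro!: cINF_greatest False)
        then show "u (t *\<^sub>R x) \<le> t * u x" using t by (simp add: field_simps)
      qed
      moreover have "u x \<le> p x" if "x \<in> X" for x
      proof -
        obtain q where q: "q \<in> C" using False by blast
        have "u x \<le> q x" by (rule le[OF q])
        also have "\<dots> \<le> p x" using CA[OF q] that by (auto simp: A_def)
        finally show ?thesis .
      qed
      ultimately have "u \<in> A" by (auto simp: A_def u_def)
      moreover have "\<forall>a\<in>C. P a u" using le by (auto simp: P_def)
      ultimately show ?thesis by blast
    qed
  qed
  then obtain q where q: "q \<in> A" and min: "\<And>a. a \<in> A \<Longrightarrow> P q a \<Longrightarrow> a = q" by blast
  show thesis
  proof (rule that[of q])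
    fix q' x assume q': "sublinear_on X q'" "\<And>x. x \<in> X \<Longrightarrow> q' x \<le> q x" and x: "x \<in> X"
    let ?q = "\<lambda>x. if x \<in> X then q' x else 0"
    have "?q \<in> A" using cut[OF q'(1)] q'(2) q by (fastforce simp: A_def)
    moreover have "P q ?q" using q'(2) q by (auto simp: A_def P_def)
    ultimately have "?q = q" by (rule min)
    then have "?q x = q x" by (rule fun_cong)
    then show "q' x = q x" using x by simp
  qed (use q in \<open>auto simp: A_def\<close>)
qed

text \<open>Lower \<open>q\<close> along the ray of \<open>y\<close>: the infimum over t \<ge> 0 of
  \<open>q (x + t *\<^sub>R y) - t * q y\<close> is sublinear and at most \<open>q\<close>, hence
  equal to it by minimality. The term with t = 1 is the missing inequality
  \<open>q x + q y \<le> q (x + y)\<close>.\<close>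

lemma minimal_sublinear_additive:
  fixes q :: "'a::real_vector \<Rightarrow> real"
  assumes X: "subspace X" and q: "sublinear_on X q"
    and min: "\<And>q' x. sublinear_on X q' \<Longrightarrow> (\<And>x. x \<in> X \<Longrightarrow> q' x \<le> q x) \<Longrightarrow> x \<in> X \<Longrightarrow> q' x = q x"
    and xy: "x \<in> X" "y \<in> X"
  shows "q (x + y) = q x + q y"
proof -
  define T where "T = (\<lambda>t. (- (t *\<^sub>R y), - (t * q y))) ` {0..}"
  obtain q' where q': "sublinear_on X q'" "\<And>x s r. x \<in> X \<Longrightarrow> (s, r) \<in> T \<Longrightarrow> q' x \<le> q (x - s) + r"
  proof (rule sublinear_on_inf_convolution[OF X q, of T])
    show "(0, 0) \<in> T" by (auto simp: T_def image_iff intro!: bexI[of _ 0])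
    show "a + b \<in> T" if ab: "a \<in> T" "b \<in> T" for a b
    proof -
      obtain t u where "t \<ge> 0" "u \<ge> 0" "a = (- (t *\<^sub>R y), - (t * q y))" "b = (- (u *\<^sub>R y), - (u * q y))"
        using ab by (auto simp: T_def)
      then show ?thesis
        by (auto simp: T_def image_iff algebra_simps intro!: bexI[of _ "t + u"])
    qed
    show "c *\<^sub>R a \<in> T" if a: "a \<in> T" "c > 0" for a c
    proof -
      obtain t where "t \<ge> 0" "a = (- (t *\<^sub>R y), - (t * q y))" using a by (auto simp: T_def)
      then show ?thesis
        using a by (auto simp: T_def image_iff algebra_simps intro!: bexI[of _ "c * t"])
    qed
    show "s \<in> X \<and> - r \<le> q (- s)" if sr: "(s, r) \<in> T" for s r
    proof -
      obtain t where "t \<ge> 0" "s = - (t *\<^sub>R y)" "r = - (t * q y)" using sr by (auto simp: T_def)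
      then show ?thesis
        using xy X sublinear_on_scale[OF X q xy(2)] by (auto simp: subspace_neg subspace_scale)
    qed
  qed blast
  have "(0, 0) \<in> T" by (auto simp: T_def image_iff intro!: bexI[of _ 0])
  then have "q' z \<le> q z" if "z \<in> X" for z using q'(2)[OF that, of 0 0] by simp
  then have "q' x = q x" using min[OF q'(1)] xy by blast
  moreover have "(- y, - q y) \<in> T" by (auto simp: T_def image_iff intro!: bexI[of _ 1])
  then have "q' x \<le> q (x + y) - q y" using q'(2)[OF xy(1)] by force
  ultimately have "q x + q y \<le> q (x + y)" by simp
  moreover have "q (x + y) \<le> q x + q y" using q xy by (auto simp: sublinear_on_def)
  ultimately show ?thesis by simp
qed

text \<open>First lower \<open>p\<close> to some \<open>p'\<close> that is at most \<open>f\<close>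
  on \<open>S\<close>; any minimal sublinear function below \<open>p'\<close> is linear. On
  \<open>S\<close> it lies below \<open>f\<close> at both \<open>x\<close> and \<open>- x\<close>,
  which forces equality. No one-dimensional extension step occurs.\<close>

theorem hahn_banach_dominated:
  fixes p f :: "'a::real_vector \<Rightarrow> real"
  assumes X: "subspace X" and p: "sublinear_on X p"
    and S: "subspace S" "S \<subseteq> X"
    and fadd: "\<And>x y. x \<in> S \<Longrightarrow> y \<in> S \<Longrightarrow> f (x + y) = f x + f y"
    and fscale: "\<And>x c. x \<in> S \<Longrightarrow> f (c *\<^sub>R x) = c * f x"
    and fp: "\<And>x. x \<in> S \<Longrightarrow> f x \<le> p x"
  obtains F where "\<And>x y. x \<in> X \<Longrightarrow> y \<in> X \<Longrightarrow> F (x + y) = F x + F y"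
    "\<And>x c. x \<in> X \<Longrightarrow> F (c *\<^sub>R x) = c * F x"
    "\<And>x. x \<in> X \<Longrightarrow> F x \<le> p x" "\<And>x. x \<in> S \<Longrightarrow> F x = f x"
proof -
  define T where "T = (\<lambda>s. (s, f s)) ` S"
  have fneg: "f (- s) = - f s" if "s \<in> S" for s using fscale[OF that, of "-1"] by simp
  have S0: "0 \<in> S" and f0: "f 0 = 0" using S subspace_0 fscale[of 0 0] by auto
  obtain p' where p': "sublinear_on X p'" "\<And>x s r. x \<in> X \<Longrightarrow> (s, r) \<in> T \<Longrightarrow> p' x \<le> p (x - s) + r"
  proof (rule sublinear_on_inf_convolution[OF X p, of T])
    show "(0, 0) \<in> T" using S0 f0 by (auto simp: T_def)
    show "a + b \<in> T" if "a \<in> T" "b \<in> T" for a b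
      using that S by (auto simp: T_def fadd subspace_add image_iff)
    show "c *\<^sub>R a \<in> T" if "a \<in> T" "c > 0" for a c
      using that S by (auto simp: T_def fscale subspace_scale image_iff)
    show "s \<in> X \<and> - r \<le> p (- s)" if "(s, r) \<in> T" for s r
      using that S fp[of "- s"] fneg by (auto simp: T_def subspace_neg)
  qed blast
  have p'p: "p' x \<le> p x" if "x \<in> X" for x
    using p'(2)[OF that, of 0 0] S0 f0 by (force simp: T_def)
  have p'f: "p' x \<le> f x" if "x \<in> S" for x
    using p'(2)[of x x "f x"] that S sublinear_on_zero[OF X p] by (auto simp: T_def)
  obtain F where F: "sublinear_on X F" "\<And>x. x \<in> X \<Longrightarrow> F x \<le> p' x"
    "\<And>q' x. sublinear_on X q' \<Longrightarrow> (\<And>x. x \<in> X \<Longrightarrow> q' x \<le> F x) \<Longrightarrow> x \<in> X \<Longrightarrow> q' x = F x"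
    using minimal_sublinear_exists[OF X p'(1)] by blast
  have add: "F (x + y) = F x + F y" if "x \<in> X" "y \<in> X" for x y
    by (rule minimal_sublinear_additive[OF X F(1) _ that]) (rule F(3))
  have neg: "F (- x) = - F x" if "x \<in> X" for x
    using add[OF that, of "- x"] that X sublinear_on_zero[OF X F(1)] by (auto simp: subspace_neg)
  show thesis
  proof (rule that[of F])
    show "F (c *\<^sub>R x) = c * F x" if x: "x \<in> X" for x c
    proof (cases "c \<ge> 0")
      case True
      then show ?thesis by (rule sublinear_on_scale[OF X F(1) x])
    next
      case False
      then have "F ((- c) *\<^sub>R x) = (- c) * F x" by (intro sublinear_on_scale[OF X F(1) x]) simp
      moreover have "F (- ((- c) *\<^sub>R x)) = - F ((- c) *\<^sub>R x)"
        by (rule neg[OF subspace_scale[OF X x]])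
      ultimately show ?thesis by simp
    qed
    show "F x \<le> p x" if "x \<in> X" for x using F(2)[OF that] p'p[OF that] by linarith
    show "F x = f x" if x: "x \<in> S" for x
    proof -
      have "x \<in> X" "- x \<in> S" "- x \<in> X" using x S by (auto simp: subspace_neg)
      then have "F x \<le> f x" "F (- x) \<le> f (- x)" using F(2) p'f x by (meson order_trans)+
      then show ?thesis using neg[OF \<open>x \<in> X\<close>] fneg[OF x] by linarith
    qed
  qed (use add in auto)
qed

text \<open>Supplies the ambient vector space in which the simple functions form a subspace, so that
  the Hahn-Banach theorem can be applied to them.\<close>

instantiation "fun" :: (type, real_vector) real_vector
begin

definition scaleR_fun :: "real \<Rightarrow> ('a \<Rightarrow> 'b) \<Rightarrow> 'a \<Rightarrow> 'b" where
  "scaleR_fun c f = (\<lambda>x. c *\<^sub>R f x)"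

instance
  by standard (auto simp: scaleR_fun_def plus_fun_def fun_eq_iff algebra_simps)

end

section \<open>Separable duals and measurability\<close>

text \<open>The distance is the seminorm of the quotient by \<open>S\<close>. As a dominating
  function it forces a linear functional to vanish on \<open>S\<close> and to be bounded by the
  norm.\<close>

lemma infdist_subspace_sublinear:
  fixes S :: "'a::real_normed_vector set"
  assumes S: "subspace S"
  shows "sublinear_on UNIV (\<lambda>x. infdist x S)"
  unfolding sublinear_on_def
proof (intro conjI ballI allI impI)
  have ne: "S \<noteq> {}" using subspace_0[OF S] by auto
  fix x y :: 'a
  have *: "infdist (x + y) S \<le> dist x a + dist y b" if "a \<in> S" "b \<in> S" for a b
  proof -
    have "infdist (x + y) S \<le> dist (x + y) (a + b)"
      using that S by (intro infdist_le) (auto simp: subspace_add)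
    also have "\<dots> \<le> dist x a + dist y b"
      by (rule dist_triangle_add)
    finally show ?thesis .
  qed
  have "infdist (x + y) S - dist y b \<le> infdist x S" if "b \<in> S" for b
    unfolding infdist_notempty[OF ne, of x]
    using *[OF _ that] by (intro cINF_greatest[OF ne]) (force simp: algebra_simps)
  then have "infdist (x + y) S - infdist x S \<le> infdist y S"
    unfolding infdist_notempty[OF ne, of y]
    by (intro cINF_greatest[OF ne]) (force simp: algebra_simps)
  then show "infdist (x + y) S \<le> infdist x S + infdist y S" by simp
next
  have ne: "S \<noteq> {}" using subspace_0[OF S] by auto
  fix x :: 'a and t :: real assume t: "t > 0"
  have "infdist (t *\<^sub>R x) S / t \<le> infdist x S"
    unfolding infdist_notempty[OF ne, of x]
  proof (rule cINF_greatest[OF ne])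
    fix a assume "a \<in> S"
    then have "infdist (t *\<^sub>R x) S \<le> dist (t *\<^sub>R x) (t *\<^sub>R a)"
      using S by (intro infdist_le) (auto simp: subspace_scale)
    also have "\<dots> = t * dist x a" 
    proof -
      have "t *\<^sub>R x - t *\<^sub>R a = t *\<^sub>R (x - a)" by (rule scaleR_diff_right[symmetric])
      then show ?thesis using t by (simp add: dist_norm)
    qed
    finally show "infdist (t *\<^sub>R x) S / t \<le> dist x a"
      using t by (simp add: field_simps)
  qed
  then show "infdist (t *\<^sub>R x) S \<le> t * infdist x S" using t by (simp add: field_simps)
qed

lemma separating_functional:
  fixes S :: "'a::real_normed_vector set"
  assumes S: "subspace S" and x0: "x0 \<notin> closure S"
  shows "\<exists>\<Phi> :: 'a \<Rightarrow>\<^sub>L real. (\<forall>x\<in>S. blinfun_apply \<Phi> x = 0) \<and> blinfun_apply \<Phi> x0 > 0"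
proof -
  define d where "d = infdist x0 S"
  have ne: "S \<noteq> {}" using subspace_0[OF S] by auto
  have d: "d > 0"
    using x0 infdist_nonneg[of x0 S] in_closure_iff_infdist_zero[OF ne] unfolding d_def
    by (metis less_eq_real_def)
  have x00: "x0 \<noteq> 0" using x0 subspace_0[OF S] closure_subset by auto
  \<comment> \<open>The coordinate along \<open>x0\<close>, scaled by the distance \<open>d\<close>;
    the choice is unique on multiples of \<open>x0\<close> because \<open>x0\<close> is
    nonzero.\<close>
  define f where "f x = (SOME c. x = c *\<^sub>R x0) * d" for x
  have f: "f (c *\<^sub>R x0) = c * d" for c
    using x00 by (simp add: f_def)
  have sub: "sublinear_on UNIV (\<lambda>x. infdist x S)" by (rule infdist_subspace_sublinear[OF S])
  obtain F where F: "\<And>x y. F (x + y) = F x + F y" "\<And>x c. F (c *\<^sub>R x) = c * F x"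
    "\<And>x. F x \<le> infdist x S" "\<And>x. x \<in> span {x0} \<Longrightarrow> F x = f x"
  proof (rule hahn_banach_dominated[OF subspace_UNIV sub subspace_span[of "{x0}"], of f])
    show "f (x + y) = f x + f y" if xy: "x \<in> span {x0}" "y \<in> span {x0}" for x y
    proof -
      obtain a b where "x = a *\<^sub>R x0" "y = b *\<^sub>R x0" using xy by (auto simp: span_singleton)
      then show ?thesis by (simp add: f flip: scaleR_add_left) (simp add: algebra_simps)
    qed
    show "f (c *\<^sub>R x) = c * f x" if x: "x \<in> span {x0}" for x c
    proof -
      obtain a where "x = a *\<^sub>R x0" using x by (auto simp: span_singleton)
      then show ?thesis by (simp add: f)
    qed
    show "f x \<le> infdist x S" if x: "x \<in> span {x0}" for x
    proof -
      obtain a where a: "x = a *\<^sub>R x0" using x by (auto simp: span_singleton)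
      show ?thesis
      proof (cases "a \<ge> 0")
        case True
        then show ?thesis using sublinear_on_scale[OF subspace_UNIV sub, of x0 a] by (simp add: a f d_def)
      next
        case False
        then have "a * d \<le> 0" using d by (simp add: mult_nonpos_nonneg)
        then show ?thesis using infdist_nonneg[of x S] by (simp add: a f)
      qed
    qed
  qed auto
  have Fn: "F x \<le> norm x" for x
    using F(3)[of x] infdist_le[OF subspace_0[OF S], of x] by (simp add: dist_norm)
  have Fneg: "F (- x) = - F x" for x using F(2)[of "-1" x] by simp
  have Fa: "\<bar>F x\<bar> \<le> norm x" for x using Fn[of x] Fn[of "- x"] Fneg[of x] by simp
  have bl: "bounded_linear F"
    using F(1,2) Fa by (intro bounded_linear_intro[of F 1]) auto
  show ?thesis
  proof (intro exI[of _ "Blinfun F"] conjI ballI)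
    show "blinfun_apply (Blinfun F) x = 0" if x: "x \<in> S" for x
    proof -
      have "F x \<le> 0" "F (- x) \<le> 0"
        using F(3)[of x] F(3)[of "- x"] x S by (auto simp: subspace_neg)
      then show ?thesis using Fneg[of x] by (simp add: bounded_linear_Blinfun_apply[OF bl])
    qed
    show "blinfun_apply (Blinfun F) x0 > 0"
      using F(4)[OF span_base[of x0 "{x0}"]] f[of 1] d by (simp add: bounded_linear_Blinfun_apply[OF bl])
  qed
qed

text \<open>Lists make countability immediate and turn closure under addition into
  appending.\<close>

definition rational_span :: "'a::real_vector set \<Rightarrow> 'a set" where
  "rational_span B = (\<lambda>l. \<Sum>(q, b)\<leftarrow>l. real_of_rat q *\<^sub>R b) ` lists (UNIV \<times> B)"

lemma countable_rational_span: "countable B \<Longrightarrow> countable (rational_span B)"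
  unfolding rational_span_def by (intro countable_image countable_lists countable_SIGMA) auto

lemma rational_span_0: "0 \<in> rational_span B"
  unfolding rational_span_def by (force intro: image_eqI[of _ _ "[]"])

lemma rational_span_base: "b \<in> B \<Longrightarrow> b \<in> rational_span B"
  unfolding rational_span_def by (rule image_eqI[of _ _ "[(1, b)]"]) auto

lemma rational_span_add:
  assumes "x \<in> rational_span B" "y \<in> rational_span B"
  shows "x + y \<in> rational_span B"
proof -
  obtain l k where "l \<in> lists (UNIV \<times> B)" "k \<in> lists (UNIV \<times> B)"
    "x = (\<Sum>(q, b)\<leftarrow>l. real_of_rat q *\<^sub>R b)" "y = (\<Sum>(q, b)\<leftarrow>k. real_of_rat q *\<^sub>R b)"
    using assms unfolding rational_span_def by blast
  then show ?thesis
    unfolding rational_span_def by (intro image_eqI[of _ _ "l @ k"]) auto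
qed

lemma rational_span_scale:
  assumes "x \<in> rational_span B"
  shows "real_of_rat r *\<^sub>R x \<in> rational_span B"
proof -
  obtain l where l: "l \<in> lists (UNIV \<times> B)" "x = (\<Sum>(q, b)\<leftarrow>l. real_of_rat q *\<^sub>R b)"
    using assms unfolding rational_span_def by blast
  have "real_of_rat r *\<^sub>R (\<Sum>(q, b)\<leftarrow>l. real_of_rat q *\<^sub>R b)
      = (\<Sum>(q, b)\<leftarrow>map (\<lambda>(q, b). (r * q, b)) l. real_of_rat q *\<^sub>R b)"
    by (induction l) (auto simp: algebra_simps of_rat_mult)
  moreover have "map (\<lambda>(q, b). (r * q, b)) l \<in> lists (UNIV \<times> B)"
    using l(1) by (induction l) auto
  ultimately show ?thesis
    unfolding rational_span_def l(2) by (intro image_eqI)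
qed

lemma closure_rational_span:
  fixes B :: "'a::real_normed_vector set"
  shows "span B \<subseteq> closure (rational_span B)"
proof
  fix x assume "x \<in> span B"
  then show "x \<in> closure (rational_span B)"
  proof (induction rule: span_induct_alt)
    case base
    show ?case using rational_span_0 closure_subset by blast
  next
    case (step c b y)
    obtain f where f: "\<And>n. f n \<in> rational_span B" "f \<longlonglongrightarrow> y"
      using step(2) unfolding closure_sequential by blast
    have "\<exists>q. \<bar>real_of_rat q - c\<bar> < 1 / real (Suc n)" for n
      using of_rat_dense[of "c - 1 / real (Suc n)" "c + 1 / real (Suc n)"]
      by (auto simp: abs_less_iff field_simps)
    then obtain q where q: "\<And>n. \<bar>real_of_rat (q n) - c\<bar> < 1 / real (Suc n)" by metis
    have "(\<lambda>n. real_of_rat (q n) - c) \<longlonglongrightarrow> 0"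
      by (rule tendsto_rabs_zero_cancel, rule Lim_null_comparison[OF _ lim_1_over_n[THEN LIMSEQ_Suc]])
         (use q in \<open>auto intro!: always_eventually less_imp_le\<close>)
    then have "(\<lambda>n. real_of_rat (q n)) \<longlonglongrightarrow> c" by (rule LIM_zero_cancel)
    then have "(\<lambda>n. real_of_rat (q n) *\<^sub>R b + f n) \<longlonglongrightarrow> c *\<^sub>R b + y"
      using f(2) by (intro tendsto_intros)
    moreover have "real_of_rat (q n) *\<^sub>R b + f n \<in> rational_span B" for n
      by (rule rational_span_add[OF rational_span_scale[OF rational_span_base[OF step(1)]] f(1)])
    ultimately show ?case unfolding closure_sequential
      by (intro exI[of _ "\<lambda>n. real_of_rat (q n) *\<^sub>R b + f n"]) simp
  qed
qed

text \<open>To each \<open>b\<close> of a countable dense set belongs a functional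
  \<open>x b\<close> that nearly norms the evaluation \<open>ev b\<close>. If their span were not
  dense, a nonzero element of the bidual would annihilate it. By reflexivity that element is
  evaluation at some \<open>u\<close>, and approximating \<open>u\<close> by such \<open>b\<close>
  shows \<open>ev u = 0\<close>, a contradiction.\<close>

theorem separable_dual_of_reflexive:
  assumes refl: "reflexive_space TYPE('u::real_normed_vector)"
    and sep: "separable_space TYPE('u::real_normed_vector)"
  obtains D :: "('u::real_normed_vector \<Rightarrow>\<^sub>L real) set" where "countable D" "closure D = UNIV"
proof -
  obtain B :: "'u set" where B: "countable B" "closure B = UNIV"
    using sep unfolding separable_space_def by blast
  define ev where "ev u = Blinfun (\<lambda>x :: 'u \<Rightarrow>\<^sub>L real. blinfun_apply x u)" for u
  have ev: "blinfun_apply (ev u) x = blinfun_apply x u" for u x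
    unfolding ev_def by (simp add: bounded_linear_Blinfun_apply)
  have ev_diff: "ev u - ev w = ev (u - w)" for u w
    by (rule blinfun_eqI) (simp add: ev minus_blinfun.rep_eq blinfun.diff_right)
  have ev_norm: "norm (ev u) \<le> norm u" for u
    
  proof (rule norm_blinfun_bound)
    show "norm (blinfun_apply (ev u) x) \<le> norm u * norm x" for x
      using norm_blinfun[of x u] by (simp add: ev mult.commute)
  qed simp
  \<comment> \<open>Half the operator norm of \<open>ev b\<close> is reached on the unit ball by the
    definition of that norm. Working with \<open>norm (ev b)\<close> instead of
    \<open>norm b\<close> spares a norm-attaining functional.\<close>
  have "\<exists>x. norm x \<le> 1 \<and> norm (ev b) / 2 \<le> \<bar>blinfun_apply x b\<bar>" for b
  proof (cases "norm (ev b) = 0")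
    case True
    then show ?thesis by (intro exI[of _ 0]) auto
  next
    case False
    show ?thesis
    proof (rule ccontr)
      assume neg: "\<not> ?thesis"
      have "norm (ev b) \<le> norm (ev b) / 2"
      proof (rule norm_blinfun_bound)
        fix x :: "'u \<Rightarrow>\<^sub>L real"
        show "norm (blinfun_apply (ev b) x) \<le> norm (ev b) / 2 * norm x"
        proof (cases "x = 0")
          case True then show ?thesis by simp
        next
          case nz: False
          have "\<bar>blinfun_apply (x /\<^sub>R norm x) b\<bar> < norm (ev b) / 2"
            using neg nz by (metis linorder_not_less norm_scaleR abs_inverse abs_norm_cancel
                left_inverse norm_eq_zero order_refl)
          then show ?thesis using nz
            by (simp add: ev scaleR_blinfun.rep_eq abs_mult field_simps)
        qed
      qed simp
      then show False using False by simp
    qed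
  qed
  then obtain x where x: "\<And>b. norm (x b) \<le> 1" "\<And>b. norm (ev b) / 2 \<le> \<bar>blinfun_apply (x b) b\<bar>"
    by metis
  define D where "D = rational_span (x ` B)"
  have "closure (span (x ` B)) = UNIV"
  proof (rule ccontr)
    assume "closure (span (x ` B)) \<noteq> UNIV"
    then obtain x0 where x0: "x0 \<notin> closure (span (x ` B))" by blast
    obtain \<Phi> :: "('u \<Rightarrow>\<^sub>L real) \<Rightarrow>\<^sub>L real" where \<Phi>: "\<forall>y\<in>span (x ` B). blinfun_apply \<Phi> y = 0" "blinfun_apply \<Phi> x0 > 0"
      using separating_functional[OF subspace_span x0] by blast
    obtain u where u: "\<And>y. blinfun_apply \<Phi> y = blinfun_apply y u"
      using refl unfolding reflexive_space_def by blast
    have \<Phi>u: "\<Phi> = ev u" by (rule blinfun_eqI) (simp add: ev u)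
    \<comment> \<open>\<open>x b\<close> kills \<open>u\<close>, so \<open>norm (ev b)\<close> is at
      most \<open>2 * norm (b - u)\<close>, the 2 undoing the half above; the triangle inequality
      adds the third summand.\<close>
    have small: "norm (ev u) \<le> 3 * norm (b - u)" if b: "b \<in> B" for b
    proof -
      have "blinfun_apply (x b) u = 0" using \<Phi>(1) u b by (simp add: span_base)
      then have "\<bar>blinfun_apply (x b) b\<bar> = \<bar>blinfun_apply (x b) (b - u)\<bar>"
        by (simp add: blinfun.diff_right)
      also have "\<dots> \<le> norm (x b) * norm (b - u)"
        using norm_blinfun[of "x b" "b - u"] by simp
      also have "\<dots> \<le> 1 * norm (b - u)" by (rule mult_right_mono[OF x(1)]) simp
      finally have "norm (ev b) \<le> 2 * norm (b - u)" using x(2)[of b] by simp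
      moreover have "norm (ev u) \<le> norm (ev b) + norm (ev b - ev u)"
        by (metis norm_triangle_sub norm_minus_commute)
      moreover have "norm (ev b - ev u) \<le> norm (b - u)" unfolding ev_diff by (rule ev_norm)
      ultimately show ?thesis by linarith
    qed
    have "norm (ev u) \<le> 0"
    proof (rule field_le_epsilon)
      fix e :: real assume "e > 0"
      then have "e / 3 > 0" by simp
      moreover have "u \<in> closure B" using B by simp
      ultimately obtain b where "b \<in> B" "dist b u < e / 3"
        unfolding closure_approachable by blast
      then show "norm (ev u) \<le> 0 + e" using small[of b] by (simp add: dist_norm)
    qed
    then have "\<Phi> = 0" using \<Phi>u by simp
    then show False using \<Phi>(2) by simp
  qed
  then have "closure D = UNIV"
    using closure_rational_span[of "x ` B"] closure_mono[of "span (x ` B)" "closure D"]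
    by (auto simp: D_def)
  moreover have "countable D" using B unfolding D_def by (intro countable_rational_span) auto
  ultimately show thesis using that by blast
qed

text \<open>A Pettis-type argument. Preimages of closed balls are measurable because the norm bound
  is a countable conjunction of scalar conditions over a dense set of \<open>h\<close>. Separability
  of the dual writes every open set as a countable union of closed balls with centres in
  \<open>D\<close> and rational radii.\<close>

lemma borel_measurable_blinfunI:
  fixes s :: "'v \<Rightarrow> ('u::real_normed_vector \<Rightarrow>\<^sub>L real)"
  assumes sepdual: "countable (D :: ('u::real_normed_vector \<Rightarrow>\<^sub>L real) set)" "closure D = UNIV"
    and sep: "separable_space TYPE('u::real_normed_vector)"
    and s: "\<And>h. (\<lambda>v. blinfun_apply (s v) h) \<in> borel_measurable M"
  shows "s \<in> borel_measurable M"
proof (rule borel_measurableI)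
  obtain B :: "'u set" where B: "countable B" "closure B = UNIV"
    using sep unfolding separable_space_def by blast
  have ball: "{v \<in> space M. norm (s v - a) \<le> r} \<in> sets M" for a and r :: real
  proof (cases "r \<ge> 0")
    case True
    have eq: "norm y \<le> r \<longleftrightarrow> (\<forall>h\<in>B. \<bar>blinfun_apply y h\<bar> \<le> r * norm h)" for y :: "'u \<Rightarrow>\<^sub>L real"
    proof
      assume "norm y \<le> r"
      then show "\<forall>h\<in>B. \<bar>blinfun_apply y h\<bar> \<le> r * norm h"
        by (metis norm_blinfun mult_right_mono norm_ge_zero order_trans real_norm_def)
    next
      assume *: "\<forall>h\<in>B. \<bar>blinfun_apply y h\<bar> \<le> r * norm h"
      show "norm y \<le> r"
      proof (rule norm_blinfun_bound[OF True])
        fix h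
        have "closed {h. norm (blinfun_apply y h) \<le> r * norm h}"
          by (intro closed_Collect_le continuous_intros)
        moreover have "B \<subseteq> {h. norm (blinfun_apply y h) \<le> r * norm h}" using * by auto
        ultimately have "closure B \<subseteq> {h. norm (blinfun_apply y h) \<le> r * norm h}"
          by (rule closure_minimal[rotated])
        then show "norm (blinfun_apply y h) \<le> r * norm h" using B by auto
      qed
    qed
    have "{v \<in> space M. norm (s v - a) \<le> r} =
        {v \<in> space M. \<forall>h\<in>B. \<bar>blinfun_apply (s v) h - blinfun_apply a h\<bar> \<le> r * norm h}"
      by (simp add: eq minus_blinfun.rep_eq)
    also have "\<dots> \<in> sets M"
    proof (rule sets.sets_Collect_countable_All'[OF _ B(1)])
      fix h
      have [measurable]: "(\<lambda>v. blinfun_apply (s v) h) \<in> borel_measurable M" by (rule s)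
      show "{v \<in> space M. \<bar>blinfun_apply (s v) h - blinfun_apply a h\<bar> \<le> r * norm h} \<in> sets M"
        by measurable
    qed
    finally show ?thesis .
  next
    case False
    then have "\<not> norm (s v - a) \<le> r" for v using norm_ge_zero[of "s v - a"] by linarith
    then show ?thesis by simp
  qed
  fix S :: "('u \<Rightarrow>\<^sub>L real) set" assume S: "open S"
  define I where "I = {(a, q) \<in> D \<times> (UNIV :: rat set). cball a (real_of_rat q) \<subseteq> S}"
  have "countable I" unfolding I_def using sepdual(1)
    by (intro countable_subset[OF _ countable_SIGMA[of D "\<lambda>_. UNIV"]]) auto
  have "s -` S \<inter> space M = (\<Union>(a, q)\<in>I. {v \<in> space M. norm (s v - a) \<le> real_of_rat q})"
  proof (intro equalityI subsetI)
    fix v assume v: "v \<in> s -` S \<inter> space M"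
    then obtain e where e: "e > 0" "ball (s v) e \<subseteq> S" using S by (auto simp: open_contains_ball)
    obtain q where q: "0 < real_of_rat q" "real_of_rat q < e / 2"
      using of_rat_dense[of 0 "e / 2"] e by auto
    have "s v \<in> closure D" using sepdual by simp
    then obtain a where a: "a \<in> D" "dist a (s v) < real_of_rat q"
      using q unfolding closure_approachable by blast
    have "cball a (real_of_rat q) \<subseteq> ball (s v) e"
    proof
      fix y assume "y \<in> cball a (real_of_rat q)"
      then show "y \<in> ball (s v) e" using a q dist_triangle[of "s v" y a] by (simp add: dist_commute)
    qed
    then have "(a, q) \<in> I" using a e by (auto simp: I_def)
    moreover have "norm (s v - a) \<le> real_of_rat q" using a by (simp add: dist_norm norm_minus_commute)
    ultimately show "v \<in> (\<Union>(a, q)\<in>I. {v \<in> space M. norm (s v - a) \<le> real_of_rat q})"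
      using v by auto
  qed (auto simp: I_def dist_norm norm_minus_commute subset_iff)
  also have "\<dots> \<in> sets M"
    using \<open>countable I\<close> ball by (intro sets.countable_UN'') auto
  finally show "s -` S \<inter> space M \<in> sets M" .
qed

section \<open>Strassen selections\<close>

text \<open>Identities that hold almost everywhere can be collected only for countably many vectors
  and rational factors. This turns such a rationally linear function into a bounded functional by
  continuity.\<close>

lemma rational_linear_extension:
  fixes \<phi> :: "'u::real_normed_vector \<Rightarrow> real"
  assumes dense: "closure D = UNIV"
    and Dadd: "\<And>x y. x \<in> D \<Longrightarrow> y \<in> D \<Longrightarrow> x + y \<in> D"
    and Dscale: "\<And>x q. x \<in> D \<Longrightarrow> real_of_rat q *\<^sub>R x \<in> D"
    and add: "\<And>x y. x \<in> D \<Longrightarrow> y \<in> D \<Longrightarrow> \<phi> (x + y) = \<phi> x + \<phi> y"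
    and scale: "\<And>x q. x \<in> D \<Longrightarrow> \<phi> (real_of_rat q *\<^sub>R x) = real_of_rat q * \<phi> x"
    and bound: "\<And>x. x \<in> D \<Longrightarrow> \<phi> x \<le> C * norm x"
  shows "\<exists>b :: 'u \<Rightarrow>\<^sub>L real. \<forall>x\<in>D. blinfun_apply b x = \<phi> x"
proof -
  have neg: "- x \<in> D" "\<phi> (- x) = - \<phi> x" if "x \<in> D" for x
    using Dscale[OF that, of "-1"] scale[OF that, of "-1"] by auto
  have diff: "x - y \<in> D" "\<phi> (x - y) = \<phi> x - \<phi> y" if "x \<in> D" "y \<in> D" for x y
    using Dadd[OF that(1) neg(1)[OF that(2)]] add[OF that(1) neg(1)[OF that(2)]] neg(2)[OF that(2)]
    by auto
  have abs: "\<bar>\<phi> x\<bar> \<le> C * norm x" if "x \<in> D" for x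
    using bound[OF that] bound[OF neg(1)[OF that]] neg(2)[OF that] by simp
  have lip: "\<bar>\<phi> x - \<phi> y\<bar> \<le> C * norm (x - y)" if "x \<in> D" "y \<in> D" for x y
    using abs[OF diff(1)[OF that]] diff(2)[OF that] by simp
  have "\<exists>f. (\<forall>n. f n \<in> D) \<and> f \<longlonglongrightarrow> h" for h
    using dense closure_sequential[of h D] by auto
  then obtain f where f: "\<And>h n. f h n \<in> D" "\<And>h. f h \<longlonglongrightarrow> h" by metis
  have null: "(\<lambda>n. \<phi> (e n) - \<phi> (f h n)) \<longlonglongrightarrow> 0" if e: "\<And>n. e n \<in> D" "e \<longlonglongrightarrow> h" for e h
  proof (rule Lim_null_comparison)
    show "\<forall>\<^sub>F n in sequentially. norm (\<phi> (e n) - \<phi> (f h n)) \<le> C * norm (e n - f h n)"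
      using lip[OF e(1) f(1)] by (simp add: always_eventually)
    have "(\<lambda>n. C * norm (e n - f h n)) \<longlonglongrightarrow> C * norm (h - h)"
      by (intro tendsto_intros e f)
    then show "(\<lambda>n. C * norm (e n - f h n)) \<longlonglongrightarrow> 0" by simp
  qed
  have "convergent (\<lambda>n. \<phi> (f h n))" for h
  proof -
    \<comment> \<open>The constant may be negative; then \<open>D\<close> contains at most the zero
      vector and the limits are trivial.\<close>
    have C: "C \<ge> 0 \<or> D \<subseteq> {0}"
    proof -
      have "C * norm x \<ge> 0" if "x \<in> D" for x using abs[OF that] by (meson abs_ge_zero order_trans)
      then show ?thesis by (metis insertI1 norm_le_zero_iff subsetI zero_le_mult_iff)
    qed
    show ?thesis
    proof (cases "C \<ge> 0")
      case False
      then have "f h n = 0" for n using C f(1) by blast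
      then show ?thesis by (simp add: convergent_const)
    next
      case True
      have "Cauchy (\<lambda>n. \<phi> (f h n))"
      proof (rule metric_CauchyI)
        fix e :: real assume e: "e > 0"
        have "Cauchy (f h)" using f(2) by (intro LIMSEQ_imp_Cauchy)
        then obtain K where K: "\<And>m n. m \<ge> K \<Longrightarrow> n \<ge> K \<Longrightarrow> dist (f h m) (f h n) < e / (C + 1)"
          using e True unfolding Cauchy_def by (metis add_nonneg_pos divide_pos_pos zero_less_one)
        have "dist (\<phi> (f h m)) (\<phi> (f h n)) < e" if "m \<ge> K" "n \<ge> K" for m n
        proof -
          have "dist (\<phi> (f h m)) (\<phi> (f h n)) \<le> C * dist (f h m) (f h n)"
            using lip[OF f(1) f(1)] by (simp add: dist_norm)
          also have "\<dots> \<le> C * (e / (C + 1))"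
            using K[OF that] True by (intro mult_left_mono) auto
          also have "\<dots> < e" using True e by (simp add: field_simps)
          finally show ?thesis .
        qed
        then show "\<exists>K. \<forall>m\<ge>K. \<forall>n\<ge>K. dist (\<phi> (f h m)) (\<phi> (f h n)) < e" by blast
      qed
      then show ?thesis by (rule Cauchy_convergent)
    qed
  qed
  define L where "L h = lim (\<lambda>n. \<phi> (f h n))" for h
  have Lf: "(\<lambda>n. \<phi> (f h n)) \<longlonglongrightarrow> L h" for h
    unfolding L_def using \<open>convergent (\<lambda>n. \<phi> (f h n))\<close> by (rule convergent_LIMSEQ_iff[THEN iffD1])
  have L: "(\<lambda>n. \<phi> (e n)) \<longlonglongrightarrow> L h" if e: "\<And>n. e n \<in> D" "e \<longlonglongrightarrow> h" for e h
    using tendsto_add[OF null[OF e] Lf[of h]] by simp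
  have "bounded_linear L"
  proof (rule bounded_linear_intro)
    fix x y
    have "(\<lambda>n. \<phi> (f x n + f y n)) \<longlonglongrightarrow> L (x + y)"
      using f by (intro L Dadd tendsto_intros)
    moreover have "(\<lambda>n. \<phi> (f x n + f y n)) \<longlonglongrightarrow> L x + L y"
      using f by (simp add: add) (intro tendsto_intros Lf)
    ultimately show "L (x + y) = L x + L y" by (rule LIMSEQ_unique)
  next
    fix r x
    have "r \<in> closure (range real_of_rat)"
      unfolding closure_approachable
    proof (intro allI impI)
      fix e :: real assume "e > 0"
      then obtain q where "r - e < real_of_rat q" "real_of_rat q < r + e"
        using of_rat_dense[of "r - e" "r + e"] by auto
      then show "\<exists>y\<in>range real_of_rat. dist y r < e"
        by (intro bexI[of _ "real_of_rat q"]) (auto simp: dist_real_def abs_less_iff)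
    qed
    then obtain c where c: "\<And>n. c n \<in> range real_of_rat" "c \<longlonglongrightarrow> r"
      unfolding closure_sequential by blast
    have "\<forall>n. \<exists>q. c n = real_of_rat q" using c(1) by blast
    then obtain q where q: "\<And>n. c n = real_of_rat (q n)" by metis
    have "(\<lambda>n. \<phi> (real_of_rat (q n) *\<^sub>R f x n)) \<longlonglongrightarrow> L (r *\<^sub>R x)"
      using f c(2) by (intro L Dscale) (auto simp flip: q intro: tendsto_intros)
    moreover have "(\<lambda>n. \<phi> (real_of_rat (q n) *\<^sub>R f x n)) \<longlonglongrightarrow> r * L x"
      unfolding scale[OF f(1)] unfolding q[symmetric] by (intro tendsto_intros Lf c(2))
    ultimately show "L (r *\<^sub>R x) = r *\<^sub>R L x" by (simp add: LIMSEQ_unique)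
  next
    fix x
    have "(\<lambda>n. C * norm (f x n)) \<longlonglongrightarrow> C * norm x" by (intro tendsto_intros f)
    moreover have "(\<lambda>n. norm (\<phi> (f x n))) \<longlonglongrightarrow> norm (L x)" by (intro tendsto_intros Lf)
    ultimately have "norm (L x) \<le> C * norm x"
      using abs f(1) by (intro LIMSEQ_le[of _ _ "\<lambda>n. C * norm (f x n)"]) auto
    then show "norm (L x) \<le> norm x * C" by (simp add: mult.commute)
  qed
  moreover have "L x = \<phi> x" if "x \<in> D" for x
    using L[of "\<lambda>n. x" x] that by (simp add: LIMSEQ_const_iff)
  ultimately show ?thesis
    by (intro exI[of _ "Blinfun L"]) (simp add: bounded_linear_Blinfun_apply)
qed

text \<open>Adding \<open>C\<close> times the measure makes \<open>N\<close> nonnegative, and the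
  sum is at most \<open>2 * C\<close> times the measure, so it is continuous at the empty set and
  finite additivity becomes countable. Subtracting \<open>C\<close> from the Radon-Nikodym density
  undoes the shift.\<close>

lemma (in finite_measure) dominated_additive_density:
  fixes N :: "'a set \<Rightarrow> real"
  assumes add: "\<And>A B. A \<in> sets M \<Longrightarrow> B \<in> sets M \<Longrightarrow> A \<inter> B = {} \<Longrightarrow> N (A \<union> B) = N A + N B"
    and bound: "\<And>A. A \<in> sets M \<Longrightarrow> \<bar>N A\<bar> \<le> C * measure M A" and C: "C \<ge> 0"
  shows "\<exists>a. integrable M a \<and> (\<forall>A\<in>sets M. N A = (\<integral>x\<in>A. a x \<partial>M))"
proof -
  define m where "m A = ennreal (N A + C * measure M A)" for A
  have nn: "0 \<le> N A + C * measure M A" if "A \<in> sets M" for A using bound[OF that] by linarith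
  have "N {} = 0" using add[of "{}" "{}"] by simp
  then have pos: "positive (sets M) m" by (simp add: positive_def m_def)
  have "Measure_Space.additive (sets M) m"
    unfolding Measure_Space.additive_def
  proof (intro ballI impI)
    fix A B assume AB: "A \<in> sets M" "B \<in> sets M" "A \<inter> B = {}"
    have "N (A \<union> B) + C * measure M (A \<union> B) = (N A + C * measure M A) + (N B + C * measure M B)"
      using AB by (simp add: add finite_measure_Union distrib_left)
    then show "m (A \<union> B) = m A + m B"
      using AB nn unfolding m_def by (simp add: ennreal_plus)
  qed
  then have ca: "countably_additive (sets M) m"
  proof (rule sets.empty_continuous_imp_countably_additive[OF pos])
    fix A :: "nat \<Rightarrow> 'a set"
    assume A: "range A \<subseteq> sets M" "decseq A" "(\<Inter>i. A i) = {}"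
    have "(\<lambda>i. measure M (A i)) \<longlonglongrightarrow> measure M (\<Inter>i. A i)"
      by (rule finite_Lim_measure_decseq) (use A in auto)
    then have "(\<lambda>i. ennreal (2 * C * measure M (A i))) \<longlonglongrightarrow> ennreal (2 * C * 0)"
      using A by (intro tendsto_intros) auto
    then have "(\<lambda>i. ennreal (2 * C * measure M (A i))) \<longlonglongrightarrow> 0" by simp
    moreover have "m (A i) \<le> ennreal (2 * C * measure M (A i))" for i
      unfolding m_def using A(1) bound[of "A i"] by (intro ennreal_leI) auto
    ultimately show "(\<lambda>i. m (A i)) \<longlonglongrightarrow> 0"
      by (intro tendsto_sandwich[where f="\<lambda>_. 0" and g="\<lambda>i. m (A i)"]) auto
  qed (auto simp: m_def)
  define K where "K = measure_of (space M) (sets M) m"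
  have sets_K: "sets K = sets M" and space_K: "space K = space M" by (auto simp: K_def)
  have em: "emeasure K A = m A" if "A \<in> sets M" for A
    unfolding K_def using that pos ca
    by (intro emeasure_measure_of_sigma) (auto simp: sets.sigma_algebra_axioms)
  have fin: "finite_measure K"
    by (rule finite_measureI) (simp add: em space_K m_def)
  interpret K: finite_measure K by (rule fin)
  have ac: "absolutely_continuous M K"
    unfolding absolutely_continuous_def
  proof
    fix A assume A: "A \<in> null_sets M"
    then have "A \<in> sets M" "measure M A = 0" by (auto simp: null_sets_def measure_def)
    then show "A \<in> null_sets K" using em[of A] bound[of A]
      by (auto simp: null_sets_def sets_K m_def)
  qed
  obtain d where d: "d \<in> borel_measurable M" "AE x in M. RN_deriv M K x = ennreal (d x)" "\<And>x. 0 \<le> d x"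
    using real_RN_deriv[OF fin ac sets_K] by blast
  have [measurable]: "d \<in> borel_measurable M" by (rule d)
  have K: "K = density M (\<lambda>x. ennreal (d x))"
    using density_RN_deriv[OF ac sets_K] d(2) density_cong[of "RN_deriv M K" M "\<lambda>x. ennreal (d x)"]
    by simp
  have "(\<integral>\<^sup>+x. ennreal (d x) \<partial>M) = emeasure (density M (\<lambda>x. ennreal (d x))) (space M)"
    by (simp add: emeasure_density cong: nn_integral_cong)
  also have "\<dots> < \<infinity>"
    unfolding K[symmetric] using K.emeasure_finite[of "space M"] by (simp add: less_top[symmetric])
  finally have int: "integrable M d"
    by (intro integrableI_nonneg) (auto simp: d(3))
  have eq: "N A + C * measure M A = (\<integral>x\<in>A. d x \<partial>M)" if A: "A \<in> sets M" for A
  proof -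
    have "ennreal (N A + C * measure M A) = (\<integral>\<^sup>+x. ennreal (d x) * indicator A x \<partial>M)"
      using em[OF A] A by (simp add: m_def K emeasure_density)
    also have "\<dots> = (\<integral>\<^sup>+x. ennreal (indicator A x * d x) \<partial>M)"
      by (intro nn_integral_cong) (auto split: split_indicator)
    also have "\<dots> = ennreal (\<integral>x. indicator A x * d x \<partial>M)"
      using A d int by (intro nn_integral_eq_integral) (auto intro: integrable_real_mult_indicator simp: mult.commute)
    finally show ?thesis
      using nn[OF A] d(3) by (simp add: set_lebesgue_integral_def)
  qed
  show ?thesis
  proof (intro exI conjI ballI)
    show "integrable M (\<lambda>x. d x - C)" using int by auto
    fix A assume A: "A \<in> sets M"
    have "(\<integral>x\<in>A. (d x - C) \<partial>M) = (\<integral>x\<in>A. d x \<partial>M) - (\<integral>x\<in>A. C \<partial>M)"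
      by (intro set_integral_diff; unfold set_integrable_def;
          intro integrable_mult_indicator A int integrable_const)
    also have "(\<integral>x\<in>A. C \<partial>M) = C * measure M A" using A by (simp add: set_lebesgue_integral_def)
    finally show "N A = (\<integral>x\<in>A. (d x - C) \<partial>M)" using eq[OF A] by simp
  qed
qed

lemma AE_le_of_set_integral_le:
  fixes f g :: "'a \<Rightarrow> real"
  assumes [measurable]: "integrable M f" "integrable M g"
    and le: "\<And>A. A \<in> sets M \<Longrightarrow> (\<integral>x\<in>A. f x \<partial>M) \<le> (\<integral>x\<in>A. g x \<partial>M)"
  shows "AE x in M. f x \<le> g x"
proof -
  define A where "A = {x \<in> space M. g x < f x}"
  then have [measurable]: "A \<in> sets M" by simp
  have si: "set_integrable M A f" "set_integrable M A g"
    unfolding set_integrable_def by (intro integrable_mult_indicator assms; simp)+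
  have "(\<integral>x\<in>A. (f x - g x) \<partial>M) = (\<integral>x\<in>A. f x \<partial>M) - (\<integral>x\<in>A. g x \<partial>M)"
    by (rule set_integral_diff) (rule si)+
  then have "(\<integral>x\<in>A. (f x - g x) \<partial>M) \<le> 0" using le[of A] by simp
  moreover have "(\<integral>x\<in>A. (f x - g x) \<partial>M) \<ge> 0"
    unfolding set_lebesgue_integral_def
    by (intro Bochner_Integration.integral_nonneg) (auto simp: A_def split: split_indicator)
  ultimately have "A \<in> null_sets M"
    using null_if_pos_func_has_zero_int[of M "\<lambda>x. f x - g x" A] assms by (auto simp: A_def)
  then have "AE x in M. x \<notin> A" by (simp add: AE_not_in)
  then show ?thesis unfolding A_def by auto
qed

text \<open>Only measurability of \<open>p\<close> in \<open>v\<close> for fixed \<open>h\<close> is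
  available, not joint measurability. Finitely many values of \<open>f\<close> reduce the composite
  to a finite sum; this is the reason for extending over simple functions.\<close>

lemma borel_measurable_simple_argument:
  assumes f: "simple_function M f" and p: "\<And>h. (\<lambda>v. p v h) \<in> borel_measurable M"
  shows "(\<lambda>v. p v (f v) :: real) \<in> borel_measurable M"
proof -
  have fin: "finite (f ` space M)" using f by (rule simple_functionD)
  have [measurable]: "f -` {y} \<inter> space M \<in> sets M" for y using f by (rule simple_functionD)
  note p[measurable]
  have "(\<lambda>v. \<Sum>y\<in>f ` space M. indicator (f -` {y} \<inter> space M) v * p v y) \<in> borel_measurable M"
    by measurable
  moreover have "(\<Sum>y\<in>f ` space M. indicator (f -` {y} \<inter> space M) v * p v y) = p v (f v)"
    if "v \<in> space M" for v
  proof -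
    have "(\<Sum>y\<in>f ` space M. indicator (f -` {y} \<inter> space M) v * p v y)
        = (\<Sum>y\<in>f ` space M. if y = f v then p v y else 0)"
      using that by (intro sum.cong) (auto simp: indicator_def)
    also have "\<dots> = p v (f v)" using fin that by (simp add: sum.delta')
    finally show ?thesis .
  qed
  ultimately show ?thesis by (simp cong: measurable_cong)
qed

text \<open>Extend \<open>y\<close>, read as a functional on constant functions, by Hahn-Banach to all simple functions
  \<open>f\<close>, dominated by \<open>\<integral> p v (f v)\<close>. The Radon-Nikodym densities of the set functions
  \<open>A \<mapsto> F (indicator A *\<^sub>R h)\<close>, with \<open>h\<close> in a countable dense rational subspace, are the selection.\<close>

theorem strassen_selection:
  fixes p :: "'v \<Rightarrow> 'u::real_normed_vector \<Rightarrow> real" and y :: "'u \<Rightarrow>\<^sub>L real"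
  assumes fin: "finite_measure M" and sep: "separable_space TYPE('u)"
    and sub: "\<And>v. sublinear_on UNIV (p v)"
    and meas: "\<And>h. (\<lambda>v. p v h) \<in> borel_measurable M"
    and bound: "\<And>v h. p v h \<le> C * norm h" and C: "C \<ge> 0"
    and le: "\<And>h. blinfun_apply y h \<le> (\<integral>v. p v h \<partial>M)"
  shows "\<exists>s :: 'v \<Rightarrow> ('u \<Rightarrow>\<^sub>L real). (AE v in M. \<forall>h. blinfun_apply (s v) h \<le> p v h) \<and>
    (\<forall>h. integrable M (\<lambda>v. blinfun_apply (s v) h) \<and> blinfun_apply y h = (\<integral>v. blinfun_apply (s v) h \<partial>M))"
proof -
  interpret finite_measure M by (rule fin)
  note sl = sublinear_on_scale[OF subspace_UNIV sub]
  have p_abs: "\<bar>p v h\<bar> \<le> C * norm h" for v h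
    using bound[of v h] bound[of v "- h"] sublinear_on_lower[OF subspace_UNIV sub, of h v] by simp
  have p_add: "p v (h + k) \<le> p v h + p v k" for v h k using sub[of v] by (auto simp: sublinear_on_def)
  have p0: "p v 0 = 0" for v by (rule sublinear_on_zero[OF subspace_UNIV sub])
  define X where "X = {f :: 'v \<Rightarrow> 'u. simple_function M f}"
  define P where "P f = (\<integral>v. p v (f v) \<partial>M)" for f :: "'v \<Rightarrow> 'u"
  have Xconst: "(\<lambda>_. h) \<in> X" for h by (simp add: X_def)
  have Xadd: "f + g \<in> X" if "f \<in> X" "g \<in> X" for f g
    using simple_function_compose2[of M f g "(+)"] that by (simp add: X_def plus_fun_def)
  have Xscale: "c *\<^sub>R f \<in> X" if "f \<in> X" for f c
    using simple_function_compose1[of M f "\<lambda>x. c *\<^sub>R x"] that by (simp add: X_def scaleR_fun_def)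
  have X: "subspace X"
    unfolding subspace_def using Xconst[of 0] Xadd Xscale by (auto simp: zero_fun_def)
  have Xind: "(\<lambda>v. indicator A v *\<^sub>R h) \<in> X" if "A \<in> sets M" for A h
    using simple_function_compose1[OF simple_function_indicator[OF that], of "\<lambda>x::real. x *\<^sub>R h"]
    by (simp add: X_def)
  have Pmeas: "(\<lambda>v. p v (f v)) \<in> borel_measurable M" if "f \<in> X" for f
    by (rule borel_measurable_simple_argument[where p = p and f = f, OF _ meas]) (use that in \<open>simp add: X_def\<close>)
  have Pint: "integrable M (\<lambda>v. p v (f v))" if f: "f \<in> X" for f
  proof -
    have "finite (norm ` f ` space M)"
      using f simple_functionD(1)[of M f] by (simp add: X_def)
    then have "finite ((\<lambda>x. norm (f x)) ` space M)" by (simp only: image_image)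
    then have "norm (f v) \<le> Max ((\<lambda>x. norm (f x)) ` space M)" if "v \<in> space M" for v
      using that by (intro Max_ge) auto
    then obtain K where K: "\<And>v. v \<in> space M \<Longrightarrow> norm (f v) \<le> K" by blast
    show ?thesis
    proof (rule integrable_const_bound[OF _ Pmeas[OF f], of "C * K"])
      show "AE v in M. norm (p v (f v)) \<le> C * K"
      proof (rule AE_I2)
        fix v assume "v \<in> space M"
        then have "C * norm (f v) \<le> C * K" using K C by (intro mult_left_mono)
        then show "norm (p v (f v)) \<le> C * K" using p_abs[of v "f v"] by simp
      qed
    qed
  qed
  have Psub: "sublinear_on X P"
    unfolding sublinear_on_def
  proof (intro conjI ballI allI impI)
    fix f g assume fg: "f \<in> X" "g \<in> X"
    have "P (f + g) \<le> (\<integral>v. p v (f v) + p v (g v) \<partial>M)"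
      unfolding P_def
      by (intro integral_mono Pint[OF Xadd[OF fg]] Bochner_Integration.integrable_add Pint fg) (simp add: p_add)
    then show "P (f + g) \<le> P f + P g"
      unfolding P_def using fg by (simp add: Pint)
  next
    fix f and t :: real assume "f \<in> X" "t > 0"
    then show "P (t *\<^sub>R f) \<le> t * P f"
      by (simp add: P_def scaleR_fun_def sl)
  qed
  define S where "S = range (\<lambda>h (_ :: 'v). h :: 'u)"
  \<comment> \<open>Evaluation at an arbitrary point: \<phi> matters on constant functions
    only.\<close>
  define \<phi> where "\<phi> f = blinfun_apply y (f undefined)" for f :: "'v \<Rightarrow> 'u"
  have S: "subspace S"
    unfolding subspace_def S_def
    by (auto simp: zero_fun_def plus_fun_def scaleR_fun_def image_iff fun_eq_iff)
  obtain F where F: "\<And>f g. f \<in> X \<Longrightarrow> g \<in> X \<Longrightarrow> F (f + g) = F f + F g"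
    "\<And>f c. f \<in> X \<Longrightarrow> F (c *\<^sub>R f) = c * F f"
    "\<And>f. f \<in> X \<Longrightarrow> F f \<le> P f" "\<And>f. f \<in> S \<Longrightarrow> F f = \<phi> f"
  proof (rule hahn_banach_dominated[OF X Psub S, of \<phi>])
    show "S \<subseteq> X" using Xconst by (auto simp: S_def)
    show "\<phi> f \<le> P f" if "f \<in> S" for f
      using that le by (auto simp: S_def \<phi>_def P_def)
  qed (auto simp: \<phi>_def plus_fun_def scaleR_fun_def blinfun.add_right blinfun.scaleR_right)
  have Fneg: "F (- f) = - F f" if "f \<in> X" for f using F(2)[OF that, of "-1"] by simp
  have ind_neg: "- (\<lambda>v. indicator A v *\<^sub>R h) = (\<lambda>v. indicator A v *\<^sub>R (- h))"
    for A :: "'v set" and h :: 'u by (auto simp: fun_eq_iff)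
  \<comment> \<open>Outside \<open>A\<close> the argument is 0 and \<open>p v 0 = 0\<close>, so the
    domination by \<open>P\<close> localises to \<open>A\<close>. Ranging over all \<open>A\<close>,
    it becomes an almost everywhere bound on densities.\<close>
  have Find: "F (\<lambda>v. indicator A v *\<^sub>R h) \<le> (\<integral>v\<in>A. p v h \<partial>M)" if A: "A \<in> sets M" for A h
  proof -
    have "F (\<lambda>v. indicator A v *\<^sub>R h) \<le> P (\<lambda>v. indicator A v *\<^sub>R h)" by (rule F(3)[OF Xind[OF A]])
    also have "\<dots> = (\<integral>v\<in>A. p v h \<partial>M)"
      unfolding P_def set_lebesgue_integral_def
      by (intro Bochner_Integration.integral_cong) (auto simp: p0 split: split_indicator)
    finally show ?thesis .
  qed
  have pint: "integrable M (\<lambda>v. p v h)" for h using Pint[OF Xconst] .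
  have Fbound: "F (\<lambda>v. indicator A v *\<^sub>R h) \<le> C * norm h * measure M A" if A: "A \<in> sets M" for A h
  proof -
    have "(\<integral>v\<in>A. p v h \<partial>M) \<le> (\<integral>v\<in>A. C * norm h \<partial>M)"
      by (intro set_integral_mono bound; unfold set_integrable_def;
          intro integrable_mult_indicator A pint integrable_const)
    also have "\<dots> = C * norm h * measure M A" using A by (simp add: set_lebesgue_integral_def)
    finally show ?thesis using Find[OF A, of h] by linarith
  qed
  have "\<exists>a. integrable M a \<and> (\<forall>A\<in>sets M. F (\<lambda>v. indicator A v *\<^sub>R h) = (\<integral>x\<in>A. a x \<partial>M))" for h
  proof (rule dominated_additive_density[of _ "C * norm h"])
    fix A B assume AB: "A \<in> sets M" "B \<in> sets M" "A \<inter> B = {}"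
    have "(\<lambda>v. indicator (A \<union> B) v *\<^sub>R h) = (\<lambda>v. indicator A v *\<^sub>R h) + (\<lambda>v. indicator B v *\<^sub>R h)"
      using AB(3) by (auto simp: fun_eq_iff split: split_indicator)
    then show "F (\<lambda>v. indicator (A \<union> B) v *\<^sub>R h) = F (\<lambda>v. indicator A v *\<^sub>R h) + F (\<lambda>v. indicator B v *\<^sub>R h)"
      using F(1)[OF Xind[OF AB(1)] Xind[OF AB(2)]] by simp
  next
    fix A assume A: "A \<in> sets M"
    have "- F (\<lambda>v. indicator A v *\<^sub>R h) = F (\<lambda>v. indicator A v *\<^sub>R (- h))"
      unfolding ind_neg[symmetric] by (rule Fneg[OF Xind[OF A], symmetric])
    also have "\<dots> \<le> C * norm h * measure M A" using Fbound[OF A, of "- h"] by simp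
    finally show "\<bar>F (\<lambda>v. indicator A v *\<^sub>R h)\<bar> \<le> C * norm h * measure M A"
      using Fbound[OF A, of h] by linarith
  qed (use C in simp)
  then obtain a where aint: "\<And>h. integrable M (a h)"
    and a: "\<And>h A. A \<in> sets M \<Longrightarrow> F (\<lambda>v. indicator A v *\<^sub>R h) = (\<integral>x\<in>A. a h x \<partial>M)"
    by metis
  have si: "set_integrable M A (a h)" if "A \<in> sets M" for A h
    unfolding set_integrable_def by (intro integrable_mult_indicator aint that)
  have a_add: "AE v in M. a (h + k) v = a h v + a k v" for h k
  proof (rule density_unique_real)
    fix A assume A: "A \<in> sets M"
    have "(\<lambda>v. indicator A v *\<^sub>R (h + k)) = (\<lambda>v. indicator A v *\<^sub>R h) + (\<lambda>v. indicator A v *\<^sub>R k)"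
      by (auto simp: fun_eq_iff algebra_simps)
    then have "(\<integral>x\<in>A. a (h + k) x \<partial>M) = (\<integral>x\<in>A. a h x \<partial>M) + (\<integral>x\<in>A. a k x \<partial>M)"
      using F(1)[OF Xind[OF A] Xind[OF A]] A by (simp flip: a)
    then show "(\<integral>x\<in>A. a (h + k) x \<partial>M) = (\<integral>x\<in>A. a h x + a k x \<partial>M)"
      using si[OF A] by (simp add: set_integral_add)
  qed (auto intro: aint)
  have a_scale: "AE v in M. a (c *\<^sub>R h) v = c * a h v" for c h
  proof (rule density_unique_real)
    fix A assume A: "A \<in> sets M"
    have "(\<lambda>v. indicator A v *\<^sub>R (c *\<^sub>R h)) = c *\<^sub>R (\<lambda>v. indicator A v *\<^sub>R h)"
      by (auto simp: fun_eq_iff scaleR_fun_def)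
    then have "(\<integral>x\<in>A. a (c *\<^sub>R h) x \<partial>M) = c * (\<integral>x\<in>A. a h x \<partial>M)"
      using F(2)[OF Xind[OF A]] A by (simp flip: a)
    then show "(\<integral>x\<in>A. a (c *\<^sub>R h) x \<partial>M) = (\<integral>x\<in>A. c * a h x \<partial>M)" by simp
  qed (auto intro: aint)
  have a_le: "AE v in M. a h v \<le> p v h" for h
    by (rule AE_le_of_set_integral_le[OF aint pint]) (use Find in \<open>simp flip: a\<close>)
  obtain B :: "'u set" where B: "countable B" "closure B = UNIV"
    using sep unfolding separable_space_def by blast
  define D where "D = rational_span B"
  have cD: "countable D" unfolding D_def by (rule countable_rational_span[OF B(1)])
  have "B \<subseteq> D" unfolding D_def using rational_span_base by blast
  then have dense: "closure D = UNIV" using closure_mono[of B D] B(2) by auto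
  have Dadd: "x + z \<in> D" if "x \<in> D" "z \<in> D" for x z
    using that unfolding D_def by (rule rational_span_add)
  have Dscale: "real_of_rat q *\<^sub>R x \<in> D" if "x \<in> D" for x q
    using that unfolding D_def by (rule rational_span_scale)
  \<comment> \<open>The exceptional null sets of the separate identities are united over countably
    many instances; on the remaining points the densities are rationally linear in
    \<open>h\<close>.\<close>
  define good where "good v \<longleftrightarrow> (\<forall>h\<in>D. a h v \<le> p v h) \<and> (\<forall>h\<in>D. \<forall>k\<in>D. a (h + k) v = a h v + a k v) \<and>
     (\<forall>h\<in>D. \<forall>q. a (real_of_rat q *\<^sub>R h) v = real_of_rat q * a h v)" for v
  have AE_good: "AE v in M. good v"
    unfolding good_def
    by (intro AE_conjI AE_ball_countable[OF cD, THEN iffD2] ballI AE_all_countable[THEN iffD2] allI a_le a_add a_scale)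
  have "\<exists>b :: 'u \<Rightarrow>\<^sub>L real. \<forall>h\<in>D. blinfun_apply b h = a h v" if "good v" for v
  proof (rule rational_linear_extension[OF dense Dadd Dscale, of "\<lambda>h. a h v" C])
    show "a h v \<le> C * norm h" if "h \<in> D" for h
      using \<open>good v\<close> that bound[of v h] unfolding good_def by force
  qed (use that in \<open>auto simp: good_def\<close>)
  then obtain b :: "'v \<Rightarrow> ('u \<Rightarrow>\<^sub>L real)" where b: "\<And>v h. good v \<Longrightarrow> h \<in> D \<Longrightarrow> blinfun_apply (b v) h = a h v"
    by metis
  define s where "s v = (if good v then b v else 0)" for v
  have [measurable]: "a h \<in> borel_measurable M" for h using aint by auto
  note meas[measurable]
  have good_meas: "{v \<in> space M. good v} \<in> sets M"
    unfolding good_def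
    by (intro sets.sets_Collect_conj sets.sets_Collect_countable_All'[OF _ cD] sets.sets_Collect_countable_All) measurable
  then have [measurable]: "Measurable.pred M good" by (simp add: pred_def)
  have "\<exists>f. (\<forall>n. f n \<in> D) \<and> f \<longlonglongrightarrow> h" for h
    using dense closure_sequential[of h D] by auto
  then obtain f where f: "\<And>h n. f h n \<in> D" "\<And>h. f h \<longlonglongrightarrow> h" by metis
  have lim: "(\<lambda>n. blinfun_apply (s v) (f h n)) \<longlonglongrightarrow> blinfun_apply (s v) h" for v h
    by (intro tendsto_intros f)
  have sD: "blinfun_apply (s v) h = (if good v then a h v else 0)" if "h \<in> D" for v h
    using b that by (simp add: s_def)
  have smD: "(\<lambda>v. blinfun_apply (s v) h) \<in> borel_measurable M" if "h \<in> D" for h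
    unfolding sD[OF that] by measurable
  have sm: "(\<lambda>v. blinfun_apply (s v) h) \<in> borel_measurable M" for h
    by (rule borel_measurable_LIMSEQ_real[OF lim smD[OF f(1)]])
  have plim: "(\<lambda>n. p v (f h n)) \<longlonglongrightarrow> p v h" for v h
  proof (rule LIM_zero_cancel, rule Lim_null_comparison)
    have "\<bar>p v x - p v z\<bar> \<le> C * norm (x - z)" for x z
      using p_add[of v z "x - z"] p_add[of v x "z - x"] bound[of v "x - z"] bound[of v "z - x"]
      by (simp add: norm_minus_commute)
    then show "\<forall>\<^sub>F n in sequentially. norm (p v (f h n) - p v h) \<le> C * norm (f h n - h)"
      by (simp add: always_eventually)
    have "(\<lambda>n. C * norm (f h n - h)) \<longlonglongrightarrow> C * norm (h - h)" by (intro tendsto_intros f)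
    then show "(\<lambda>n. C * norm (f h n - h)) \<longlonglongrightarrow> 0" by simp
  qed
  have s_le: "blinfun_apply (s v) h \<le> p v h" if "good v" for v h
    by (rule LIMSEQ_le[OF lim plim]) (use that f in \<open>auto simp: sD good_def\<close>)
  have s_abs: "\<bar>blinfun_apply (s v) h\<bar> \<le> C * norm h" for v h
  proof (cases "good v")
    case True
    have "blinfun_apply (s v) (- h) \<le> C * norm h"
      using s_le[OF True, of "- h"] bound[of v "- h"] by simp
    moreover have "blinfun_apply (s v) h \<le> C * norm h" using s_le[OF True, of h] bound[of v h] by simp
    ultimately show ?thesis by (simp add: blinfun.minus_right)
  next
    case False
    then show ?thesis using C by (simp add: s_def)
  qed
  have sint: "integrable M (\<lambda>v. blinfun_apply (s v) h)" for h
    by (rule integrable_const_bound[OF _ sm, of _ "C * norm h"]) (use s_abs in simp)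
  have eqD: "blinfun_apply y h = (\<integral>v. blinfun_apply (s v) h \<partial>M)" if h: "h \<in> D" for h
  proof -
    \<comment> \<open>\<open>F\<close> acts on functions on the whole type, while the densities only
      see \<open>space M\<close>. The constant function and its restriction by an indicator differ
      by \<open>d\<close>, which vanishes on \<open>space M\<close>; then
      \<open>P d = P (- d) = 0\<close>, and hence \<open>F d = 0\<close>.\<close>
    define d :: "'v \<Rightarrow> 'u" where "d = (\<lambda>v. h) + - (\<lambda>v. indicator (space M) v *\<^sub>R h)"
    have dX: "d \<in> X" "- d \<in> X" "- (\<lambda>v. indicator (space M) v *\<^sub>R h) \<in> X"
      unfolding d_def by (intro Xadd Xconst Xind subspace_neg[OF X] sets.top)+
    have "P d = 0" "P (- d) = 0"
      unfolding P_def by (auto simp: d_def p0 cong: Bochner_Integration.integral_cong)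
    then have "F d = 0" using F(3)[OF dX(1)] F(3)[OF dX(2)] Fneg[OF dX(1)] by simp
    then have "F (\<lambda>v. h) = F (\<lambda>v. indicator (space M) v *\<^sub>R h)"
      using F(1)[OF Xconst[of h] dX(3)] Fneg[OF Xind[OF sets.top, of h]] unfolding d_def by simp
    also have "\<dots> = (\<integral>v. a h v \<partial>M)"
      using a[OF sets.top, of h] aint by (simp add: set_integral_space)
    also have "\<dots> = (\<integral>v. blinfun_apply (s v) h \<partial>M)"
      using AE_good smD[OF h] by (intro integral_cong_AE) (auto simp: sD[OF h])
    finally show ?thesis using F(4)[of "\<lambda>v. h"] by (simp add: S_def \<phi>_def)
  qed
  have eq: "blinfun_apply y h = (\<integral>v. blinfun_apply (s v) h \<partial>M)" for h
  proof (rule LIMSEQ_unique)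
    show "(\<lambda>n. blinfun_apply y (f h n)) \<longlonglongrightarrow> blinfun_apply y h" by (intro tendsto_intros f)
    have "Bseq (f h)" using f(2) by (intro convergent_imp_Bseq convergentI)
    then obtain K where K: "\<And>n. norm (f h n) \<le> K" unfolding Bseq_def by blast
    have "(\<lambda>n. \<integral>v. blinfun_apply (s v) (f h n) \<partial>M) \<longlonglongrightarrow> (\<integral>v. blinfun_apply (s v) h \<partial>M)"
    proof (rule integral_dominated_convergence[of _ _ _ "\<lambda>_. C * K"])
      fix n
      have "norm (blinfun_apply (s v) (f h n)) \<le> C * K" for v
        using s_abs[of v "f h n"] mult_left_mono[OF K[of n] C] by simp
      then show "AE v in M. norm (blinfun_apply (s v) (f h n)) \<le> C * K" by simp
    qed (use sm lim in auto)
    then show "(\<lambda>n. blinfun_apply y (f h n)) \<longlonglongrightarrow> (\<integral>v. blinfun_apply (s v) h \<partial>M)"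
      by (simp add: eqD f(1))
  qed
  have "AE v in M. \<forall>h. blinfun_apply (s v) h \<le> p v h" using AE_good s_le by auto
  then show ?thesis using sint eq by blast
qed

section \<open>Clarke derivatives of integrals\<close>

lemma filterlim_nhds_at_right_0:
  fixes x :: "'u::real_normed_vector"
  assumes "y \<longlonglongrightarrow> x" "t \<longlonglongrightarrow> 0" "\<And>n. t n > (0::real)"
  shows "filterlim (\<lambda>n. (y n, t n)) (nhds x \<times>\<^sub>F at_right 0) sequentially"
proof -
  have "t n \<noteq> 0" for n using assms(3)[of n] by simp
  then show ?thesis using assms by (intro filterlim_Pair) (auto simp: filterlim_at)
qed

lemma clarke_dd_lessD:
  fixes f :: "'u::real_normed_vector \<Rightarrow> real"
  assumes "clarke_dd f x h < ereal b"
    and "y \<longlonglongrightarrow> x" "t \<longlonglongrightarrow> 0" "\<And>n. t n > 0"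
  shows "\<forall>\<^sub>F n in sequentially. (f (y n + t n *\<^sub>R h) - f (y n)) / t n < b"
proof -
  have "\<forall>\<^sub>F q in nhds x \<times>\<^sub>F at_right 0. (\<lambda>(y, t). ereal ((f (y + t *\<^sub>R h) - f y) / t)) q < ereal b"
    using assms(1) unfolding clarke_dd_def by (rule Limsup_lessD)
  from eventually_compose_filterlim[OF this filterlim_nhds_at_right_0[OF assms(2-4)]]
  show ?thesis by simp
qed

lemma clarke_dd_ge_sequence:
  fixes f :: "'u::real_normed_vector \<Rightarrow> real"
  assumes yt: "y \<longlonglongrightarrow> x" "t \<longlonglongrightarrow> 0" "\<And>n. t n > 0"
    and lim: "(\<lambda>n. (f (y n + t n *\<^sub>R h) - f (y n)) / t n) \<longlonglongrightarrow> c"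
  shows "ereal c \<le> clarke_dd f x h"
proof (rule ccontr)
  assume "\<not> ?thesis"
  then obtain b where b: "clarke_dd f x h < ereal b" "ereal b < ereal c"
    using ereal_dense2 by (metis not_le)
  have "\<forall>\<^sub>F n in sequentially. (f (y n + t n *\<^sub>R h) - f (y n)) / t n \<le> b"
    using clarke_dd_lessD[OF b(1) yt] by eventually_elim simp
  then have "c \<le> b" by (intro tendsto_upperbound[OF lim]) auto
  then show False using b(2) by simp
qed

text \<open>Dominated convergence works along sequences, so the upper limit over a product filter
  must be reached by them. A value \<open>b\<close> strictly between \<open>c\<close> and the upper
  limit is met frequently, and neighbourhoods of size 1/(n+1) yield a sequence with quotients at
  least \<open>b\<close> throughout.\<close>

lemma clarke_dd_le_sequences:
  fixes f :: "'u::real_normed_vector \<Rightarrow> real"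
  assumes seq: "\<And>y t b. y \<longlonglongrightarrow> x \<Longrightarrow> t \<longlonglongrightarrow> 0 \<Longrightarrow> (\<And>n. t n > 0) \<Longrightarrow>
      (\<And>n. b \<le> (f (y n + t n *\<^sub>R h) - f (y n)) / t n) \<Longrightarrow> b \<le> c"
  shows "clarke_dd f x h \<le> ereal c"
proof (rule ccontr)
  assume "\<not> ?thesis"
  then obtain b where b: "ereal c < ereal b" "ereal b < clarke_dd f x h"
    using ereal_dense2 by (metis not_le)
  let ?F = "nhds x \<times>\<^sub>F at_right (0::real)"
  let ?q = "\<lambda>y t. (f (y + t *\<^sub>R h) - f y) / t"
  have "\<not> (\<forall>\<^sub>F (y, t) in ?F. ?q y t < b)"
  proof
    assume "\<forall>\<^sub>F (y, t) in ?F. ?q y t < b"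
    then have "clarke_dd f x h \<le> ereal b"
      unfolding clarke_dd_def by (intro Limsup_bounded) (auto elim!: eventually_mono)
    then show False using b(2) by simp
  qed
  then have freq: "\<exists>\<^sub>F (y, t) in ?F. b \<le> ?q y t"
    by (simp add: frequently_def case_prod_unfold not_le)
  have "\<exists>y t. dist y x < 1 / real (Suc n) \<and> 0 < t \<and> t < 1 / real (Suc n) \<and> b \<le> ?q y t" for n
  proof -
    have "\<forall>\<^sub>F y in nhds x. dist y x < 1 / real (Suc n)"
      by (auto simp: eventually_nhds_metric intro!: exI[of _ "1 / real (Suc n)"])
    moreover have "\<forall>\<^sub>F t in at_right 0. 0 < t \<and> t < 1 / real (Suc n)"
      using eventually_at_right_real[of 0 "1 / real (Suc n)"] by simp
    ultimately have "\<forall>\<^sub>F (y, t) in ?F. dist y x < 1 / real (Suc n) \<and> 0 < t \<and> t < 1 / real (Suc n)"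
      using eventually_prodI by (force simp: case_prod_unfold)
    then have "\<exists>\<^sub>F (y, t) in ?F. b \<le> ?q y t \<and> dist y x < 1 / real (Suc n) \<and> 0 < t \<and> t < 1 / real (Suc n)"
      using frequently_eventually_frequently[OF freq] by (simp add: case_prod_unfold)
    then show ?thesis using frequently_ex[of "\<lambda>(y, t). b \<le> ?q y t \<and> dist y x < 1 / real (Suc n) \<and> 0 < t \<and> t < 1 / real (Suc n)"]
      by fastforce
  qed
  then obtain y t where yt: "\<And>n. dist (y n) x < 1 / real (Suc n)" "\<And>n. 0 < t n"
      "\<And>n. t n < 1 / real (Suc n)" "\<And>n. b \<le> ?q (y n) (t n)" by metis
  have inv: "(\<lambda>n. 1 / real (Suc n)) \<longlonglongrightarrow> 0" by (rule lim_1_over_n[THEN LIMSEQ_Suc])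
  have "y \<longlonglongrightarrow> x"
  proof (rule metric_tendsto_imp_tendsto[OF inv])
    show "\<forall>\<^sub>F n in sequentially. dist (y n) x \<le> dist (1 / real (Suc n)) 0"
      using yt(1) by (simp add: always_eventually less_imp_le)
  qed
  moreover have "t \<longlonglongrightarrow> 0"
    by (rule tendsto_sandwich[OF _ _ tendsto_const inv]) (use yt in \<open>auto intro!: always_eventually less_imp_le\<close>)
  ultimately have "b \<le> c" using yt by (intro seq[of y t b])
  then show False using b(1) by simp
qed

text \<open>For a concave \<open>f\<close> the Clarke derivative in direction \<open>h\<close> equals the ordinary one-sided derivative
  along \<open>- h\<close> with the sign reversed; the second conjunct records this through backward difference
  quotients along a sequence, which keeps the measurability in a parameter visible.\<close>

definition concave_regular :: "('u::real_normed_vector \<Rightarrow> real) \<Rightarrow> 'u \<Rightarrow> ('u \<Rightarrow> real) \<Rightarrow> bool" where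
  "concave_regular f x p \<longleftrightarrow> (\<forall>h. clarke_dd f x h = ereal (p h) \<and>
     (\<lambda>n. (f x - f (x - (1 / real (Suc n)) *\<^sub>R h)) / (1 / real (Suc n))) \<longlonglongrightarrow> p h)"

lemma inverse_Suc_seq: "(\<lambda>n. 1 / real (Suc n)) \<longlonglongrightarrow> 0" "1 / real (Suc n) > 0"
  by (rule lim_1_over_n[THEN LIMSEQ_Suc]) simp

text \<open>The backward quotient in direction \<open>h + k\<close> splits at the intermediate point
  \<open>x - r n *\<^sub>R h\<close>. Both pieces are Clarke quotients with base points tending to
  \<open>x\<close>, hence eventually below \<open>p h\<close> and \<open>p k\<close> up to an error,
  while the whole converges to \<open>p (h + k)\<close>.\<close>

lemma concave_regular_sublinear:
  fixes f :: "'u::real_normed_vector \<Rightarrow> real"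
  assumes reg: "concave_regular f x p"
  shows "sublinear_on UNIV p"
proof -
  define r where "r n = 1 / real (Suc n)" for n
  have r: "r \<longlonglongrightarrow> 0" "\<And>n. r n > 0"
    unfolding r_def by (rule inverse_Suc_seq)+
  have up: "clarke_dd f x h < ereal (p h + e)" if "e > 0" for h and e :: real
    using reg that by (simp add: concave_regular_def)
  have lim: "(\<lambda>n. (f x - f (x - r n *\<^sub>R h)) / r n) \<longlonglongrightarrow> p h" for h
    using reg by (simp add: concave_regular_def r_def)
  have x0: "(\<lambda>n. x - r n *\<^sub>R h) \<longlonglongrightarrow> x" for h
    using tendsto_diff[OF tendsto_const tendsto_scaleR[OF r(1) tendsto_const]] by force
  show ?thesis
    unfolding sublinear_on_def
  proof (intro conjI ballI allI impI)
    fix h k :: 'u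
    show "p (h + k) \<le> p h + p k"
    proof (rule field_le_epsilon)
      fix e :: real assume "e > 0"
      then have e: "e / 2 > 0" by simp
      have "\<forall>\<^sub>F n in sequentially. (f (x - r n *\<^sub>R h + r n *\<^sub>R h) - f (x - r n *\<^sub>R h)) / r n < p h + e / 2"
        by (rule clarke_dd_lessD[OF up[OF e] x0 r])
      moreover have "\<forall>\<^sub>F n in sequentially.
          (f (x - r n *\<^sub>R (h + k) + r n *\<^sub>R k) - f (x - r n *\<^sub>R (h + k))) / r n < p k + e / 2"
        by (rule clarke_dd_lessD[OF up[OF e] x0 r])
      ultimately have "\<forall>\<^sub>F n in sequentially. (f x - f (x - r n *\<^sub>R (h + k))) / r n \<le> p h + p k + e"
      proof eventually_elim
        case (elim n)
        have eq: "x - r n *\<^sub>R (h + k) + r n *\<^sub>R k = x - r n *\<^sub>R h" by (simp add: algebra_simps)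
        have "(f x - f (x - r n *\<^sub>R (h + k))) / r n
          = (f (x - r n *\<^sub>R h + r n *\<^sub>R h) - f (x - r n *\<^sub>R h)) / r n
            + (f (x - r n *\<^sub>R (h + k) + r n *\<^sub>R k) - f (x - r n *\<^sub>R (h + k))) / r n"
          unfolding eq by (simp add: add_divide_distrib[symmetric] del: scaleR_add_right)
        then show ?case using elim by linarith
      qed
      then show "p (h + k) \<le> p h + p k + e" by (intro tendsto_upperbound[OF lim]) auto
    qed
  next
    fix h :: 'u and c :: real assume c: "c > 0"
    show "p (c *\<^sub>R h) \<le> c * p h"
    proof (rule field_le_epsilon)
      fix e :: real assume "e > 0"
      then have e: "e / c > 0" using c by simp
      have rc: "(\<lambda>n. r n * c) \<longlonglongrightarrow> 0" "\<And>n. r n * c > 0"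
        using tendsto_mult[OF r(1) tendsto_const[of c]] r(2) c by auto
      have x1: "(\<lambda>n. x - (r n * c) *\<^sub>R h) \<longlonglongrightarrow> x"
        using tendsto_diff[OF tendsto_const tendsto_scaleR[OF rc(1) tendsto_const]] by force
      have "\<forall>\<^sub>F n in sequentially. (f (x - (r n * c) *\<^sub>R h + (r n * c) *\<^sub>R h) - f (x - (r n * c) *\<^sub>R h)) / (r n * c)
            < p h + e / c"
        by (rule clarke_dd_lessD[OF up[OF e] x1 rc])
      then have "\<forall>\<^sub>F n in sequentially. (f x - f (x - r n *\<^sub>R (c *\<^sub>R h))) / r n \<le> c * p h + e"
      proof eventually_elim
        case (elim n)
        have "(f x - f (x - r n *\<^sub>R (c *\<^sub>R h))) / r n = c * ((f x - f (x - (r n * c) *\<^sub>R h)) / (r n * c))"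
          using c by simp
        also have "\<dots> \<le> c * (p h + e / c)" using elim c by (intro mult_left_mono) auto
        finally show ?case using c by (simp add: distrib_left)
      qed
      then show "p (c *\<^sub>R h) \<le> c * p h + e" by (intro tendsto_upperbound[OF lim]) auto
    qed
  qed
qed

text \<open>The backward quotients use the same points for every \<open>v\<close>, so dominated
  convergence along them gives the lower bound. The upper bound is a reverse Fatou argument. The
  Lipschitz constant provides the dominating function for both.\<close>

lemma concave_regular_integral:
  fixes e :: "'u::real_normed_vector \<Rightarrow> 'v \<Rightarrow> real"
  assumes fin: "finite_measure M"
    and int: "\<And>u. integrable M (e u)"
    and \<delta>: "\<delta> > 0" and C: "C \<ge> 0"
    and lip: "\<And>u w v. u \<in> ball x \<delta> \<Longrightarrow> w \<in> ball x \<delta> \<Longrightarrow> \<bar>e u v - e w v\<bar> \<le> C * norm (u - w)"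
    and reg: "\<And>v. concave_regular (\<lambda>u. e u v) x (p v)"
  shows "integrable M (\<lambda>v. p v h)" "p v h \<le> C * norm h"
    "clarke_dd (\<lambda>u. \<integral>v. e u v \<partial>M) x h = ereal (\<integral>v. p v h \<partial>M)"
proof -
  interpret finite_measure M by (rule fin)
  have em[measurable]: "e u \<in> borel_measurable M" for u using int by auto
  have quot_bound: "\<bar>(e (y + t *\<^sub>R h) v - e y v) / t\<bar> \<le> C * norm h"
    if "y \<in> ball x \<delta>" "y + t *\<^sub>R h \<in> ball x \<delta>" "t > 0" for y t v
    using lip[OF that(2,1), of v] that(3) by (simp add: abs_divide field_simps)
  have ev: "\<forall>\<^sub>F n in sequentially. y n \<in> ball x \<delta> \<and> y n + t n *\<^sub>R h \<in> ball x \<delta>"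
    if "y \<longlonglongrightarrow> x" "t \<longlonglongrightarrow> 0" for y t
  proof -
    have "(\<lambda>n. y n + t n *\<^sub>R h) \<longlonglongrightarrow> x + 0 *\<^sub>R h" by (intro tendsto_intros that)
    then have "\<forall>\<^sub>F n in sequentially. y n + t n *\<^sub>R h \<in> ball x \<delta>"
      using \<delta> by (intro topological_tendstoD) auto
    moreover have "\<forall>\<^sub>F n in sequentially. y n \<in> ball x \<delta>"
      using \<delta> that by (intro topological_tendstoD) auto
    ultimately show ?thesis by eventually_elim simp
  qed
  define r where "r n = 1 / real (Suc n)" for n
  have r: "r \<longlonglongrightarrow> 0" "\<And>n. r n > 0" unfolding r_def by (rule inverse_Suc_seq)+
  have lim: "(\<lambda>n. (e x v - e (x - r n *\<^sub>R h) v) / r n) \<longlonglongrightarrow> p v h" for v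
    using reg[of v] by (simp add: concave_regular_def r_def)
  have x0: "(\<lambda>n. x - r n *\<^sub>R h) \<longlonglongrightarrow> x"
    using tendsto_diff[OF tendsto_const tendsto_scaleR[OF r(1) tendsto_const]] by force
  \<comment> \<open>Dropping the first \<open>N\<close> terms puts both points of every quotient
    into the ball on which the Lipschitz bound holds.\<close>
  obtain N where N: "\<And>n. n \<ge> N \<Longrightarrow> x - r n *\<^sub>R h \<in> ball x \<delta> \<and> x - r n *\<^sub>R h + r n *\<^sub>R h \<in> ball x \<delta>"
    using ev[OF x0 r(1)] unfolding eventually_sequentially by blast
  define y where "y n = x - r (n + N) *\<^sub>R h" for n
  define t where "t n = r (n + N)" for n
  have y: "y \<longlonglongrightarrow> x" unfolding y_def by (rule LIMSEQ_ignore_initial_segment[OF x0])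
  have t: "t \<longlonglongrightarrow> 0" "\<And>n. t n > 0"
    unfolding t_def using r by (auto intro: LIMSEQ_ignore_initial_segment)
  have yball: "y n \<in> ball x \<delta>" "y n + t n *\<^sub>R h \<in> ball x \<delta>" for n
    using N[of "n + N"] by (auto simp: y_def t_def)
  define q where "q n v = (e (y n + t n *\<^sub>R h) v - e (y n) v) / t n" for n v
  have qlim: "(\<lambda>n. q n v) \<longlonglongrightarrow> p v h" for v
    using LIMSEQ_ignore_initial_segment[OF lim[of v], of N] by (simp add: q_def y_def t_def)
  have qb: "\<bar>q n v\<bar> \<le> C * norm h" for n v
    unfolding q_def by (rule quot_bound[OF yball t(2)])
  have qm[measurable]: "q n \<in> borel_measurable M" for n unfolding q_def by measurable
  have pm[measurable]: "(\<lambda>v. p v h) \<in> borel_measurable M"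
    by (rule borel_measurable_LIMSEQ_real[OF qlim qm])
  have pb: "\<bar>p v h\<bar> \<le> C * norm h" for v
    by (rule tendsto_upperbound[OF tendsto_rabs[OF qlim]]) (use qb in auto)
  then show "p v h \<le> C * norm h" by (meson abs_le_D1)
  show pint: "integrable M (\<lambda>v. p v h)"
    by (rule integrable_const_bound[OF _ pm, of "C * norm h"]) (use pb in simp)
  define \<phi> where "\<phi> u = (\<integral>v. e u v \<partial>M)" for u
  have \<phi>q: "(\<phi> (u + s *\<^sub>R h) - \<phi> u) / s = (\<integral>v. (e (u + s *\<^sub>R h) v - e u v) / s \<partial>M)" for u s
    by (simp add: \<phi>_def int)
  have "(\<lambda>n. \<integral>v. q n v \<partial>M) \<longlonglongrightarrow> (\<integral>v. p v h \<partial>M)"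
    by (rule integral_dominated_convergence[of _ _ _ "\<lambda>_. C * norm h"]) (use qlim qb in auto)
  then have "ereal (\<integral>v. p v h \<partial>M) \<le> clarke_dd \<phi> x h"
    by (intro clarke_dd_ge_sequence[OF y t]) (simp add: \<phi>q q_def)
  moreover have "clarke_dd \<phi> x h \<le> ereal (\<integral>v. p v h \<partial>M)"
  proof (rule clarke_dd_le_sequences)
    fix y t b
    assume y: "y \<longlonglongrightarrow> x" and t: "t \<longlonglongrightarrow> 0" "\<And>n. t n > 0"
      and b: "\<And>n. b \<le> (\<phi> (y n + t n *\<^sub>R h) - \<phi> (y n)) / t n"
    obtain N where N: "\<And>n. n \<ge> N \<Longrightarrow> y n \<in> ball x \<delta> \<and> y n + t n *\<^sub>R h \<in> ball x \<delta>"
      using ev[OF y t(1)] unfolding eventually_sequentially by blast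
    define q where "q n v = (e (y (n + N) + t (n + N) *\<^sub>R h) v - e (y (n + N)) v) / t (n + N)" for n v
    have qb: "\<bar>q n v\<bar> \<le> C * norm h" for n v
      unfolding q_def using N[of "n + N"] t(2) by (intro quot_bound) auto
    have qm[measurable]: "q n \<in> borel_measurable M" for n unfolding q_def by measurable
    \<comment> \<open>The quotients along arbitrary sequences need not converge; they are only
      eventually below \<open>p v h + d\<close>. Their maximum with \<open>p v h\<close> does
      converge, and it still bounds them from above.\<close>
    have mlim: "(\<lambda>n. max (q n v) (p v h)) \<longlonglongrightarrow> p v h" for v
    proof (rule LIMSEQ_I)
      fix d :: real assume d: "d > 0"
      have "clarke_dd (\<lambda>u. e u v) x h < ereal (p v h + d)"
        using reg[of v] d by (simp add: concave_regular_def)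
      from clarke_dd_lessD[OF this y t] obtain K where
        K: "\<And>n. n \<ge> K \<Longrightarrow> (e (y n + t n *\<^sub>R h) v - e (y n) v) / t n < p v h + d"
        unfolding eventually_sequentially by blast
      have "norm (max (q n v) (p v h) - p v h) < d" if "n \<ge> K" for n
        using K[of "n + N"] that d unfolding q_def by (auto simp: max_def)
      then show "\<exists>K. \<forall>n\<ge>K. norm (max (q n v) (p v h) - p v h) < d" by blast
    qed
    have "(\<lambda>n. \<integral>v. max (q n v) (p v h) \<partial>M) \<longlonglongrightarrow> (\<integral>v. p v h \<partial>M)"
    proof (rule integral_dominated_convergence[of _ _ _ "\<lambda>_. C * norm h"])
      fix n
      have "norm (max (q n v) (p v h)) \<le> C * norm h" for v
        using qb[of n v] pb[of v] by (auto simp: max_def)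
      then show "AE v in M. norm (max (q n v) (p v h)) \<le> C * norm h" by simp
    qed (use mlim in auto)
    moreover have "b \<le> (\<integral>v. max (q n v) (p v h) \<partial>M)" for n
    proof -
      have qint: "integrable M (q n)"
        by (rule integrable_const_bound[OF _ qm, of _ "C * norm h"]) (use qb in simp)
      have "b \<le> (\<integral>v. q n v \<partial>M)" using b[of "n + N"] by (simp only: \<phi>q q_def)
      also have "\<dots> \<le> (\<integral>v. max (q n v) (p v h) \<partial>M)"
        by (intro integral_mono qint integrable_max pint) simp
      finally show ?thesis .
    qed
    ultimately show "b \<le> (\<integral>v. p v h \<partial>M)" by (intro tendsto_lowerbound) auto
  qed
  ultimately show "clarke_dd (\<lambda>u. \<integral>v. e u v \<partial>M) x h = ereal (\<integral>v. p v h \<partial>M)"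
    unfolding \<phi>_def by (rule antisym[rotated])
qed

text \<open>Through the Clarke derivatives, membership on the left means domination by the integral
  of \<open>p\<close>, and on the right domination by each \<open>p v\<close>. Strassen's selection
  gives one inclusion and integration of the inequality the other; separability of the dual is used
  for norm measurability of the selection.\<close>

theorem clarke_subdiff_integral:
  fixes e :: "'u::real_normed_vector \<Rightarrow> 'v \<Rightarrow> real"
  assumes refl: "reflexive_space TYPE('u)" and sep: "separable_space TYPE('u)"
    and fin: "finite_measure M"
    and int: "\<And>u. integrable M (e u)"
    and \<delta>: "\<delta> > 0" and C: "C \<ge> 0"
    and lip: "\<And>u w v. u \<in> ball x \<delta> \<Longrightarrow> w \<in> ball x \<delta> \<Longrightarrow> \<bar>e u v - e w v\<bar> \<le> C * norm (u - w)"
    and reg: "\<And>v. \<exists>p. concave_regular (\<lambda>u. e u v) x p"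
  shows "clarke_subdiff (\<lambda>u. \<integral>v. e u v \<partial>M) x = aumann_integral M (\<lambda>v. clarke_subdiff (\<lambda>u. e u v) x)"
proof -
  obtain p where p: "\<And>v. concave_regular (\<lambda>u. e u v) x (p v)" using reg by metis
  note I = concave_regular_integral[where e = e and p = p, OF fin int \<delta> C lip p]
  have sub: "sublinear_on UNIV (p v)" for v by (rule concave_regular_sublinear[OF p])
  have S: "clarke_subdiff (\<lambda>u. \<integral>v. e u v \<partial>M) x = {y. \<forall>h. blinfun_apply y h \<le> (\<integral>v. p v h \<partial>M)}"
  proof -
    have "clarke_dd (\<lambda>u. \<integral>v. e u v \<partial>M) x h = ereal (\<integral>v. p v h \<partial>M)" for h
      by (rule concave_regular_integral(3)[OF fin int \<delta> C lip p])
    then show ?thesis by (simp add: clarke_subdiff_def)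
  qed
  have Sv: "clarke_subdiff (\<lambda>u. e u v) x = {y. \<forall>h. blinfun_apply y h \<le> p v h}" for v
    using p[of v] by (simp add: clarke_subdiff_def concave_regular_def)
  show ?thesis
  proof (intro equalityI subsetI)
    fix y assume "y \<in> clarke_subdiff (\<lambda>u. \<integral>v. e u v \<partial>M) x"
    then have le: "blinfun_apply y h \<le> (\<integral>v. p v h \<partial>M)" for h by (simp add: S)
    obtain s :: "'v \<Rightarrow> ('u \<Rightarrow>\<^sub>L real)" where s: "AE v in M. \<forall>h. blinfun_apply (s v) h \<le> p v h"
      "\<forall>h. integrable M (\<lambda>v. blinfun_apply (s v) h) \<and> blinfun_apply y h = (\<integral>v. blinfun_apply (s v) h \<partial>M)"
      using strassen_selection[OF fin sep sub borel_measurable_integrable[OF I(1)] I(2) C le] by blast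
    obtain D :: "('u \<Rightarrow>\<^sub>L real) set" where D: "countable D" "closure D = UNIV"
      by (rule separable_dual_of_reflexive[OF refl sep])
    have "s \<in> borel_measurable M" 
      by (rule borel_measurable_blinfunI[OF D sep]) (use s(2) in auto)
    then show "y \<in> aumann_integral M (\<lambda>v. clarke_subdiff (\<lambda>u. e u v) x)"
      using s unfolding aumann_integral_def Sv by auto
  next
    fix y assume "y \<in> aumann_integral M (\<lambda>v. clarke_subdiff (\<lambda>u. e u v) x)"
    then obtain s where s: "AE v in M. \<forall>h. blinfun_apply (s v) h \<le> p v h"
      "\<And>h. integrable M (\<lambda>v. blinfun_apply (s v) h)"
      "\<And>h. blinfun_apply y h = (\<integral>v. blinfun_apply (s v) h \<partial>M)"
      unfolding aumann_integral_def Sv by auto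
    have "blinfun_apply y h \<le> (\<integral>v. p v h \<partial>M)" for h
      unfolding s(3) using s(1) by (intro integral_mono_AE s(2) I(1)) auto
    then show "y \<in> clarke_subdiff (\<lambda>u. \<integral>v. e u v \<partial>M) x" by (simp add: S)
  qed
qed

section \<open>Roots of convex functions and the radial probability function\<close>

text \<open>Continuity of \<kappa> makes \<open>F\<close> strictly differentiable at
  \<open>\<rho> x\<close>, so quotients of the composite are \<open>c\<close> times quotients of
  \<rho> up to a vanishing error. Quotients of a concave function are monotone in the step, and
  \<open>c \<ge> 0\<close> preserves the direction of the inequality.\<close>

lemma concave_regular_compose:
  fixes \<rho> :: "'u::real_normed_vector \<Rightarrow> real" and F \<kappa> :: "real \<Rightarrow> real"
  assumes \<delta>: "\<delta> > 0"
    and conc: "\<And>u w t. u \<in> ball x \<delta> \<Longrightarrow> w \<in> ball x \<delta> \<Longrightarrow> 0 \<le> t \<Longrightarrow> t \<le> 1 \<Longrightarrow>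
      (1 - t) * \<rho> u + t * \<rho> w \<le> \<rho> ((1 - t) *\<^sub>R u + t *\<^sub>R w)"
    and lip: "\<And>u w. u \<in> ball x \<delta> \<Longrightarrow> w \<in> ball x \<delta> \<Longrightarrow> \<bar>\<rho> u - \<rho> w\<bar> \<le> \<Lambda> * norm (u - w)"
    and pos: "\<rho> x > 0"
    and F: "\<And>r. r > 0 \<Longrightarrow> (F has_real_derivative \<kappa> r) (at r)"
    and \<kappa>: "isCont \<kappa> (\<rho> x)" "\<kappa> (\<rho> x) \<ge> 0"
    and f: "\<And>u. u \<in> ball x \<delta> \<Longrightarrow> f u = F (\<rho> u)"
  shows "\<exists>p. concave_regular f x p"
proof -
  define c where "c = \<kappa> (\<rho> x)"
  \<comment> \<open>The mean value bound for \<open>F r - c * r\<close>. Both end points may move,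
    which ordinary differentiability at \<open>\<rho> x\<close> would not allow.\<close>
  have strict: "\<exists>\<eta>>0. \<forall>a\<in>ball (\<rho> x) \<eta>. \<forall>b\<in>ball (\<rho> x) \<eta>. \<bar>(F b - c * b) - (F a - c * a)\<bar> \<le> \<epsilon> * \<bar>b - a\<bar>"
    if \<epsilon>: "\<epsilon> > 0" for \<epsilon>
  proof -
    obtain \<eta> where \<eta>: "\<eta> > 0" "\<And>r. \<bar>r - \<rho> x\<bar> < \<eta> \<Longrightarrow> \<bar>\<kappa> r - c\<bar> < \<epsilon>"
      using \<kappa>(1) \<epsilon> unfolding isCont_def LIM_eq c_def by (metis abs_zero cancel_comm_monoid_add_class.diff_cancel real_norm_def)
    define \<eta>' where "\<eta>' = min \<eta> (\<rho> x)"
    have \<eta>': "\<eta>' > 0" using \<eta> pos by (simp add: \<eta>'_def)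
    have "norm ((F b - c * b) - (F a - c * a)) \<le> \<epsilon> * norm (b - a)"
      if "a \<in> ball (\<rho> x) \<eta>'" "b \<in> ball (\<rho> x) \<eta>'" for a b
    proof (rule field_differentiable_bound[of "ball (\<rho> x) \<eta>'" "\<lambda>r. F r - c * r" "\<lambda>r. \<kappa> r - c"])
      fix r assume r: "r \<in> ball (\<rho> x) \<eta>'"
      then have r0: "r > 0" "\<bar>r - \<rho> x\<bar> < \<eta>" by (auto simp: \<eta>'_def dist_real_def abs_if split: if_splits)
      show "((\<lambda>r. F r - c * r) has_field_derivative \<kappa> r - c) (at r within ball (\<rho> x) \<eta>')"
        using has_field_derivative_at_within[OF F[OF r0(1)]] by (auto intro!: derivative_eq_intros)
      show "norm (\<kappa> r - c) \<le> \<epsilon>" using \<eta>(2)[OF r0(2)] by simp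
    qed (use that in auto)
    then show ?thesis using \<eta>' by (intro exI[of _ \<eta>']) auto
  qed
  have quot: "(\<lambda>n. (F (b n) - F (a n)) / t n - c * ((b n - a n) / t n)) \<longlonglongrightarrow> 0"
    if a: "a \<longlonglongrightarrow> \<rho> x" and b: "b \<longlonglongrightarrow> \<rho> x" and t: "\<And>n. t n > 0"
      and B: "\<forall>\<^sub>F n in sequentially. \<bar>b n - a n\<bar> \<le> B * t n" for a b t :: "nat \<Rightarrow> real" and B
  proof (rule LIMSEQ_I)
    fix e :: real assume e: "e > 0"
    define \<epsilon> where "\<epsilon> = e / (\<bar>B\<bar> + 1)"
    have \<epsilon>: "\<epsilon> > 0" using e by (simp add: \<epsilon>_def)
    obtain \<eta> where \<eta>: "\<eta> > 0" "\<forall>a\<in>ball (\<rho> x) \<eta>. \<forall>b\<in>ball (\<rho> x) \<eta>. \<bar>(F b - c * b) - (F a - c * a)\<bar> \<le> \<epsilon> * \<bar>b - a\<bar>"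
      using strict[OF \<epsilon>] by blast
    have "\<forall>\<^sub>F n in sequentially. a n \<in> ball (\<rho> x) \<eta>" "\<forall>\<^sub>F n in sequentially. b n \<in> ball (\<rho> x) \<eta>"
      using \<eta>(1) by (auto intro!: topological_tendstoD[OF a] topological_tendstoD[OF b] simp del: mem_ball)
    then have "\<forall>\<^sub>F n in sequentially. norm ((F (b n) - F (a n)) / t n - c * ((b n - a n) / t n) - 0) < e"
      using B
    proof eventually_elim
      case (elim n)
      have "(F (b n) - F (a n)) / t n - c * ((b n - a n) / t n)
          = ((F (b n) - c * b n) - (F (a n) - c * a n)) / t n"
        using t[of n] by (simp add: field_simps)
      then have "norm ((F (b n) - F (a n)) / t n - c * ((b n - a n) / t n) - 0)
          = \<bar>(F (b n) - c * b n) - (F (a n) - c * a n)\<bar> / t n"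
        using t[of n] by simp
      also have "\<dots> \<le> \<epsilon> * \<bar>b n - a n\<bar> / t n"
        using \<eta>(2) elim t[of n] by (intro divide_right_mono) auto
      also have "\<dots> \<le> \<epsilon> * (B * t n) / t n"
        using elim \<epsilon> t[of n] by (intro divide_right_mono mult_left_mono) auto
      also have "\<dots> = \<epsilon> * B" using t[of n] by simp
      also have "\<dots> < \<epsilon> * (\<bar>B\<bar> + 1)" using \<epsilon> by (intro mult_strict_left_mono) auto
      also have "\<dots> = e" by (simp add: \<epsilon>_def)
      finally show ?case .
    qed
    then show "\<exists>N. \<forall>n\<ge>N. norm ((F (b n) - F (a n)) / t n - c * ((b n - a n) / t n) - 0) < e"
      by (simp add: eventually_sequentially)
  qed
  have ev_ball: "\<forall>\<^sub>F n in sequentially. y n \<in> ball x \<delta>" if "y \<longlonglongrightarrow> x" for y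
    using that \<delta> by (intro topological_tendstoD) auto
  have \<rho>_lim: "(\<lambda>n. \<rho> (y n)) \<longlonglongrightarrow> \<rho> x" if y: "y \<longlonglongrightarrow> x" for y
  proof (rule LIM_zero_cancel, rule Lim_null_comparison)
    show "\<forall>\<^sub>F n in sequentially. norm (\<rho> (y n) - \<rho> x) \<le> \<Lambda> * norm (y n - x)"
      using ev_ball[OF y] by eventually_elim (use lip[of _ x] \<delta> in auto)
    have "(\<lambda>n. \<Lambda> * norm (y n - x)) \<longlonglongrightarrow> \<Lambda> * norm (x - x)" by (intro tendsto_intros y)
    then show "(\<lambda>n. \<Lambda> * norm (y n - x)) \<longlonglongrightarrow> 0" by simp
  qed
  \<comment> \<open>Concavity: the backward slope grows with the step length.\<close>
  have slope: "(\<rho> z - \<rho> (z - t *\<^sub>R h)) / t \<le> (\<rho> z - \<rho> (z - \<tau> *\<^sub>R h)) / \<tau>"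
    if "z \<in> ball x \<delta>" "z - \<tau> *\<^sub>R h \<in> ball x \<delta>" "0 < t" "t \<le> \<tau>" for z h t \<tau>
  proof -
    have "(1 - t / \<tau>) * \<rho> z + (t / \<tau>) * \<rho> (z - \<tau> *\<^sub>R h)
        \<le> \<rho> ((1 - t / \<tau>) *\<^sub>R z + (t / \<tau>) *\<^sub>R (z - \<tau> *\<^sub>R h))"
      using that by (intro conc) auto
    also have "(1 - t / \<tau>) *\<^sub>R z + (t / \<tau>) *\<^sub>R (z - \<tau> *\<^sub>R h) = z - t *\<^sub>R h"
      using that by (simp add: algebra_simps)
    finally have "\<rho> z - \<rho> (z - t *\<^sub>R h) \<le> (t / \<tau>) * (\<rho> z - \<rho> (z - \<tau> *\<^sub>R h))"
      by (simp add: algebra_simps)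
    then show ?thesis using that by (simp add: field_simps)
  qed
  define r where "r n = 1 / real (Suc n)" for n
  have r: "r \<longlonglongrightarrow> 0" "\<And>n. r n > 0" unfolding r_def by (rule inverse_Suc_seq)+
  have rdec: "r n \<le> r m" if "m \<le> n" for m n using that by (simp add: r_def frac_le)
  have "\<exists>q. clarke_dd f x h = ereal q \<and> (\<lambda>n. (f x - f (x - r n *\<^sub>R h)) / r n) \<longlonglongrightarrow> q" for h
  proof -
    define s where "s n = (\<rho> x - \<rho> (x - r n *\<^sub>R h)) / r n" for n
    have x0: "(\<lambda>n. x - r n *\<^sub>R h) \<longlonglongrightarrow> x"
      using tendsto_diff[OF tendsto_const tendsto_scaleR[OF r(1) tendsto_const]] by force
    obtain N where N: "\<And>n. n \<ge> N \<Longrightarrow> x - r n *\<^sub>R h \<in> ball x \<delta>"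
      using ev_ball[OF x0] unfolding eventually_sequentially by blast
    have xb: "x \<in> ball x \<delta>" using \<delta> by simp
    have s_le: "s n \<le> s m" if "N \<le> m" "m \<le> n" for m n
      unfolding s_def using that N[of m] xb r(2) rdec by (intro slope) auto
    have s_abs: "\<bar>s n\<bar> \<le> \<Lambda> * norm h" if "N \<le> n" for n
      using lip[OF xb N[OF that]] r(2)[of n] by (simp add: s_def abs_divide field_simps)
    have "convergent (\<lambda>n. s (n + N))"
    proof (rule Bseq_monoseq_convergent)
      show "Bseq (\<lambda>n. s (n + N))" by (rule BseqI'[of _ "\<Lambda> * norm h"]) (use s_abs in simp)
      show "monoseq (\<lambda>n. s (n + N))" by (intro decseq_imp_monoseq) (auto simp: decseq_def intro: s_le)
    qed
    then obtain d where "(\<lambda>n. s (n + N)) \<longlonglongrightarrow> d" by (auto simp: convergent_def)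
    then have d: "s \<longlonglongrightarrow> d" by (rule LIMSEQ_offset)
    have f_eq: "\<forall>\<^sub>F n in sequentially. (f x - f (x - r n *\<^sub>R h)) / r n = (F (\<rho> x) - F (\<rho> (x - r n *\<^sub>R h))) / r n"
      using ev_ball[OF x0]
    proof eventually_elim
      case (elim n)
      show ?case unfolding f[OF xb] f[OF elim] ..
    qed
    have "\<forall>\<^sub>F n in sequentially. \<bar>\<rho> x - \<rho> (x - r n *\<^sub>R h)\<bar> \<le> (\<Lambda> * norm h) * r n"
      using ev_ball[OF x0]
    proof eventually_elim
      case (elim n)
      then show ?case using lip[OF xb elim] r(2)[of n] by (simp add: mult_ac)
    qed
    then have "(\<lambda>n. (F (\<rho> x) - F (\<rho> (x - r n *\<^sub>R h))) / r n - c * s n) \<longlonglongrightarrow> 0"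
      unfolding s_def by (rule quot[OF \<rho>_lim[OF x0] tendsto_const r(2)])
    from tendsto_add[OF this tendsto_mult[OF tendsto_const[of c] d]]
    have "(\<lambda>n. (F (\<rho> x) - F (\<rho> (x - r n *\<^sub>R h))) / r n) \<longlonglongrightarrow> c * d" by simp
    then have lim: "(\<lambda>n. (f x - f (x - r n *\<^sub>R h)) / r n) \<longlonglongrightarrow> c * d"
      using tendsto_cong[OF f_eq] by blast
    have "ereal (c * d) \<le> clarke_dd f x h"
      by (rule clarke_dd_ge_sequence[OF x0 r]) (use lim in simp)
    moreover have "clarke_dd f x h \<le> ereal (c * d)"
    proof (rule clarke_dd_le_sequences)
      fix y t b
      assume y: "y \<longlonglongrightarrow> x" and t: "t \<longlonglongrightarrow> 0" "\<And>n. t n > 0"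
        and b: "\<And>n. b \<le> (f (y n + t n *\<^sub>R h) - f (y n)) / t n"
      define z where "z n = y n + t n *\<^sub>R h" for n
      have z: "z \<longlonglongrightarrow> x"
        using tendsto_add[OF y tendsto_scaleR[OF t(1) tendsto_const[of h]]] unfolding z_def by simp
      define Q where "Q n = (\<rho> (z n) - \<rho> (y n)) / t n" for n
      have "\<forall>\<^sub>F n in sequentially. \<bar>\<rho> (z n) - \<rho> (y n)\<bar> \<le> (\<Lambda> * norm h) * t n"
        using ev_ball[OF y] ev_ball[OF z]
      proof eventually_elim
        case (elim n)
        then show ?case using lip[of "z n" "y n"] t(2)[of n] by (simp add: z_def mult_ac)
      qed
      then have o: "(\<lambda>n. (F (\<rho> (z n)) - F (\<rho> (y n))) / t n - c * Q n) \<longlonglongrightarrow> 0"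
        unfolding Q_def by (rule quot[OF \<rho>_lim[OF y] \<rho>_lim[OF z] t(2)])
      \<comment> \<open>Freeze the step \<open>r m\<close>. As soon as \<open>t n < r m\<close>, the
        slope ending at \<open>z n\<close> over \<open>t n\<close> is at most the one over
        \<open>r m\<close>; letting n grow gives the slope at \<open>x\<close>, and only then m
        tends to infinity.\<close>
      have "b \<le> c * s m" if m: "m \<ge> N" for m
      proof -
        have zm: "(\<lambda>n. z n - r m *\<^sub>R h) \<longlonglongrightarrow> x - r m *\<^sub>R h" by (intro tendsto_intros z)
        have evm: "\<forall>\<^sub>F n in sequentially. z n - r m *\<^sub>R h \<in> ball x \<delta>"
          by (rule topological_tendstoD[OF zm]) (use N[OF m] in auto)
        have "(\<lambda>n. \<rho> (z n - r m *\<^sub>R h)) \<longlonglongrightarrow> \<rho> (x - r m *\<^sub>R h)"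
        proof (rule LIM_zero_cancel, rule Lim_null_comparison)
          show "\<forall>\<^sub>F n in sequentially. norm (\<rho> (z n - r m *\<^sub>R h) - \<rho> (x - r m *\<^sub>R h)) \<le> \<Lambda> * norm (z n - x)"
            using evm by eventually_elim (use lip[OF _ N[OF m]] in force)
          have "(\<lambda>n. \<Lambda> * norm (z n - x)) \<longlonglongrightarrow> \<Lambda> * norm (x - x)" by (intro tendsto_intros z)
          then show "(\<lambda>n. \<Lambda> * norm (z n - x)) \<longlonglongrightarrow> 0" by simp
        qed
        then have R: "(\<lambda>n. c * ((\<rho> (z n) - \<rho> (z n - r m *\<^sub>R h)) / r m)) \<longlonglongrightarrow> c * s m"
          unfolding s_def using r(2)[of m] by (intro tendsto_intros \<rho>_lim[OF z]) auto
        have "\<forall>\<^sub>F n in sequentially. t n < r m"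
          using t(1) r(2)[of m] by (rule order_tendstoD)
        then have "\<forall>\<^sub>F n in sequentially. b \<le> ((F (\<rho> (z n)) - F (\<rho> (y n))) / t n - c * Q n)
            + c * ((\<rho> (z n) - \<rho> (z n - r m *\<^sub>R h)) / r m)"
          using ev_ball[OF y] ev_ball[OF z] evm
        proof eventually_elim
          case (elim n)
          have "z n - t n *\<^sub>R h = y n" by (simp add: z_def)
          then have "Q n \<le> (\<rho> (z n) - \<rho> (z n - r m *\<^sub>R h)) / r m"
            using slope[of "z n" "r m" h "t n"] elim t(2)[of n] by (simp add: Q_def)
          then have "c * Q n \<le> c * ((\<rho> (z n) - \<rho> (z n - r m *\<^sub>R h)) / r m)"
            using \<kappa>(2) unfolding c_def by (rule mult_left_mono)
          moreover have "b \<le> (F (\<rho> (z n)) - F (\<rho> (y n))) / t n"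
            using b[of n] unfolding z_def[symmetric] f[OF elim(2)] f[OF elim(3)] .
          ultimately show ?case by linarith
        qed
        then show ?thesis using tendsto_lowerbound[OF tendsto_add[OF o R]] by simp
      qed
      then show "b \<le> c * d"
        by (intro tendsto_lowerbound[OF tendsto_mult[OF tendsto_const d]])
           (auto simp: eventually_sequentially)
    qed
    ultimately show ?thesis using lim by (intro exI[of _ "c * d"]) auto
  qed
  then obtain q where "\<And>h. clarke_dd f x h = ereal (q h) \<and> (\<lambda>n. (f x - f (x - r n *\<^sub>R h)) / r n) \<longlonglongrightarrow> q h"
    by metis
  then show ?thesis unfolding concave_regular_def r_def by blast
qed

text \<open>The last estimate is relative to \<open>\<rho> w\<close>: its constant does not depend on \<open>a\<close>, which is what
  survives when the rays of interest become arbitrarily long.\<close>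

lemma convex_root:
  fixes G :: "'u::real_normed_vector \<Rightarrow> real \<Rightarrow> real"
  assumes conv: "\<And>u w r s t. 0 \<le> t \<Longrightarrow> t \<le> 1 \<Longrightarrow>
      G ((1 - t) *\<^sub>R u + t *\<^sub>R w) ((1 - t) * r + t * s) \<le> (1 - t) * G u r + t * G w s"
    and cont: "\<And>u. continuous_on UNIV (G u)"
    and \<beta>: "\<beta> > 0" and K: "K \<ge> 0" and a: "a > 0"
    and G0: "\<And>u. u \<in> ball x \<delta> \<Longrightarrow> G u 0 \<le> - \<beta>"
    and Ga: "\<And>u. u \<in> ball x \<delta> \<Longrightarrow> G u a > 0"
    and lip: "\<And>u w r. u \<in> ball x \<delta> \<Longrightarrow> w \<in> ball x \<delta> \<Longrightarrow> 0 \<le> r \<Longrightarrow> r \<le> a \<Longrightarrow> \<bar>G u r - G w r\<bar> \<le> K * norm (u - w)"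
  obtains \<rho> where "\<And>u. u \<in> ball x \<delta> \<Longrightarrow> 0 < \<rho> u \<and> \<rho> u < a"
    "\<And>u. u \<in> ball x \<delta> \<Longrightarrow> {r. 0 \<le> r \<and> G u r \<le> 0} = {0..\<rho> u}"
    "\<And>u w t. u \<in> ball x \<delta> \<Longrightarrow> w \<in> ball x \<delta> \<Longrightarrow> 0 \<le> t \<Longrightarrow> t \<le> 1 \<Longrightarrow>
      (1 - t) * \<rho> u + t * \<rho> w \<le> \<rho> ((1 - t) *\<^sub>R u + t *\<^sub>R w)"
    "\<And>u w. u \<in> ball x \<delta> \<Longrightarrow> w \<in> ball x \<delta> \<Longrightarrow> \<rho> u - \<rho> w \<le> \<rho> w * (K / \<beta> * norm (u - w))"
proof -
  have chord: "G u (t * r) \<le> (1 - t) * G u 0 + t * G u r" if "0 \<le> t" "t \<le> 1" for u t r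
    using conv[OF that, of u u 0 r] by (simp flip: scaleR_add_left)
  have "\<exists>\<rho>. 0 < \<rho> \<and> \<rho> < a \<and> {r. 0 \<le> r \<and> G u r \<le> 0} = {0..\<rho>}" if u: "u \<in> ball x \<delta>" for u
  proof -
    define S where "S = {r. 0 \<le> r \<and> G u r \<le> 0}"
    have clS: "closed S"
      unfolding S_def using cont by (intro closed_Collect_conj closed_Collect_le continuous_intros)
    have S0: "0 \<in> S" using G0[OF u] \<beta> by (simp add: S_def)
    \<comment> \<open>A point of the sublevel set at or beyond \<open>a\<close> would, by the chord
      from the negative value at 0, make \<open>G u a\<close> nonpositive.\<close>
    have Sa: "r < a" if "r \<in> S" for r
    proof (rule ccontr)
      assume "\<not> r < a"
      then have r: "a \<le> r" "r > 0" using a by auto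
      then have "G u ((a / r) * r) \<le> (1 - a / r) * G u 0 + (a / r) * G u r"
        using a by (intro chord) auto
      moreover have "(1 - a / r) * G u 0 \<le> 0" "(a / r) * G u r \<le> 0"
        using r a G0[OF u] \<beta> that
        by (auto simp: S_def mult_nonneg_nonpos divide_nonpos_pos)
      ultimately show False using Ga[OF u] r by simp
    qed
    have bdd: "bdd_above S" using Sa by (meson bdd_aboveI less_imp_le)
    define \<rho> where "\<rho> = Sup S"
    have \<rho>S: "\<rho> \<in> S" unfolding \<rho>_def using S0 bdd clS by (intro closed_contains_Sup) auto
    have "S = {0..\<rho>}"
    proof (intro equalityI subsetI)
      fix r assume r: "r \<in> {0..\<rho>}"
      show "r \<in> S"
      proof (cases "\<rho> = 0")
        case True then show ?thesis using r S0 by simp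
      next
        case False
        then have \<rho>: "\<rho> > 0" using \<rho>S by (simp add: S_def)
        have "G u ((r / \<rho>) * \<rho>) \<le> (1 - r / \<rho>) * G u 0 + (r / \<rho>) * G u \<rho>"
          using r \<rho> by (intro chord) auto
        moreover have "(1 - r / \<rho>) * G u 0 \<le> 0" "(r / \<rho>) * G u \<rho> \<le> 0"
          using r \<rho> G0[OF u] \<beta> \<rho>S by (auto simp: S_def mult_nonneg_nonpos divide_nonpos_pos)
        ultimately show ?thesis using r \<rho> by (simp add: S_def)
      qed
    qed (use bdd in \<open>auto simp: \<rho>_def S_def intro: cSup_upper\<close>)
    moreover have "\<rho> > 0"
    proof -
      have "isCont (G u) 0" using cont by (simp add: continuous_on_eq_continuous_at)
      then have "((G u) \<longlongrightarrow> G u 0) (at_right 0)"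
        unfolding isCont_def by (rule filterlim_at_split[THEN iffD1, THEN conjunct2])
      then have "\<forall>\<^sub>F r in at_right 0. G u r < 0"
        using G0[OF u] \<beta> by (intro order_tendstoD(2)) auto
      moreover have "\<forall>\<^sub>F r in at_right 0. (0::real) < r" by (rule eventually_at_right_less)
      ultimately have "\<forall>\<^sub>F r in at_right 0. 0 < r \<and> G u r < 0" by eventually_elim simp
      then obtain r where "0 < r" "G u r < 0"
        using eventually_happens'[OF trivial_limit_at_right_real] by blast
      then have "r \<in> S" by (simp add: S_def)
      then have "r \<le> \<rho>" unfolding \<rho>_def using bdd by (rule cSup_upper)
      then show ?thesis using \<open>0 < r\<close> by simp
    qed
    ultimately show ?thesis using Sa[OF \<rho>S] unfolding S_def by blast
  qed
  then have "\<forall>u\<in>ball x \<delta>. \<exists>\<rho>. 0 < \<rho> \<and> \<rho> < a \<and> {r. 0 \<le> r \<and> G u r \<le> 0} = {0..\<rho>}" by blast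
  from bchoice[OF this] obtain \<rho> where
    "\<forall>u\<in>ball x \<delta>. 0 < \<rho> u \<and> \<rho> u < a \<and> {r. 0 \<le> r \<and> G u r \<le> 0} = {0..\<rho> u}" by blast
  then have \<rho>: "\<And>u. u \<in> ball x \<delta> \<Longrightarrow> 0 < \<rho> u" "\<And>u. u \<in> ball x \<delta> \<Longrightarrow> \<rho> u < a"
    and set_eq: "\<And>u. u \<in> ball x \<delta> \<Longrightarrow> {r. 0 \<le> r \<and> G u r \<le> 0} = {0..\<rho> u}"
    by (blast, blast, blast)
  have root: "G u (\<rho> u) \<le> 0" if "u \<in> ball x \<delta>" for u
  proof -
    have "\<rho> u \<in> {0..\<rho> u}" using \<rho>(1)[OF that] by simp
    then show ?thesis unfolding set_eq[OF that, symmetric] by blast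
  qed
  have below: "r \<le> \<rho> u" if "u \<in> ball x \<delta>" "0 \<le> r" "G u r \<le> 0" for u r
  proof -
    have "r \<in> {0..\<rho> u}" using that unfolding set_eq[OF that(1), symmetric] by blast
    then show ?thesis by simp
  qed
  show thesis
  proof (rule that[of \<rho>])
    fix u w and t :: real assume uw: "u \<in> ball x \<delta>" "w \<in> ball x \<delta>" and t: "0 \<le> t" "t \<le> 1"
    \<comment> \<open>Joint convexity keeps the convex combination of two roots in the sublevel set
      of the combined argument, hence below its root.\<close>
    show "(1 - t) * \<rho> u + t * \<rho> w \<le> \<rho> ((1 - t) *\<^sub>R u + t *\<^sub>R w)"
    proof (rule below)
      show "(1 - t) *\<^sub>R u + t *\<^sub>R w \<in> ball x \<delta>"
        using convex_ball[of x \<delta>] uw t by (simp add: convex_alt)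
      show "0 \<le> (1 - t) * \<rho> u + t * \<rho> w" using \<rho>(1)[OF uw(1)] \<rho>(1)[OF uw(2)] t by simp
      have "G ((1 - t) *\<^sub>R u + t *\<^sub>R w) ((1 - t) * \<rho> u + t * \<rho> w) \<le> (1 - t) * G u (\<rho> u) + t * G w (\<rho> w)"
        by (rule conv[OF t])
      also have "\<dots> \<le> 0" using root[OF uw(1)] root[OF uw(2)] t
        by (intro add_nonpos_nonpos mult_nonneg_nonpos) auto
      finally show "G ((1 - t) *\<^sub>R u + t *\<^sub>R w) ((1 - t) * \<rho> u + t * \<rho> w) \<le> 0" .
    qed
  next
    fix u w assume uw: "u \<in> ball x \<delta>" "w \<in> ball x \<delta>"
    define k where "k = K * norm (u - w)"
    have k: "k \<ge> 0" using K by (simp add: k_def)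
    \<comment> \<open>The weight at which the chord bound
      \<open>(1 - t) * (- \<beta>) + t * k\<close> is exactly zero: shrinking the root of
      \<open>u\<close> by this factor makes it admissible for \<open>w\<close>.\<close>
    define t where "t = \<beta> / (\<beta> + k)"
    have t: "0 < t" "t \<le> 1" using \<beta> k by (auto simp: t_def)
    have "G w (\<rho> u) \<le> G u (\<rho> u) + k"
      using lip[OF uw, of "\<rho> u"] \<rho>[OF uw(1)] by (simp add: k_def)
    then have "G w (\<rho> u) \<le> k" using root[OF uw(1)] by simp
    have "G w (t * \<rho> u) \<le> (1 - t) * G w 0 + t * G w (\<rho> u)" by (rule chord) (use t in auto)
    also have "\<dots> \<le> (1 - t) * (- \<beta>) + t * k"
      using t G0[OF uw(2)] \<open>G w (\<rho> u) \<le> k\<close> by (intro add_mono mult_left_mono) auto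
    also have "\<dots> = 0" using \<beta> k by (simp add: t_def field_simps)
    finally have "t * \<rho> u \<le> \<rho> w"
      using t \<rho>(1)[OF uw(1)] by (intro below[OF uw(2)]) auto
    then have "\<rho> u \<le> \<rho> w * ((\<beta> + k) / \<beta>)" using \<beta> k by (simp add: t_def field_simps)
    also have "\<dots> = \<rho> w + \<rho> w * (K / \<beta> * norm (u - w))" using \<beta> by (simp add: k_def field_simps)
    finally show "\<rho> u - \<rho> w \<le> \<rho> w * (K / \<beta> * norm (u - w))" by simp
  qed (use \<rho> set_eq in auto)
qed

text \<open>The chi density without its cutoff at 0. The cutoff can create a jump there (for
  \<open>m = 1\<close>), whereas this formula is continuous on the whole line.\<close>

definition chi_kernel :: "nat \<Rightarrow> real \<Rightarrow> real" where
  "chi_kernel m r = r ^ (m - 1) * exp (- (r\<^sup>2) / 2) / (2 powr (real m / 2 - 1) * Gamma (real m / 2))"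

lemma chi_normaliser_pos: "m > 0 \<Longrightarrow> 2 powr (real m / 2 - 1) * Gamma (real m / 2) > 0"
  by (intro mult_pos_pos Gamma_real_pos) auto

lemma continuous_on_chi_kernel [continuous_intros]: "continuous_on A (chi_kernel m)"
  unfolding chi_kernel_def[abs_def] divide_inverse by (intro continuous_intros)

lemma chi_kernel_nonneg: "m > 0 \<Longrightarrow> r \<ge> 0 \<Longrightarrow> chi_kernel m r \<ge> 0"
  unfolding chi_kernel_def using chi_normaliser_pos[of m] by (intro divide_nonneg_pos mult_nonneg_nonneg) auto

text \<open>The m-th term of the exponential series bounds
  \<open>(r\<^sup>2) ^ m * exp (- (r\<^sup>2) / 2)\<close> by \<open>2 ^ m * fact m\<close>, and
  \<open>r ^ m \<le> 1 + (r\<^sup>2) ^ m\<close> reduces to this even power.\<close>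

lemma chi_kernel_bound:
  assumes "m > 0"
  obtains c where "c \<ge> 0" "\<And>r. r > 0 \<Longrightarrow> chi_kernel m r \<le> c / r"
proof -
  define N where "N = 2 powr (real m / 2 - 1) * Gamma (real m / 2)"
  have N: "N > 0" unfolding N_def by (rule chi_normaliser_pos[OF assms])
  define c where "c = (1 + 2 ^ m * fact m) / N"
  have "chi_kernel m r \<le> c / r" if r: "r > 0" for r
  proof -
    have "(r\<^sup>2 / 2) ^ m / fact m \<le> exp (r\<^sup>2 / 2)"
    proof -
      have "(\<Sum>k\<in>{m}. inverse (fact k) *\<^sub>R (r\<^sup>2 / 2) ^ k) \<le> (\<Sum>k. inverse (fact k) *\<^sub>R (r\<^sup>2 / 2) ^ k)"
        by (rule sum_le_suminf[OF summable_exp_generic]) auto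
      then show ?thesis by (simp add: exp_def field_simps)
    qed
    then have A: "(r\<^sup>2) ^ m * exp (- (r\<^sup>2) / 2) \<le> 2 ^ m * fact m"
      by (simp add: exp_minus field_simps power_divide)
    have "r ^ m \<le> 1 + (r\<^sup>2) ^ m"
    proof -
      have "0 \<le> (r ^ m - 1 / 2)\<^sup>2" by simp
      then show ?thesis by (simp add: power2_eq_square power_mult_distrib algebra_simps)
    qed
    then have "r ^ m * exp (- (r\<^sup>2) / 2) \<le> (1 + (r\<^sup>2) ^ m) * exp (- (r\<^sup>2) / 2)"
      by (intro mult_right_mono) auto
    also have "\<dots> \<le> 1 + 2 ^ m * fact m" using A by (simp add: distrib_right add_mono)
    finally have B: "r ^ m * exp (- (r\<^sup>2) / 2) \<le> 1 + 2 ^ m * fact m" .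
    have "chi_kernel m r * r = r ^ m * exp (- (r\<^sup>2) / 2) / N"
      using assms by (cases m) (auto simp: chi_kernel_def N_def mult_ac)
    also have "\<dots> \<le> c" unfolding c_def using B N by (intro divide_right_mono) auto
    finally show ?thesis using r by (simp add: field_simps)
  qed
  moreover have "c \<ge> 0" using N by (simp add: c_def)
  ultimately show thesis using that by blast
qed

lemma chi_measure_Icc:
  assumes "m > 0"
  obtains F where "\<And>r. r \<ge> 0 \<Longrightarrow> measure (chi_measure m) {0..r} = F r"
    "\<And>r. r > 0 \<Longrightarrow> (F has_real_derivative chi_kernel m r) (at r)"
proof -
  \<comment> \<open>Starting at -1 puts 0 in the interior, so that \<open>G\<close> has a two-sided
    derivative there as well.\<close>
  define G where "G r = integral {-1..r} (chi_kernel m)" for r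
  have G: "(G has_real_derivative chi_kernel m r) (at r)" if "r \<ge> 0" for r
  proof -
    have "(G has_real_derivative chi_kernel m r) (at r within {-1..r + 1})"
      unfolding G_def using that by (intro integral_has_real_derivative continuous_intros) auto
    moreover have "at r within {-1..r + 1} = at r"
      using that by (intro at_within_interior) auto
    ultimately show ?thesis by simp
  qed
  have [measurable]: "chi_kernel m \<in> borel_measurable borel"
    by (intro borel_measurable_continuous_onI continuous_intros)
  have chi_eq: "chi_density m r = (if r \<ge> 0 then chi_kernel m r else 0)" for r
    by (simp add: chi_density_def chi_kernel_def)
  have [measurable]: "chi_density m \<in> borel_measurable borel"
    unfolding chi_eq[abs_def] by measurable
  show thesis
  proof (rule that[of "\<lambda>r. G r - G 0"])
    fix r :: real assume r: "r \<ge> 0"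
    have "emeasure (chi_measure m) {0..r} = (\<integral>\<^sup>+x. ennreal (chi_density m x) * indicator {0..r} x \<partial>lborel)"
      unfolding chi_measure_def by (subst emeasure_density) auto
    also have "\<dots> = (\<integral>\<^sup>+x. ennreal (chi_kernel m x) * indicator {0..r} x \<partial>lborel)"
      by (intro nn_integral_cong) (auto simp: chi_eq split: split_indicator)
    also have "\<dots> = ennreal (G r - G 0)"
      using r G chi_kernel_nonneg[OF assms] by (intro nn_integral_FTC_Icc) auto
    finally have em: "emeasure (chi_measure m) {0..r} = ennreal (G r - G 0)" .
    have "G 0 \<le> G r"
      using r G chi_kernel_nonneg[OF assms] by (intro DERIV_nonneg_imp_nondecreasing[of 0 r G]) auto
    then show "measure (chi_measure m) {0..r} = G r - G 0" using em by (simp add: measure_def)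
  next
    fix r :: real assume "r > 0"
    then show "((\<lambda>r. G r - G 0) has_real_derivative chi_kernel m r) (at r)"
      using G[of r] by (auto intro!: derivative_eq_intros)
  qed
qed

section \<open>Lipschitz estimates and stability of sublevel sets\<close>

lemma locally_lipschitz_imp_continuous:
  assumes "locally_lipschitz f"
  shows "continuous_on UNIV f"
proof -
  have "isCont f x" for x
  proof -
    obtain \<epsilon> K where \<epsilon>: "\<epsilon> > 0" "\<And>y z. y \<in> ball x \<epsilon> \<Longrightarrow> z \<in> ball x \<epsilon> \<Longrightarrow> \<bar>f y - f z\<bar> \<le> K * dist y z"
      using assms unfolding locally_lipschitz_def by metis
    have "((\<lambda>y. f y - f x) \<longlongrightarrow> 0) (at x)"
    proof (rule Lim_null_comparison)
      have "\<forall>\<^sub>F y in at x. y \<in> ball x \<epsilon>" using \<epsilon>(1) by (intro eventually_at_in_open') auto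
      then show "\<forall>\<^sub>F y in at x. norm (f y - f x) \<le> K * dist y x"
        by eventually_elim (use \<epsilon> in auto)
      have "((\<lambda>y. K * dist y x) \<longlongrightarrow> K * dist x x) (at x)" by (intro tendsto_intros)
      then show "((\<lambda>y. K * dist y x) \<longlongrightarrow> 0) (at x)" by simp
    qed
    then show ?thesis unfolding isCont_def by (rule LIM_zero_cancel)
  qed
  then show ?thesis by (simp add: continuous_at_imp_continuous_on)
qed

lemma uniform_lipschitz_on_compact:
  fixes g :: "'u::metric_space \<Rightarrow> 'z::metric_space \<Rightarrow> real"
  assumes lip: "locally_lipschitz (\<lambda>p. g (fst p) (snd p))" and S: "compact S"
  obtains \<delta> K where "\<delta> > 0" "K \<ge> 0"
    "\<And>u w z. u \<in> ball x \<delta> \<Longrightarrow> w \<in> ball x \<delta> \<Longrightarrow> z \<in> S \<Longrightarrow> \<bar>g u z - g w z\<bar> \<le> K * dist u w"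
proof -
  have "\<forall>z. \<exists>\<epsilon>>0. \<exists>K. \<forall>p\<in>ball (x, z) \<epsilon>. \<forall>q\<in>ball (x, z) \<epsilon>. \<bar>g (fst p) (snd p) - g (fst q) (snd q)\<bar> \<le> K * dist p q"
    using lip unfolding locally_lipschitz_def by blast
  then obtain \<epsilon> K where \<epsilon>: "\<And>z. \<epsilon> z > 0"
    and K: "\<And>z p q. p \<in> ball (x, z) (\<epsilon> z) \<Longrightarrow> q \<in> ball (x, z) (\<epsilon> z) \<Longrightarrow>
      \<bar>g (fst p) (snd p) - g (fst q) (snd q)\<bar> \<le> K z * dist p q"
    by metis
  \<comment> \<open>The radii are halved so that the distance in \<open>z\<close> and the
    perturbation in \<open>u\<close> each take one half of \<open>\<epsilon> a\<close>.\<close>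
  obtain T where T: "T \<subseteq> S" "finite T" "S \<subseteq> (\<Union>z\<in>T. ball z (\<epsilon> z / 2))"
  proof (rule compactE_image[OF S, of S "\<lambda>z. ball z (\<epsilon> z / 2)"])
    show "S \<subseteq> (\<Union>z\<in>S. ball z (\<epsilon> z / 2))" using \<epsilon> by force
  qed auto
  define \<delta> where "\<delta> = Min (insert 1 ((\<lambda>z. \<epsilon> z / 2) ` T))"
  define K' where "K' = Max (insert 0 (K ` T))"
  have \<delta>: "\<delta> > 0" using T \<epsilon> by (simp add: \<delta>_def)
  have K': "K' \<ge> 0" using T by (simp add: K'_def)
  show thesis
  proof (rule that[OF \<delta> K'])
    fix u w z assume u: "u \<in> ball x \<delta>" and w: "w \<in> ball x \<delta>" and "z \<in> S"
    then obtain a where a: "a \<in> T" "dist a z < \<epsilon> a / 2" using T by auto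
    have "\<delta> \<le> \<epsilon> a / 2" unfolding \<delta>_def using T a by (intro Min_le) auto
    have near: "(y, z) \<in> ball (x, a) (\<epsilon> a)" if "y \<in> ball x \<delta>" for y
    proof -
      have "dist (x, a) (y, z) \<le> dist x y + dist a z"
        unfolding dist_Pair_Pair by (rule sqrt_sum_squares_le_sum) auto
      also have "\<dots> < \<epsilon> a" using that a \<open>\<delta> \<le> \<epsilon> a / 2\<close> by simp
      finally show ?thesis by simp
    qed
    have "\<bar>g u z - g w z\<bar> \<le> K a * dist (u, z) (w, z)"
      using K[OF near[OF u] near[OF w]] by simp
    also have "dist (u, z) (w, z) = dist u w" by (simp add: dist_Pair_Pair)
    also have "K a * dist u w \<le> K' * dist u w"
      unfolding K'_def using T a by (intro mult_right_mono Max_ge) auto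
    finally show "\<bar>g u z - g w z\<bar> \<le> K' * dist u w" .
  qed
qed

text \<open>Boundedness is given only at \<open>x\<close>. A sphere outside the sublevel set carries
  a positive minimum of \<open>g x\<close> by compactness, and a uniform Lipschitz constant on the
  ball of radius \<open>R\<close> keeps the sign for nearby \<open>u\<close>. Positivity on this
  sphere later cuts off all rays of nonzero direction.\<close>

lemma sublevel_stability:
  fixes g :: "'u::real_normed_vector \<Rightarrow> 'z::euclidean_space \<Rightarrow> real"
  assumes lip: "locally_lipschitz (\<lambda>p. g (fst p) (snd p))"
    and g0: "g x 0 < 0" and bdd: "bounded {z. g x z \<le> 0}"
  obtains \<delta> K \<beta> R where "\<delta> > 0" "K \<ge> 0" "\<beta> > 0" "R > 0"
    "\<And>u w z. u \<in> ball x \<delta> \<Longrightarrow> w \<in> ball x \<delta> \<Longrightarrow> norm z \<le> R \<Longrightarrow> \<bar>g u z - g w z\<bar> \<le> K * norm (u - w)"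
    "\<And>u. u \<in> ball x \<delta> \<Longrightarrow> g u 0 \<le> - \<beta>"
    "\<And>u z. u \<in> ball x \<delta> \<Longrightarrow> norm z = R \<Longrightarrow> g u z > 0"
proof -
  obtain b where b: "\<And>z. g x z \<le> 0 \<Longrightarrow> norm z \<le> b" using bdd unfolding bounded_iff by blast
  define R where "R = max b 0 + 1"
  have R: "R > 0" by (simp add: R_def)
  have pos: "g x z > 0" if "norm z = R" for z using b[of z] that by (fastforce simp: R_def)
  have "continuous_on UNIV (\<lambda>z. g x z)"
    using continuous_on_compose2[OF locally_lipschitz_imp_continuous[OF lip], of UNIV "\<lambda>z. (x, z)"]
    by (simp add: continuous_intros)
  then have "continuous_on (sphere 0 R) (\<lambda>z. g x z)" by (rule continuous_on_subset) auto
  then obtain z0 where z0: "norm z0 = R" "\<And>z. norm z = R \<Longrightarrow> g x z0 \<le> g x z"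
    using continuous_attains_inf[of "sphere (0::'z) R" "\<lambda>z. g x z"] R by auto
  obtain \<delta> K where \<delta>: "\<delta> > 0" and K: "K \<ge> 0"
    and lipK: "\<And>u w z. u \<in> ball x \<delta> \<Longrightarrow> w \<in> ball x \<delta> \<Longrightarrow> z \<in> cball (0::'z) R \<Longrightarrow> \<bar>g u z - g w z\<bar> \<le> K * dist u w"
    using uniform_lipschitz_on_compact[OF lip compact_cball[of 0 R], of x] by blast
  define \<mu> where "\<mu> = min (- g x 0) (g x z0)"
  have \<mu>: "\<mu> > 0" using g0 pos[OF z0(1)] by (simp add: \<mu>_def)
  have \<mu>le: "\<mu> \<le> - g x 0" "\<mu> \<le> g x z0" by (auto simp: \<mu>_def)
  \<comment> \<open>Chosen so that a perturbation changes \<open>g\<close> by at most half the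
    margin \<mu>; the added 1 keeps the denominator positive when \<open>K\<close> is 0.\<close>
  define \<delta>' where "\<delta>' = min \<delta> (\<mu> / (2 * (K + 1)))"
  have \<delta>': "\<delta>' > 0" using \<delta> \<mu> K by (simp add: \<delta>'_def)
  have close: "\<bar>g u z - g x z\<bar> \<le> \<mu> / 2" if u: "u \<in> ball x \<delta>'" and z: "norm z \<le> R" for u z
  proof -
    have "\<bar>g u z - g x z\<bar> \<le> K * dist u x"
      using u z \<delta> by (intro lipK) (auto simp: \<delta>'_def)
    also have "\<dots> \<le> (K + 1) * (\<mu> / (2 * (K + 1)))"
      using u K by (intro mult_mono) (auto simp: \<delta>'_def dist_commute)
    also have "\<dots> = \<mu> / 2" using K by (simp add: field_simps)
    finally show ?thesis .
  qed
  show thesis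
  proof (rule that[of \<delta>' K "\<mu> / 2" R])
    show "\<bar>g u z - g w z\<bar> \<le> K * norm (u - w)" if "u \<in> ball x \<delta>'" "w \<in> ball x \<delta>'" "norm z \<le> R" for u w z
      using lipK[of u w z] that by (simp add: \<delta>'_def dist_norm)
    show "g u 0 \<le> - (\<mu> / 2)" if "u \<in> ball x \<delta>'" for u
    proof -
      have "\<bar>g u 0 - g x 0\<bar> \<le> \<mu> / 2" by (rule close[OF that]) (use R in simp)
      then show ?thesis using \<mu>le by linarith
    qed
    show "g u z > 0" if "u \<in> ball x \<delta>'" "norm z = R" for u z
    proof -
      have "\<bar>g u z - g x z\<bar> \<le> \<mu> / 2" by (rule close[OF that(1)]) (use that in simp)
      then show ?thesis using z0(2)[OF that(2)] \<mu> \<mu>le by linarith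
    qed
  qed (use \<delta>' K \<mu> R in auto)
qed

text \<open>The data of \<open>sublevel_stability\<close> do not involve a direction, so one ball
  serves all \<open>v\<close>. In the constant \<open>c * K / \<beta>\<close>, \<open>c\<close>
  bounds \<open>r * \<kappa> r\<close> and \<open>K / \<beta>\<close> is the relative Lipschitz
  constant of the radius.\<close>

lemma radial_prob_regular:
  fixes g :: "'u::real_normed_vector \<Rightarrow> real^'m \<Rightarrow> real" and L :: "real^'m^'m"
  assumes lip: "locally_lipschitz (\<lambda>p. g (fst p) (snd p))"
    and conv: "convex_on UNIV (\<lambda>p. g (fst p) (snd p))"
    and g0: "g x 0 < 0" and bdd: "bounded {z. g x z \<le> 0}"
  obtains \<delta> C where "\<delta> > 0" "C \<ge> 0"
    "\<And>u w v. u \<in> ball x \<delta> \<Longrightarrow> w \<in> ball x \<delta> \<Longrightarrow>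
      \<bar>radial_prob g L u v - radial_prob g L w v\<bar> \<le> C * norm (u - w)"
    "\<And>v. \<exists>p. concave_regular (\<lambda>u. radial_prob g L u v) x p"
proof -
  obtain \<delta> K \<beta> R where \<delta>: "\<delta> > 0" and K: "K \<ge> 0" and \<beta>: "\<beta> > 0" and R: "R > 0"
    and glip: "\<And>u w z. u \<in> ball x \<delta> \<Longrightarrow> w \<in> ball x \<delta> \<Longrightarrow> norm z \<le> R \<Longrightarrow> \<bar>g u z - g w z\<bar> \<le> K * norm (u - w)"
    and gneg: "\<And>u. u \<in> ball x \<delta> \<Longrightarrow> g u 0 \<le> - \<beta>"
    and gpos: "\<And>u z. u \<in> ball x \<delta> \<Longrightarrow> norm z = R \<Longrightarrow> g u z > 0"
    using sublevel_stability[OF lip g0 bdd] by blast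
  define \<kappa> where "\<kappa> = chi_kernel CARD('m)"
  have \<kappa>0: "\<kappa> r \<ge> 0" if "r \<ge> 0" for r unfolding \<kappa>_def using that by (intro chi_kernel_nonneg) auto
  obtain F where Fm: "\<And>r. r \<ge> 0 \<Longrightarrow> measure (chi_measure CARD('m)) {0..r} = F r"
    and F: "\<And>r. r > 0 \<Longrightarrow> (F has_real_derivative \<kappa> r) (at r)"
    unfolding \<kappa>_def using chi_measure_Icc[of "CARD('m)"] by (metis zero_less_card_finite)
  obtain c where c: "c \<ge> 0" "\<And>r. r > 0 \<Longrightarrow> \<kappa> r \<le> c / r"
    unfolding \<kappa>_def using chi_kernel_bound[of "CARD('m)"] by (metis zero_less_card_finite)
  have \<kappa>cont: "isCont \<kappa> r" for r
    using continuous_on_chi_kernel[of UNIV] unfolding \<kappa>_def by (simp add: continuous_on_eq_continuous_at)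
  \<comment> \<open>The density is estimated at the smaller end point \<open>s\<close>. With
    \<open>s = \<rho> w\<close> the factor \<open>1 / s\<close> cancels the \<open>\<rho> w\<close>
    in the relative Lipschitz estimate, so long rays do no harm.\<close>
  have F_increment: "\<bar>F r - F s\<bar> \<le> c / s * (r - s)" if "0 < s" "s \<le> r" for r s
  proof -
    have "norm (F r - F s) \<le> c / s * norm (r - s)"
    proof (rule field_differentiable_bound[of "{s..r}" F \<kappa>])
      fix z assume z: "z \<in> {s..r}"
      then have z0: "z > 0" using that by simp
      show "(F has_field_derivative \<kappa> z) (at z within {s..r})"
        by (rule has_field_derivative_at_within[OF F[OF z0]])
      have "\<kappa> z \<le> c / z" by (rule c(2)[OF z0])
      also have "\<dots> \<le> c / s" using c(1) z that by (intro divide_left_mono) auto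
      finally show "norm (\<kappa> z) \<le> c / s" using \<kappa>0[of z] z0 by simp
    qed (use that in auto)
    then show ?thesis using that by simp
  qed
  have *: "(\<forall>u\<in>ball x \<delta>. \<forall>w\<in>ball x \<delta>. \<bar>radial_prob g L u v - radial_prob g L w v\<bar> \<le> c * K / \<beta> * norm (u - w))
      \<and> (\<exists>p. concave_regular (\<lambda>u. radial_prob g L u v) x p)" for v
  proof (cases "L *v v = 0")
    \<comment> \<open>The ray degenerates to the origin, where \<open>g u\<close> is negative for
      all \<open>u\<close> in the ball, so the radial probability is constant there and a constant
      radius 1 shows regularity.\<close>
    case True
    have const: "radial_prob g L u v = radial_prob g L x v" if "u \<in> ball x \<delta>" for u
      using gneg[OF that] g0 \<beta> by (simp add: radial_prob_def True)
    have "\<exists>p. concave_regular (\<lambda>u. radial_prob g L u v) x p"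
      by (rule concave_regular_compose[where \<rho> = "\<lambda>_. 1" and F = "\<lambda>_. radial_prob g L x v" and \<kappa> = "\<lambda>_. 0"
            and \<Lambda> = 0, OF \<delta>]) (use const in auto)
    moreover have "0 \<le> c * K / \<beta> * norm (u - w)" for u w :: 'u using c K \<beta> by simp
    ultimately show ?thesis using const by (simp del: mem_ball)
  next
    case False
    define G where "G u r = g u (r *\<^sub>R (L *v v))" for u r
    define a where "a = R / norm (L *v v)"
    have a: "a > 0" using R False by (simp add: a_def)
    have gcont: "continuous_on UNIV (G u)" for u
      unfolding G_def
      using continuous_on_compose2[OF locally_lipschitz_imp_continuous[OF lip], of UNIV "\<lambda>r. (u, r *\<^sub>R (L *v v))"]
      by (simp add: continuous_intros)
    have Gconv: "G ((1 - t) *\<^sub>R u + t *\<^sub>R w) ((1 - t) * r + t * s) \<le> (1 - t) * G u r + t * G w s"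
      if "0 \<le> t" "t \<le> 1" for u w r s t
      using convex_onD[OF conv, of t "(u, r *\<^sub>R (L *v v))" "(w, s *\<^sub>R (L *v v))"] that
      by (simp add: G_def scaleR_add_left)
    have Glip: "\<bar>G u r - G w r\<bar> \<le> K * norm (u - w)"
      if "u \<in> ball x \<delta>" "w \<in> ball x \<delta>" "0 \<le> r" "r \<le> a" for u w r
      unfolding G_def using that False by (intro glip) (auto simp: a_def field_simps)
    have Ga: "G u a > 0" if "u \<in> ball x \<delta>" for u
      unfolding G_def using that False R by (intro gpos) (auto simp: a_def)
    have G0: "G u 0 \<le> - \<beta>" if "u \<in> ball x \<delta>" for u using gneg[OF that] by (simp add: G_def)
    obtain \<rho> where \<rho>: "\<And>u. u \<in> ball x \<delta> \<Longrightarrow> 0 < \<rho> u \<and> \<rho> u < a"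
      and \<rho>set: "\<And>u. u \<in> ball x \<delta> \<Longrightarrow> {r. 0 \<le> r \<and> G u r \<le> 0} = {0..\<rho> u}"
      and \<rho>conc: "\<And>u w t. u \<in> ball x \<delta> \<Longrightarrow> w \<in> ball x \<delta> \<Longrightarrow> 0 \<le> t \<Longrightarrow> t \<le> 1 \<Longrightarrow>
        (1 - t) * \<rho> u + t * \<rho> w \<le> \<rho> ((1 - t) *\<^sub>R u + t *\<^sub>R w)"
      and \<rho>lip: "\<And>u w. u \<in> ball x \<delta> \<Longrightarrow> w \<in> ball x \<delta> \<Longrightarrow> \<rho> u - \<rho> w \<le> \<rho> w * (K / \<beta> * norm (u - w))"
    proof (rule convex_root[where G = G and K = K and \<beta> = \<beta> and x = x and \<delta> = \<delta> and a = a,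
            OF Gconv gcont \<beta> K a G0 Ga Glip])
      fix \<rho>' assume "\<And>u. u \<in> ball x \<delta> \<Longrightarrow> 0 < \<rho>' u \<and> \<rho>' u < a"
        "\<And>u. u \<in> ball x \<delta> \<Longrightarrow> {r. 0 \<le> r \<and> G u r \<le> 0} = {0..\<rho>' u}"
        "\<And>u w t. u \<in> ball x \<delta> \<Longrightarrow> w \<in> ball x \<delta> \<Longrightarrow> 0 \<le> t \<Longrightarrow> t \<le> 1 \<Longrightarrow>
          (1 - t) * \<rho>' u + t * \<rho>' w \<le> \<rho>' ((1 - t) *\<^sub>R u + t *\<^sub>R w)"
        "\<And>u w. u \<in> ball x \<delta> \<Longrightarrow> w \<in> ball x \<delta> \<Longrightarrow> \<rho>' u - \<rho>' w \<le> \<rho>' w * (K / \<beta> * norm (u - w))"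
      from that[OF this] show thesis .
    qed
    have e: "radial_prob g L u v = F (\<rho> u)" if "u \<in> ball x \<delta>" for u
      using \<rho>set[OF that] Fm[of "\<rho> u"] \<rho>[OF that] by (simp add: radial_prob_def G_def)
    have KB: "K / \<beta> \<ge> 0" using K \<beta> by simp
    \<comment> \<open>This constant depends on \<open>v\<close> through \<open>a\<close>; it serves
      only the regularity for a fixed direction. The uniform estimate is
      \<open>flip\<close>.\<close>
    have \<rho>lip': "\<bar>\<rho> u - \<rho> w\<bar> \<le> (a * (K / \<beta>)) * norm (u - w)" if u: "u \<in> ball x \<delta>" and w: "w \<in> ball x \<delta>" for u w
    proof -
      have "\<rho> u * (K / \<beta> * norm (u - w)) \<le> a * (K / \<beta> * norm (u - w))"
        "\<rho> w * (K / \<beta> * norm (u - w)) \<le> a * (K / \<beta> * norm (u - w))"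
        using \<rho>[OF u] \<rho>[OF w] KB by (auto intro!: mult_right_mono mult_nonneg_nonneg simp del: times_divide_eq_left)
      then show ?thesis using \<rho>lip[OF u w] \<rho>lip[OF w u] by (simp add: norm_minus_commute mult.assoc)
    qed
    have flip: "F (\<rho> u) - F (\<rho> w) \<le> c * K / \<beta> * norm (u - w) \<and> F (\<rho> w) - F (\<rho> u) \<le> c * K / \<beta> * norm (u - w)"
      if u: "u \<in> ball x \<delta>" and w: "w \<in> ball x \<delta>" and le: "\<rho> w \<le> \<rho> u" for u w
    proof -
      have "\<bar>F (\<rho> u) - F (\<rho> w)\<bar> \<le> c / \<rho> w * (\<rho> u - \<rho> w)"
        using \<rho>[OF w] le by (intro F_increment) auto
      also have "\<dots> \<le> c / \<rho> w * (\<rho> w * (K / \<beta> * norm (u - w)))"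
        using \<rho>[OF w] c \<rho>lip[OF u w] by (intro mult_left_mono) auto
      also have "\<dots> = c * K / \<beta> * norm (u - w)" using \<rho>[OF w] by simp
      finally show ?thesis by linarith
    qed
    have "\<bar>radial_prob g L u v - radial_prob g L w v\<bar> \<le> c * K / \<beta> * norm (u - w)"
      if u: "u \<in> ball x \<delta>" and w: "w \<in> ball x \<delta>" for u w
    proof (cases "\<rho> w \<le> \<rho> u")
      case True
      then show ?thesis using flip[OF u w True] by (simp add: e u w abs_le_iff del: mem_ball)
    next
      case False
      then have "\<rho> u \<le> \<rho> w" by simp
      then show ?thesis using flip[OF w u] by (simp add: e u w abs_le_iff norm_minus_commute del: mem_ball)
    qed
    moreover have "\<exists>p. concave_regular (\<lambda>u. radial_prob g L u v) x p"
      by (rule concave_regular_compose[where \<rho> = \<rho> and F = F and \<kappa> = \<kappa>, OF \<delta> \<rho>conc \<rho>lip' _ F \<kappa>cont _ e])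
        (use \<rho>[of x] \<delta> \<kappa>0 in auto)
    ultimately show ?thesis by blast
  qed
  show thesis
    by (rule that[of \<delta> "c * K / \<beta>"]) (use * \<delta> c K \<beta> in auto)
qed

section \<open>Polar coordinates and the Gaussian measure\<close>

text \<open>The image of Lebesgue measure under the norm: the dimension times the volume of the unit
  ball is the surface area of the unit sphere.\<close>

definition radial_measure :: "'a::euclidean_space itself \<Rightarrow> real measure" where
  "radial_measure _ = density lborel
     (\<lambda>r. ennreal (real DIM('a) * unit_ball_vol (real DIM('a)) * r ^ (DIM('a) - 1)) * indicator {0..} r)"

lemma sets_radial_measure [simp, measurable_cong]: "sets (radial_measure TYPE('a::euclidean_space)) = sets borel"
  by (simp add: radial_measure_def)

lemma emeasure_radial_lessThan:
  fixes r :: real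
  assumes r: "r \<ge> 0"
  shows "emeasure (radial_measure TYPE('a::euclidean_space)) {..<r} = ennreal (unit_ball_vol (real DIM('a)) * r ^ DIM('a))"
proof -
  let ?m = "DIM('a)" and ?w = "unit_ball_vol (real DIM('a))"
  have "emeasure (radial_measure TYPE('a)) {..<r}
      = (\<integral>\<^sup>+s. ennreal (real ?m * ?w * s ^ (?m - 1)) * indicator {0..} s * indicator {..<r} s \<partial>lborel)"
    unfolding radial_measure_def by (subst emeasure_density) auto
  also have "\<dots> = (\<integral>\<^sup>+s. ennreal (real ?m * ?w * s ^ (?m - 1)) * indicator {0..r} s \<partial>lborel)"
    using AE_lborel_singleton[of r]
    by (intro nn_integral_cong_AE) (auto split: split_indicator elim!: eventually_mono)
  also have "\<dots> = ennreal (?w * r ^ ?m - ?w * 0 ^ ?m)"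
    using r by (intro nn_integral_FTC_Icc) (auto intro!: derivative_eq_intros)
  finally show ?thesis by (simp add: zero_power)
qed

lemma sigma_finite_radial_measure: "sigma_finite_measure (radial_measure TYPE('a::euclidean_space))"
proof
  let ?A = "range (\<lambda>n. {..<real n})"
  have "emeasure (radial_measure TYPE('a)) {..<real n} \<noteq> \<infinity>" for n
    by (subst emeasure_radial_lessThan) auto
  then show "\<exists>A. countable A \<and> A \<subseteq> sets (radial_measure TYPE('a)) \<and> \<Union> A = space (radial_measure TYPE('a))
      \<and> (\<forall>a\<in>A. emeasure (radial_measure TYPE('a)) a \<noteq> \<infinity>)"
    by (intro exI[of _ ?A]) (auto simp: radial_measure_def intro: reals_Archimedean2)
qed

lemma sets_uniform_sphere [simp, measurable_cong]: "sets (uniform_sphere :: 'a::euclidean_space measure) = sets borel"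
  and space_uniform_sphere [simp]: "space (uniform_sphere :: 'a::euclidean_space measure) = UNIV"
  by (auto simp: uniform_sphere_def)

lemma prob_space_uniform_sphere: "prob_space (uniform_sphere :: 'a::euclidean_space measure)"
proof -
  have "prob_space (uniform_measure lborel (ball (0::'a) 1))"
    using unit_ball_vol_pos[of "real DIM('a)"]
    by (intro prob_space_uniform_measure) (auto simp: emeasure_ball simp del: unit_ball_vol_pos)
  then show ?thesis
    unfolding uniform_sphere_def by (rule prob_space.prob_space_distr) measurable
qed

lemma emeasure_uniform_sphere:
  fixes B :: "'a::euclidean_space set"
  assumes [measurable]: "B \<in> sets borel"
  shows "emeasure uniform_sphere B * ennreal (unit_ball_vol (real DIM('a)))
    = emeasure lborel {x. norm x < 1 \<and> x /\<^sub>R norm x \<in> B}"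
proof -
  have w: "unit_ball_vol (real DIM('a)) > 0" by simp
  have em: "emeasure lborel (ball (0::'a) 1) = ennreal (unit_ball_vol (real DIM('a)))"
    by (simp add: emeasure_ball)
  have eq: "ball (0::'a) 1 \<inter> {x. x /\<^sub>R norm x \<in> B} = {x. norm x < 1 \<and> x /\<^sub>R norm x \<in> B}"
    by auto
  have "emeasure uniform_sphere B = emeasure (uniform_measure lborel (ball (0::'a) 1)) {x. x /\<^sub>R norm x \<in> B}"
    unfolding uniform_sphere_def by (subst emeasure_distr) (auto simp: vimage_def)
  also have "\<dots> = emeasure lborel {x. norm x < 1 \<and> x /\<^sub>R norm x \<in> B} / ennreal (unit_ball_vol (real DIM('a)))"
    by (subst emeasure_uniform_measure) (auto simp: eq em simp del: mem_ball)
  moreover have "ennreal W / ennreal W = 1" if "W > 0" for W :: real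
    using that by (simp add: divide_ennreal)
  note this[OF w]
  ultimately show ?thesis
    by (simp add: ennreal_divide_times ennreal_times_divide[symmetric])
qed

lemma emeasure_cone_scale:
  fixes B :: "'a::euclidean_space set" and r :: real
  assumes [measurable]: "B \<in> sets borel" and r: "r > 0"
  shows "emeasure lborel {x. norm x < r \<and> x /\<^sub>R norm x \<in> B}
    = ennreal (r ^ DIM('a)) * emeasure lborel {x. norm x < 1 \<and> x /\<^sub>R norm x \<in> B}"
proof -
  let ?X = "{x. norm x < r \<and> x /\<^sub>R norm x \<in> B}"
  have [measurable]: "?X \<in> sets borel" by measurable
  have "emeasure lborel ?X = emeasure (density (distr lborel borel (\<lambda>x. 0 + r *\<^sub>R x)) (\<lambda>_. ennreal (\<bar>r\<bar> ^ DIM('a)))) ?X"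
    using lborel_affine[of r "0::'a"] r by simp
  also have "\<dots> = ennreal (r ^ DIM('a)) * emeasure (distr lborel borel (\<lambda>x. 0 + r *\<^sub>R x)) ?X"
    using r by (subst emeasure_density_const) auto
  also have "emeasure (distr lborel borel (\<lambda>x. 0 + r *\<^sub>R x)) ?X = emeasure lborel ((\<lambda>x. 0 + r *\<^sub>R x) -` ?X \<inter> space lborel)"
    by (rule emeasure_distr) auto
  also have "(\<lambda>x. 0 + r *\<^sub>R x) -` ?X \<inter> space lborel = {x. norm x < 1 \<and> x /\<^sub>R norm x \<in> B}"
    using r by (auto simp: field_simps)
  finally show ?thesis .
qed

text \<open>It suffices to compare rectangles. For a fixed set \<open>B\<close> of directions both
  sides are measures in the radius, \<open>N1\<close> and \<open>N2\<close>, and they agree on the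
  half-lines below r because the volume of a cone scales with the power \<open>DIM('a)\<close> of
  r.\<close>

theorem polar_coordinates:
  "radial_measure TYPE('a) \<Otimes>\<^sub>M (uniform_sphere :: 'a::euclidean_space measure)
    = distr lborel (borel \<Otimes>\<^sub>M borel) (\<lambda>x. (norm x, x /\<^sub>R norm x))"
proof (rule pair_measure_eqI)
  show "sigma_finite_measure (radial_measure TYPE('a))" by (rule sigma_finite_radial_measure)
  interpret U: prob_space "uniform_sphere :: 'a measure" by (rule prob_space_uniform_sphere)
  show "sigma_finite_measure (uniform_sphere :: 'a measure)" by unfold_locales
  show "sets (radial_measure TYPE('a) \<Otimes>\<^sub>M (uniform_sphere :: 'a measure))
      = sets (distr lborel (borel \<Otimes>\<^sub>M borel) (\<lambda>x::'a. (norm x, x /\<^sub>R norm x)))"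
    by (simp cong: sets_pair_measure_cong)
  fix A and B :: "'a set"
  assume "A \<in> sets (radial_measure TYPE('a))" "B \<in> sets uniform_sphere"
  then have [measurable]: "A \<in> sets borel" "B \<in> sets borel" by auto
  let ?\<kappa> = "radial_measure TYPE('a)" and ?w = "unit_ball_vol (real DIM('a))"
  define N1 where "N1 = distr (density lborel (indicator {x::'a. x /\<^sub>R norm x \<in> B})) borel norm"
  define N2 where "N2 = density ?\<kappa> (\<lambda>_. emeasure uniform_sphere B)"
  have N1: "emeasure N1 S = emeasure lborel {x::'a. norm x \<in> S \<and> x /\<^sub>R norm x \<in> B}" if [measurable]: "S \<in> sets borel" for S
  proof -
    have [measurable]: "(norm :: 'a \<Rightarrow> real) -` S \<in> sets borel"
      by (rule measurable_sets_borel) measurable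
    have "emeasure N1 S = (\<integral>\<^sup>+x. indicator {x::'a. x /\<^sub>R norm x \<in> B} x * indicator (norm -` S) x \<partial>lborel)"
      unfolding N1_def by (subst emeasure_distr) (auto simp: emeasure_density)
    also have "\<dots> = (\<integral>\<^sup>+x. indicator {x::'a. norm x \<in> S \<and> x /\<^sub>R norm x \<in> B} x \<partial>lborel)"
      by (intro nn_integral_cong) (auto split: split_indicator)
    finally show ?thesis by simp
  qed
  have N2: "emeasure N2 S = emeasure uniform_sphere B * emeasure ?\<kappa> S" if "S \<in> sets borel" for S
    unfolding N2_def using that by (subst emeasure_density_const) auto
  have less: "emeasure N1 {..<r} = emeasure N2 {..<r}" for r :: real
  proof (cases "r > 0")
    case True
    have "emeasure N1 {..<r} = ennreal (r ^ DIM('a)) * (emeasure uniform_sphere B * ennreal ?w)"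
      by (simp add: N1 emeasure_cone_scale[OF _ True] emeasure_uniform_sphere)
    then show ?thesis
      using True by (simp add: N2 emeasure_radial_lessThan ennreal_mult mult_ac)
  next
    case False
    have "\<not> norm x < r" for x :: 'a using False norm_ge_zero[of x] by linarith
    then have "emeasure lborel {x::'a. norm x < r \<and> x /\<^sub>R norm x \<in> B} = 0" by simp
    then have "emeasure N1 {..<r} = 0" by (simp add: N1)
    moreover have "emeasure ?\<kappa> {..<r} \<le> emeasure ?\<kappa> {..<0}" using False by (intro emeasure_mono) auto
    then have "emeasure ?\<kappa> {..<r} = 0" by (simp add: emeasure_radial_lessThan zero_power)
    ultimately show ?thesis by (simp add: N2)
  qed
  have "N1 = N2"
  proof (rule measure_eqI_generator_eq[where E = "range lessThan" and \<Omega> = UNIV and A = "\<lambda>n. {..<real n}"])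
    show "Int_stable (range lessThan :: real set set)"
    proof (rule Int_stableI)
      fix S T :: "real set" assume "S \<in> range lessThan" "T \<in> range lessThan"
      then obtain a b where "S = {..<a}" "T = {..<b}" by blast
      then have "S \<inter> T = {..<min a b}" by auto
      then show "S \<inter> T \<in> range lessThan" by blast
    qed
    show "sets N1 = sigma_sets UNIV (range lessThan)" "sets N2 = sigma_sets UNIV (range lessThan)"
      by (simp_all add: N1_def N2_def borel_Iio)
    show "emeasure N1 {..<real n} \<noteq> \<infinity>" for n
      unfolding less by (simp add: N2 emeasure_radial_lessThan ennreal_mult_eq_top_iff U.emeasure_eq_measure)
    show "(\<Union>n. {..<real n}) = UNIV" by (auto intro: reals_Archimedean2)
  qed (use less in auto)
  then have "emeasure N1 A = emeasure N2 A" by simp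
  moreover have "emeasure (distr lborel (borel \<Otimes>\<^sub>M borel) (\<lambda>x::'a. (norm x, x /\<^sub>R norm x))) (A \<times> B) = emeasure N1 A"
    by (subst emeasure_distr) (auto simp: N1 vimage_def)
  ultimately show "emeasure ?\<kappa> A * emeasure uniform_sphere B
      = emeasure (distr lborel (borel \<Otimes>\<^sub>M borel) (\<lambda>x::'a. (norm x, x /\<^sub>R norm x))) (A \<times> B)"
    by (simp add: N2 mult.commute)
qed

section \<open>The standard Gaussian measure in polar coordinates\<close>

definition std_gaussian :: "'a::euclidean_space measure" where
  "std_gaussian = density lborel (\<lambda>x. ennreal (\<Prod>b\<in>Basis. std_normal_density (x \<bullet> b)))"

lemma sets_std_gaussian [simp, measurable_cong]: "sets (std_gaussian :: 'a::euclidean_space measure) = sets borel"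
  and space_std_gaussian [simp]: "space (std_gaussian :: 'a::euclidean_space measure) = UNIV"
  by (auto simp: std_gaussian_def)

lemma prob_space_std_gaussian: "prob_space (std_gaussian :: 'a::euclidean_space measure)"
proof
  have "emeasure (std_gaussian :: 'a measure) UNIV = (\<integral>\<^sup>+x. (\<Prod>b\<in>(Basis::'a set). ennreal (std_normal_density (x \<bullet> b))) \<partial>lborel)"
    by (simp add: std_gaussian_def emeasure_density prod_ennreal)
  also have "\<dots> = (\<Prod>b\<in>(Basis::'a set). \<integral>\<^sup>+x. ennreal (std_normal_density x) \<partial>lborel)"
    by (rule nn_integral_lborel_prod) auto
  also have "(\<integral>\<^sup>+x. ennreal (std_normal_density x) \<partial>lborel) = 1"
    using prob_space.emeasure_space_1[OF prob_space_normal_density[of 1 0]] by (simp add: emeasure_density)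
  finally show "emeasure (std_gaussian :: 'a measure) (space std_gaussian) = 1" by simp
qed

lemma sum_Basis_neg_half_square: "(\<Sum>b\<in>Basis. - ((x \<bullet> b)\<^sup>2) / 2) = - ((norm x)\<^sup>2) / 2"
  for x :: "'a::euclidean_space"
proof -
  have "(norm x)\<^sup>2 = (\<Sum>b\<in>Basis. (x \<bullet> b)\<^sup>2)"
    unfolding power2_norm_eq_inner euclidean_inner[of x x] by (simp add: power2_eq_square)
  then show ?thesis by (simp add: sum_negf sum_divide_distrib)
qed

lemma std_gaussian_density_radial:
  "(\<Prod>b\<in>Basis. std_normal_density ((x::'a::euclidean_space) \<bullet> b))
    = (2 * pi) powr (- real DIM('a) / 2) * exp (- ((norm x)\<^sup>2) / 2)"
proof -
  have "(\<Prod>b\<in>Basis. std_normal_density (x \<bullet> b)) = (\<Prod>b\<in>(Basis::'a set). (2 * pi) powr (- 1 / 2) * exp (- ((x \<bullet> b)\<^sup>2) / 2))"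
    by (intro prod.cong) (simp_all add: normal_density_def powr_minus powr_half_sqrt field_simps)
  also have "\<dots> = ((2 * pi) powr (- 1 / 2)) ^ DIM('a) * exp (\<Sum>b\<in>(Basis::'a set). - ((x \<bullet> b)\<^sup>2) / 2)"
    by (simp add: prod.distrib exp_sum)
  also have "((2 * pi) powr (- 1 / 2)) ^ DIM('a) = (2 * pi) powr (- real DIM('a) / 2)"
    by (simp add: powr_realpow[symmetric] powr_powr)
  also have "(\<Sum>b\<in>(Basis::'a set). - ((x \<bullet> b)\<^sup>2) / 2) = - ((norm x)\<^sup>2) / 2"
    by (rule sum_Basis_neg_half_square)
  finally show ?thesis .
qed

text \<open>The Gaussian constant times the sphere's surface area is the chi constant; the unit ball
  volume is \<open>pi powr (m / 2) / Gamma (m / 2 + 1)\<close>, and the recursion of Gamma absorbs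
  the factor m.\<close>

lemma chi_normalisation:
  assumes "m > 0"
  shows "(2 * pi) powr (- real m / 2) * (real m * unit_ball_vol (real m)) = 1 / (2 powr (real m / 2 - 1) * Gamma (real m / 2))"
proof -
  have G: "Gamma (real m / 2 + 1) = real m / 2 * Gamma (real m / 2)"
    using assms by (intro Gamma_plus1) (auto dest: nonpos_Ints_nonpos)
  have p: "2 powr (real m / 2 - 1) = 2 powr (real m / 2) / 2" by (simp add: powr_diff)
  have "Gamma (real m / 2) > 0" using assms by (intro Gamma_real_pos) simp
  then show ?thesis
    using assms unfolding unit_ball_vol_def G p
    by (simp add: powr_mult powr_minus field_simps)
qed

text \<open>The Gaussian density depends on the norm alone, so it joins the radial density, and
  their product on nonnegative radii is the chi density.\<close>

lemma std_gaussian_polar: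
  fixes A :: "'a::euclidean_space set"
  assumes [measurable]: "A \<in> sets borel"
  shows "emeasure std_gaussian A = (\<integral>\<^sup>+v. emeasure (chi_measure DIM('a)) {r. 0 \<le> r \<and> r *\<^sub>R v \<in> A} \<partial>uniform_sphere)"
proof -
  let ?m = "DIM('a)" and ?w = "unit_ball_vol (real DIM('a))"
  define d where "d r = (2 * pi) powr (- real ?m / 2) * exp (- (r\<^sup>2) / 2)" for r
  have [measurable]: "d \<in> borel_measurable borel" unfolding d_def by measurable
  define h where "h p = ennreal (d (fst p)) * indicator A (fst p *\<^sub>R snd p)" for p :: "real \<times> 'a"
  have hm[measurable]: "h \<in> borel_measurable (borel \<Otimes>\<^sub>M borel)" unfolding h_def by measurable
  interpret U: prob_space "uniform_sphere :: 'a measure" by (rule prob_space_uniform_sphere)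
  interpret R: sigma_finite_measure "radial_measure TYPE('a)" by (rule sigma_finite_radial_measure)
  interpret P: pair_sigma_finite "radial_measure TYPE('a)" "uniform_sphere :: 'a measure" ..
  have sets: "sets (radial_measure TYPE('a) \<Otimes>\<^sub>M (uniform_sphere :: 'a measure)) = sets (borel \<Otimes>\<^sub>M borel)"
    by (intro sets_pair_measure_cong) auto
  have [measurable]: "chi_density ?m \<in> borel_measurable borel"
    unfolding chi_density_def[abs_def] by measurable
  have "emeasure std_gaussian A = (\<integral>\<^sup>+x. ennreal (d (norm x)) * indicator A x \<partial>lborel)"
    unfolding std_gaussian_def std_gaussian_density_radial d_def by (subst emeasure_density) auto
  also have "\<dots> = (\<integral>\<^sup>+x. h (norm x, x /\<^sub>R norm x) \<partial>lborel)"
  proof (rule nn_integral_cong)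
    fix x :: 'a
    \<comment> \<open>The convention \<open>inverse 0 = 0\<close> makes the polar representation
      valid at the origin too.\<close>
    have "norm x *\<^sub>R (x /\<^sub>R norm x) = x" by (cases "x = 0") auto
    then show "ennreal (d (norm x)) * indicator A x = h (norm x, x /\<^sub>R norm x)" by (simp add: h_def)
  qed
  also have "\<dots> = (\<integral>\<^sup>+p. h p \<partial>distr lborel (borel \<Otimes>\<^sub>M borel) (\<lambda>x. (norm x, x /\<^sub>R norm x)))"
    by (subst nn_integral_distr) auto
  also have "\<dots> = (\<integral>\<^sup>+p. h p \<partial>(radial_measure TYPE('a) \<Otimes>\<^sub>M uniform_sphere))"
    by (simp add: polar_coordinates)
  also have "\<dots> = (\<integral>\<^sup>+v. \<integral>\<^sup>+r. h (r, v) \<partial>radial_measure TYPE('a) \<partial>uniform_sphere)"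
    by (rule P.nn_integral_snd[symmetric]) (simp add: measurable_cong_sets[OF sets refl])
  also have "\<dots> = (\<integral>\<^sup>+v. emeasure (chi_measure ?m) {r. 0 \<le> r \<and> r *\<^sub>R v \<in> A} \<partial>uniform_sphere)"
  proof (rule nn_integral_cong)
    fix v :: 'a
    have [measurable]: "{r::real. 0 \<le> r \<and> r *\<^sub>R v \<in> A} \<in> sets borel" by measurable
    have "(\<integral>\<^sup>+r. h (r, v) \<partial>radial_measure TYPE('a))
        = (\<integral>\<^sup>+r. (ennreal (real ?m * ?w * r ^ (?m - 1)) * indicator {0..} r) * h (r, v) \<partial>lborel)"
      unfolding radial_measure_def by (subst nn_integral_density) auto
    also have "\<dots> = (\<integral>\<^sup>+r. ennreal (chi_density ?m r) * indicator {r. 0 \<le> r \<and> r *\<^sub>R v \<in> A} r \<partial>lborel)"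
    proof (rule nn_integral_cong)
      fix r :: real
      show "(ennreal (real ?m * ?w * r ^ (?m - 1)) * indicator {0..} r) * h (r, v)
          = ennreal (chi_density ?m r) * indicator {r. 0 \<le> r \<and> r *\<^sub>R v \<in> A} r"
      proof (cases "0 \<le> r \<and> r *\<^sub>R v \<in> A")
        case True
        have "real ?m * ?w * r ^ (?m - 1) * d r
            = ((2 * pi) powr (- real ?m / 2) * (real ?m * ?w)) * (r ^ (?m - 1) * exp (- (r\<^sup>2) / 2))"
          by (simp add: d_def mult_ac)
        also have "\<dots> = chi_density ?m r"
          using True by (subst chi_normalisation) (auto simp: chi_density_def)
        finally have "real ?m * ?w * r ^ (?m - 1) * d r = chi_density ?m r" .
        then show ?thesis
          using True by (simp add: h_def ennreal_mult'[symmetric] d_def)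
      qed (auto simp: h_def split: split_indicator)
    qed
    also have "\<dots> = emeasure (chi_measure ?m) {r. 0 \<le> r \<and> r *\<^sub>R v \<in> A}"
      unfolding chi_measure_def by (subst emeasure_density) auto
    finally show "(\<integral>\<^sup>+r. h (r, v) \<partial>radial_measure TYPE('a)) = emeasure (chi_measure ?m) {r. 0 \<le> r \<and> r *\<^sub>R v \<in> A}" .
  qed
  finally show ?thesis .
qed

text \<open>The total mass is read off from the polar formula for the whole space, which replaces
  evaluating a Gamma integral.\<close>

lemma prob_space_chi_measure:
  "prob_space (chi_measure DIM('a::euclidean_space))"
proof
  interpret U: prob_space "uniform_sphere :: 'a measure" by (rule prob_space_uniform_sphere)
  have [measurable]: "chi_density DIM('a) \<in> borel_measurable borel"
    unfolding chi_density_def[abs_def] by measurable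
  have "1 = (\<integral>\<^sup>+v. emeasure (chi_measure DIM('a)) {r. 0 \<le> r} \<partial>(uniform_sphere :: 'a measure))"
  proof -
    have "emeasure (std_gaussian :: 'a measure) UNIV = 1"
      using prob_space.emeasure_space_1[OF prob_space_std_gaussian[where 'a = 'a]] by (simp only: space_std_gaussian)
    then show ?thesis
      using std_gaussian_polar[of "UNIV :: 'a set"] by (simp only: sets.top[of borel, unfolded space_borel] UNIV_I simp_thms)
  qed
  also have "\<dots> = emeasure (chi_measure DIM('a)) {r. 0 \<le> r}"
    using U.emeasure_space_1 by (simp only: nn_integral_const mult_1_right)
  also have "\<dots> = emeasure (chi_measure DIM('a)) (space (chi_measure DIM('a)))"
  proof -
    have "emeasure (chi_measure DIM('a)) UNIV = (\<integral>\<^sup>+r. ennreal (chi_density DIM('a) r) * indicator UNIV r \<partial>lborel)"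
      unfolding chi_measure_def by (subst emeasure_density) auto
    also have "\<dots> = (\<integral>\<^sup>+r. ennreal (chi_density DIM('a) r) * indicator {r. 0 \<le> r} r \<partial>lborel)"
      by (rule nn_integral_cong) (simp add: chi_density_def split: split_indicator)
    also have "\<dots> = emeasure (chi_measure DIM('a)) {r. 0 \<le> r}"
      unfolding chi_measure_def by (subst emeasure_density) auto
    finally show ?thesis by (simp add: chi_measure_def)
  qed
  finally show "emeasure (chi_measure DIM('a)) (space (chi_measure DIM('a))) = 1" by simp
qed

section \<open>Uniqueness of characteristic functions\<close>

text \<open>A nonnegative weight can be normalised to a probability density. The images under
  \<open>X\<close> are then distributions on the line with equal characteristic functions, so Levy's
  uniqueness theorem applies.\<close>

lemma weighted_char_determines:
  fixes M N :: "'a measure" and X w :: "'a \<Rightarrow> real"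
  assumes fin: "finite_measure M" "finite_measure N" and sets: "sets N = sets M"
    and X[measurable]: "X \<in> borel_measurable M" and w[measurable]: "w \<in> borel_measurable M"
    and w0: "\<And>x. 0 \<le> w x" and wB: "\<And>x. w x \<le> B"
    and eq: "\<And>t. (CLINT x|M. w x *\<^sub>R iexp (t * X x)) = (CLINT x|N. w x *\<^sub>R iexp (t * X x))"
    and S[measurable]: "S \<in> sets borel"
  shows "(\<integral>x. w x * indicator S (X x) \<partial>M) = (\<integral>x. w x * indicator S (X x) \<partial>N)"
proof -
  have [measurable]: "X \<in> borel_measurable N" "w \<in> borel_measurable N"
    using X w by (auto simp: measurable_cong_sets[OF sets refl])
  have wint: "integrable M w" "integrable N w"
    using w0 wB fin by (auto intro!: finite_measure.integrable_const_bound[where B = B])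
  define c where "c = (\<integral>x. w x \<partial>M)"
  have cN: "(\<integral>x. w x \<partial>N) = c"
  proof -
    have "complex_of_real (\<integral>x. w x \<partial>M) = complex_of_real (\<integral>x. w x \<partial>N)"
      using eq[of 0] by (simp add: scaleR_conv_of_real)
    then show ?thesis by (simp add: c_def)
  qed
  have c0: "c \<ge> 0" unfolding c_def using w0 by (intro Bochner_Integration.integral_nonneg) auto
  show ?thesis
  proof (cases "c = 0")
    \<comment> \<open>A weight of total mass 0 cannot be normalised, but then both integrals
      vanish.\<close>
    case True
    have "(\<integral>x. w x * indicator S (X x) \<partial>K) = 0"
      if K: "K = M \<or> K = N" for K
    proof (rule antisym)
      have [measurable]: "X \<in> borel_measurable K" "w \<in> borel_measurable K" and int: "integrable K w" and "(\<integral>x. w x \<partial>K) = 0"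
        using K wint cN True c_def by auto
      have "integrable K (\<lambda>x. w x * indicator S (X x))"
        by (rule Bochner_Integration.integrable_bound[OF int]) (auto split: split_indicator)
      then have "(\<integral>x. w x * indicator S (X x) \<partial>K) \<le> (\<integral>x. w x \<partial>K)"
        using w0 int by (intro integral_mono) (auto split: split_indicator)
      then show "(\<integral>x. w x * indicator S (X x) \<partial>K) \<le> 0" using \<open>(\<integral>x. w x \<partial>K) = 0\<close> by simp
      show "0 \<le> (\<integral>x. w x * indicator S (X x) \<partial>K)"
        using w0 by (intro Bochner_Integration.integral_nonneg) auto
    qed
    then show ?thesis by simp
  next
    case False
    then have c: "c > 0" using c0 by simp
    define D where "D K = distr (density K (\<lambda>x. ennreal (w x / c))) borel X" for K :: "'a measure"
    have D: "real_distribution (D K)" "char (D K) t = (CLINT x|K. w x *\<^sub>R iexp (t * X x)) /\<^sub>R c"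
      "measure (D K) S = (\<integral>x. w x * indicator S (X x) \<partial>K) / c"
      if K: "K = M \<or> K = N" for K t
    proof -
      have [measurable]: "X \<in> borel_measurable K" "w \<in> borel_measurable K"
        and int: "integrable K w" and ic: "(\<integral>x. w x \<partial>K) = c"
        using K wint cN c_def by auto
      have "emeasure (density K (\<lambda>x. ennreal (w x / c))) (space K) = (\<integral>\<^sup>+x. ennreal (w x / c) \<partial>K)"
        by (simp add: emeasure_density cong: nn_integral_cong)
      also have "\<dots> = ennreal (\<integral>x. w x / c \<partial>K)"
        using int w0 c by (intro nn_integral_eq_integral) auto
      also have "\<dots> = 1" using ic c by simp
      finally have "prob_space (density K (\<lambda>x. ennreal (w x / c)))"
        by (intro prob_spaceI) simp
      then have ps: "prob_space (D K)"
        unfolding D_def by (rule prob_space.prob_space_distr) simp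
      then show "real_distribution (D K)"
        by (intro real_distribution.intro real_distribution_axioms.intro) (auto simp: D_def)
      have "char (D K) t = (CLINT x|density K (\<lambda>x. ennreal (w x / c)). iexp (t * X x))"
        unfolding char_def D_def by (subst integral_distr) auto
      also have "\<dots> = (CLINT x|K. (w x / c) *\<^sub>R iexp (t * X x))"
        by (subst integral_density) (use w0 c in auto)
      also have "\<dots> = (CLINT x|K. (1 / c) *\<^sub>R (w x *\<^sub>R iexp (t * X x)))" by simp
      also have "\<dots> = (CLINT x|K. w x *\<^sub>R iexp (t * X x)) /\<^sub>R c"
        by (subst integral_scaleR_right) (simp add: divide_inverse)
      finally show "char (D K) t = (CLINT x|K. w x *\<^sub>R iexp (t * X x)) /\<^sub>R c" .
      have "measure (D K) S = (\<integral>x. indicator S x \<partial>D K)"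
        by (simp add: D_def)
      also have "\<dots> = (\<integral>x. indicator S (X x) \<partial>density K (\<lambda>x. ennreal (w x / c)))"
        unfolding D_def by (subst integral_distr) auto
      also have "\<dots> = (\<integral>x. (w x / c) * indicator S (X x) \<partial>K)"
        by (subst integral_density) (use w0 c in auto)
      also have "\<dots> = (\<integral>x. w x * indicator S (X x) \<partial>K) / c" by simp
      finally show "measure (D K) S = (\<integral>x. w x * indicator S (X x) \<partial>K) / c" .
    qed
    have "char (D M) t = char (D N) t" for t
      by (simp only: D(2)[OF disjI1[OF refl]] D(2)[OF disjI2[OF refl]] eq)
    then have "D M = D N"
      by (intro Levy_uniqueness D(1)) auto
    then show ?thesis using D(3)[of M] D(3)[of N] c by simp
  qed
qed

text \<open>A weighted exponential becomes a combination of pure exponentials at shifted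
  frequencies. The factor 1 and the bracketing match a three-entry list sum \<open>T\<close> in the
  uniqueness proof.\<close>

lemma cos_scaleR_iexp:
  "(r * (1 + cos \<theta>)) *\<^sub>R iexp s
    = 1 * (r *\<^sub>R iexp s) + (1/2 * (r *\<^sub>R iexp (s + \<theta>)) + 1/2 * (r *\<^sub>R iexp (s - \<theta>)))"
proof -
  have gen: "of_real r * (1 + (p + inverse p) / 2) * E
      = 1 * (of_real r * E) + (1/2 * (of_real r * (E * p)) + 1/2 * (of_real r * (E / p)))"
    if "p \<noteq> 0" for p E :: complex
    using that by (simp add: field_simps)
  have "complex_of_real (cos \<theta>) = (iexp \<theta> + inverse (iexp \<theta>)) / 2"
    by (simp add: cos_of_real[symmetric] cos_exp_eq exp_minus)
  moreover have "iexp (s + \<theta>) = iexp s * iexp \<theta>" "iexp (s - \<theta>) = iexp s / iexp \<theta>"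
    by (simp_all add: distrib_left right_diff_distrib exp_add exp_diff)
  ultimately show ?thesis
    using gen[OF exp_not_eq_zero, of "\<i> * complex_of_real \<theta>" "iexp s"]
    by (simp only: scaleR_conv_of_real of_real_mult of_real_add of_real_1)
qed

lemma sin_scaleR_iexp:
  "(r * (1 + sin \<theta>)) *\<^sub>R iexp s
    = 1 * (r *\<^sub>R iexp s) + (1/(2*\<i>) * (r *\<^sub>R iexp (s + \<theta>)) + - 1/(2*\<i>) * (r *\<^sub>R iexp (s - \<theta>)))"
proof -
  have gen: "of_real r * (1 + (p - inverse p) / (2*\<i>)) * E
      = 1 * (of_real r * E) + (1/(2*\<i>) * (of_real r * (E * p)) + - 1/(2*\<i>) * (of_real r * (E / p)))"
    if "p \<noteq> 0" for p E :: complex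
    using that by (simp add: field_simps)
  have "complex_of_real (sin \<theta>) = (iexp \<theta> - inverse (iexp \<theta>)) / (2*\<i>)"
    by (simp add: sin_of_real[symmetric] sin_exp_eq exp_minus)
  moreover have "iexp (s + \<theta>) = iexp s * iexp \<theta>" "iexp (s - \<theta>) = iexp s / iexp \<theta>"
    by (simp_all add: distrib_left right_diff_distrib exp_add exp_diff)
  ultimately show ?thesis
    using gen[OF exp_not_eq_zero, of "\<i> * complex_of_real \<theta>" "iexp s"]
    by (simp only: scaleR_conv_of_real of_real_mult of_real_add of_real_1)
qed

text \<open>Coordinates are processed one at a time: multiplying by \<open>1 + cos (a \<bullet> x)\<close> or \<open>1 + sin (a \<bullet> x)\<close>
  yields nonnegative weights, so that the one-dimensional uniqueness theorem of Levy applies to the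
  weighted projections and lets an indicator replace the exponential in that coordinate.\<close>

theorem char_determines_measure:
  fixes M N :: "'a::euclidean_space measure"
  assumes fin: "finite_measure M" "finite_measure N"
    and sets[measurable_cong]: "sets M = sets borel" "sets N = sets borel"
    and eq: "\<And>a. (CLINT x|M. iexp (a \<bullet> x)) = (CLINT x|N. iexp (a \<bullet> x))"
  shows "M = N"
proof -
  \<comment> \<open>\<open>J\<close> holds the coordinates whose exponential has already been
    exchanged for an indicator.\<close>
  define P where "P J S x = (\<Prod>j\<in>J. indicator (S j) (x \<bullet> j) :: real)" for J and S :: "'a \<Rightarrow> real set" and x :: 'a
  have P01: "0 \<le> P J S x" "P J S x \<le> 1" for J S x
    unfolding P_def by (auto intro!: prod_nonneg prod_le_1 split: split_indicator)
  have key: "(CLINT x|M. P J S x *\<^sub>R iexp (a \<bullet> x)) = (CLINT x|N. P J S x *\<^sub>R iexp (a \<bullet> x))"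
    if "finite J" "\<And>j. S j \<in> sets borel" for J S a
    using that
  proof (induction J arbitrary: a rule: finite_induct)
    case empty
    then show ?case using eq by (simp add: P_def)
  next
    case (insert j J)
    note S[measurable] = \<open>\<And>j. S j \<in> sets borel\<close>
    have IH: "(CLINT x|M. P J S x *\<^sub>R iexp (a \<bullet> x)) = (CLINT x|N. P J S x *\<^sub>R iexp (a \<bullet> x))" for a
      by (rule insert.IH[OF S])
    have [measurable]: "P J S \<in> borel_measurable borel" unfolding P_def by measurable
    have ci: "integrable K (\<lambda>x. P J S x *\<^sub>R iexp (a \<bullet> x))" if "K = M \<or> K = N" for K a
    proof -
      have [measurable_cong]: "sets K = sets borel" using that sets by auto
      show ?thesis
        by (rule finite_measure.integrable_const_bound[where B = 1])
          (use that fin P01 in \<open>auto simp: norm_mult\<close>)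
    qed
    \<comment> \<open>Combinations of the functions covered by the induction hypothesis; by
      linearity their integrals under \<open>M\<close> and \<open>N\<close> agree.\<close>
    define T where "T l x = (\<Sum>(c, b)\<leftarrow>l. c * (P J S x *\<^sub>R iexp (b \<bullet> x)))" for l :: "(complex \<times> 'a) list" and x
    have T: "integrable K (T l) \<and> (CLINT x|K. T l x) = (\<Sum>(c, b)\<leftarrow>l. c * (CLINT x|K. P J S x *\<^sub>R iexp (b \<bullet> x)))"
      if "K = M \<or> K = N" for K l
      unfolding T_def using ci[OF that] by (induction l) (auto simp del: mult_scaleR_right)
    have weighted: "(\<integral>x. W x * indicator (S j) (x \<bullet> j) \<partial>M) = (\<integral>x. W x * indicator (S j) (x \<bullet> j) \<partial>N)"
      if W: "\<And>x. 0 \<le> W x" "\<And>x. W x \<le> 2" and [measurable]: "W \<in> borel_measurable borel"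
        and exp: "\<And>t x. W x *\<^sub>R iexp (t * (x \<bullet> j)) = T (l t) x"
      for W l
    proof (rule weighted_char_determines[OF fin _ _ _ W(1) W(2)])
      show "(CLINT x|M. W x *\<^sub>R iexp (t * (x \<bullet> j))) = (CLINT x|N. W x *\<^sub>R iexp (t * (x \<bullet> j)))" for t
        unfolding exp by (simp only: T simp_thms IH)
    qed (use S in \<open>simp_all add: sets\<close>)
    have PW: "0 \<le> P J S x * s" "P J S x * s \<le> 2" if "0 \<le> s" "s \<le> 2" for x s
      using mult_mono[OF P01(2)[of J S x] that(2)] mult_nonneg_nonneg[OF P01(1)[of J S x] that(1)] that by simp_all
    let ?I = "\<lambda>x. indicator (S j) (x \<bullet> j) :: real"
    have w0: "(\<integral>x. P J S x * ?I x \<partial>M) = (\<integral>x. P J S x * ?I x \<partial>N)"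
    proof (rule weighted)
      show "P J S x \<le> 2" for x using P01(2)[of J S x] by simp
      show "P J S x *\<^sub>R iexp (t * (x \<bullet> j)) = T [(1, t *\<^sub>R j)] x" for t x
        by (simp add: T_def inner_commute)
    qed (auto simp: P01)
    have wc: "(\<integral>x. (P J S x * (1 + cos (a \<bullet> x))) * ?I x \<partial>M) = (\<integral>x. (P J S x * (1 + cos (a \<bullet> x))) * ?I x \<partial>N)"
    proof (rule weighted)
      have "0 \<le> 1 + cos (a \<bullet> x)" "1 + cos (a \<bullet> x) \<le> 2" for x
        using cos_ge_minus_one[of "a \<bullet> x"] cos_le_one[of "a \<bullet> x"] by linarith+
      then show "0 \<le> P J S x * (1 + cos (a \<bullet> x))" "P J S x * (1 + cos (a \<bullet> x)) \<le> 2" for x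
        by (blast intro: PW)+
      show "(P J S x * (1 + cos (a \<bullet> x))) *\<^sub>R iexp (t * (x \<bullet> j))
          = T [(1, t *\<^sub>R j), (1/2, t *\<^sub>R j + a), (1/2, t *\<^sub>R j - a)] x" for t x
        using cos_scaleR_iexp[of "P J S x" "a \<bullet> x" "t * (x \<bullet> j)"]
        by (simp add: T_def inner_add_left inner_diff_left inner_commute[of j x] del: mult_scaleR_right)
    qed measurable
    have ws: "(\<integral>x. (P J S x * (1 + sin (a \<bullet> x))) * ?I x \<partial>M) = (\<integral>x. (P J S x * (1 + sin (a \<bullet> x))) * ?I x \<partial>N)"
    proof (rule weighted)
      have "0 \<le> 1 + sin (a \<bullet> x)" "1 + sin (a \<bullet> x) \<le> 2" for x
        using sin_ge_minus_one[of "a \<bullet> x"] sin_le_one[of "a \<bullet> x"] by linarith+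
      then show "0 \<le> P J S x * (1 + sin (a \<bullet> x))" "P J S x * (1 + sin (a \<bullet> x)) \<le> 2" for x
        by (blast intro: PW)+
      show "(P J S x * (1 + sin (a \<bullet> x))) *\<^sub>R iexp (t * (x \<bullet> j))
          = T [(1, t *\<^sub>R j), (1/(2*\<i>), t *\<^sub>R j + a), (- 1/(2*\<i>), t *\<^sub>R j - a)] x" for t x
        using sin_scaleR_iexp[of "P J S x" "a \<bullet> x" "t * (x \<bullet> j)"]
        by (simp add: T_def inner_add_left inner_diff_left inner_commute[of j x] del: mult_scaleR_right)
    qed measurable
    \<comment> \<open>Subtracting the integral with weight \<open>P J S\<close> removes the 1 that
      made the weights nonnegative. What remains are the real and imaginary parts of the
      exponential, now with the indicator of coordinate \<open>j\<close>.\<close>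
    have split: "(CLINT x|K. P (insert j J) S x *\<^sub>R iexp (a \<bullet> x))
        = complex_of_real ((\<integral>x. (P J S x * (1 + cos (a \<bullet> x))) * ?I x \<partial>K) - (\<integral>x. P J S x * ?I x \<partial>K))
          + \<i> * complex_of_real ((\<integral>x. (P J S x * (1 + sin (a \<bullet> x))) * ?I x \<partial>K) - (\<integral>x. P J S x * ?I x \<partial>K))"
      if K: "K = M \<or> K = N" for K
    proof -
      have [measurable_cong]: "sets K = sets borel" using K sets by auto
      have bint: "integrable K f" if "f \<in> borel_measurable borel" "\<And>x. \<bar>f x\<bar> \<le> 2" for f :: "'a \<Rightarrow> real"
        by (rule finite_measure.integrable_const_bound[where B = 2]) (use that K fin in \<open>auto simp: sets cong: measurable_cong_sets\<close>)
      have b1: "\<bar>P J S x * ?I x * f\<bar> \<le> 2" if "\<bar>f\<bar> \<le> 2" for f x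
        using that P01[of J S x] by (auto simp: abs_mult split: split_indicator intro: order_trans[OF mult_left_le_one_le])
      have int0: "integrable K (\<lambda>x. P J S x * ?I x)" using b1[of 1] by (intro bint) auto
      have intc: "integrable K (\<lambda>x. P J S x * ?I x * cos (a \<bullet> x))"
        by (intro bint b1) (auto intro: order_trans[OF abs_cos_le_one])
      have ints: "integrable K (\<lambda>x. P J S x * ?I x * sin (a \<bullet> x))"
        by (intro bint b1) (auto intro: order_trans[OF abs_sin_le_one])
      have "(\<integral>x. (P J S x * (1 + cos (a \<bullet> x))) * ?I x \<partial>K) = (\<integral>x. P J S x * ?I x + P J S x * ?I x * cos (a \<bullet> x) \<partial>K)"
        by (intro Bochner_Integration.integral_cong) (auto simp: algebra_simps)
      then have c: "(\<integral>x. (P J S x * (1 + cos (a \<bullet> x))) * ?I x \<partial>K) - (\<integral>x. P J S x * ?I x \<partial>K) = (\<integral>x. P J S x * ?I x * cos (a \<bullet> x) \<partial>K)"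
        using int0 intc by simp
      have "(\<integral>x. (P J S x * (1 + sin (a \<bullet> x))) * ?I x \<partial>K) = (\<integral>x. P J S x * ?I x + P J S x * ?I x * sin (a \<bullet> x) \<partial>K)"
        by (intro Bochner_Integration.integral_cong) (auto simp: algebra_simps)
      then have s: "(\<integral>x. (P J S x * (1 + sin (a \<bullet> x))) * ?I x \<partial>K) - (\<integral>x. P J S x * ?I x \<partial>K) = (\<integral>x. P J S x * ?I x * sin (a \<bullet> x) \<partial>K)"
        using int0 ints by simp
      have "(CLINT x|K. P (insert j J) S x *\<^sub>R iexp (a \<bullet> x))
          = (CLINT x|K. complex_of_real (P J S x * ?I x * cos (a \<bullet> x)) + \<i> * complex_of_real (P J S x * ?I x * sin (a \<bullet> x)))"
      proof (rule Bochner_Integration.integral_cong[OF refl])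
        fix x
        have "P (insert j J) S x = P J S x * ?I x" using insert.hyps by (simp add: P_def mult.commute)
        moreover have "iexp (a \<bullet> x) = complex_of_real (cos (a \<bullet> x)) + \<i> * complex_of_real (sin (a \<bullet> x))"
          by (simp add: exp_Euler cos_of_real sin_of_real)
        ultimately show "P (insert j J) S x *\<^sub>R iexp (a \<bullet> x)
            = complex_of_real (P J S x * ?I x * cos (a \<bullet> x)) + \<i> * complex_of_real (P J S x * ?I x * sin (a \<bullet> x))"
          by (simp add: scaleR_conv_of_real algebra_simps)
      qed
      also have "\<dots> = complex_of_real (\<integral>x. P J S x * ?I x * cos (a \<bullet> x) \<partial>K) + \<i> * complex_of_real (\<integral>x. P J S x * ?I x * sin (a \<bullet> x) \<partial>K)"
        using intc ints by (subst Bochner_Integration.integral_add) (auto simp del: of_real_mult)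
      finally show ?thesis unfolding c s .
    qed
    show ?case by (simp add: split w0 wc ws)
  qed
  show ?thesis
  proof (rule measure_eqI_generator_eq[where E = "range (\<lambda>(a, b). box a b)" and \<Omega> = UNIV
        and A = "\<lambda>n. box (- (real n *\<^sub>R One)) (real n *\<^sub>R One)"])
    show "Int_stable (range (\<lambda>(a, b::'a). box a b))"
      by (auto simp: Int_stable_def box_Int_box)
    show "sets M = sigma_sets UNIV (range (\<lambda>(a, b). box a b))" "sets N = sigma_sets UNIV (range (\<lambda>(a, b). box a b))"
      by (simp_all add: sets borel_eq_box)
    show "(\<Union>n. box (- (real n *\<^sub>R One)) (real n *\<^sub>R One)) = (UNIV :: 'a set)"
      unfolding UN_box_eq_UNIV by auto
    show "emeasure M (box (- (real n *\<^sub>R One)) (real n *\<^sub>R One)) \<noteq> \<infinity>" for n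
      using fin(1) by (simp add: finite_measure.emeasure_finite)
    fix X :: "'a set" assume "X \<in> range (\<lambda>(a, b). box a b)"
    then obtain l u where X: "X = box l u" by auto
    \<comment> \<open>Once all coordinates are exchanged, the product of indicators is that of a
      box, and frequency 0 leaves its measure.\<close>
    have P: "P Basis (\<lambda>j. {l \<bullet> j<..<u \<bullet> j}) x = indicator X x" for x
      by (auto simp: P_def X mem_box indicator_def)
    have "complex_of_real (measure K X) = (CLINT x|K. P Basis (\<lambda>j. {l \<bullet> j<..<u \<bullet> j}) x *\<^sub>R iexp (0 \<bullet> x))"
      if K: "K = M \<or> K = N" for K
    proof -
      have sK: "sets K = sets borel" using K sets by auto
      have "(CLINT x|K. P Basis (\<lambda>j. {l \<bullet> j<..<u \<bullet> j}) x *\<^sub>R iexp (0 \<bullet> x)) = (CLINT x|K. complex_of_real (indicator X x))"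
        unfolding P by (simp add: scaleR_conv_of_real)
      also have "\<dots> = complex_of_real (measure K X)"
        using sK sets_eq_imp_space_eq[OF sK] by (simp add: X)
      finally show ?thesis by simp
    qed
    then have "measure M X = measure N X"
      using key[of Basis "\<lambda>j. {l \<bullet> j<..<u \<bullet> j}" 0] by (metis finite_Basis borel_open open_greaterThanLessThan of_real_eq_iff)
    then show "emeasure M X = emeasure N X"
      using fin by (simp add: finite_measure.emeasure_eq_measure)
  qed auto
qed

section \<open>The subdifferential of the Gaussian probability function\<close>

lemma char_std_gaussian:
  fixes a :: "'a::euclidean_space"
  shows "(CLINT x|std_gaussian. iexp (a \<bullet> x)) = complex_of_real (exp (- ((norm a)\<^sup>2) / 2))"
proof -
  interpret product_sigma_finite "\<lambda>_ :: 'a. lborel :: real measure" by unfold_locales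
  define h where "h b x = std_normal_density x *\<^sub>R iexp ((a \<bullet> b) * x)" for b :: 'a and x
  have hint: "integrable lborel (h b)" for b
  proof (rule Bochner_Integration.integrable_bound[OF integrable_normal_density[of 1 0]])
    show "AE x in lborel. norm (h b x) \<le> norm (std_normal_density x)" by (simp add: h_def)
  qed (auto simp: h_def[abs_def])
  have h: "(CLINT x|lborel. h b x) = complex_of_real (exp (- ((a \<bullet> b)\<^sup>2) / 2))" for b
  proof -
    have "(CLINT x|lborel. h b x) = char std_normal_distribution (a \<bullet> b)"
      unfolding char_def h_def by (subst integral_density) auto
    then show ?thesis by (simp add: char_std_normal_distribution)
  qed
  have "(CLINT x|std_gaussian. iexp (a \<bullet> x)) = (CLINT x|lborel. (\<Prod>b\<in>Basis. std_normal_density (x \<bullet> b)) *\<^sub>R iexp (a \<bullet> x))"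
    unfolding std_gaussian_def by (subst integral_density) (auto intro!: prod_nonneg)
  also have "\<dots> = (CLINT f|Pi\<^sub>M Basis (\<lambda>_. lborel). \<Prod>b\<in>Basis. h b (f b))"
    unfolding lborel_eq[where 'a = 'a]
  proof (subst integral_distr)
    show "(CLINT f|Pi\<^sub>M Basis (\<lambda>_. lborel). (\<Prod>b\<in>Basis. std_normal_density ((\<Sum>b\<in>Basis. f b *\<^sub>R b) \<bullet> b)) *\<^sub>R
          iexp (a \<bullet> (\<Sum>b\<in>Basis. f b *\<^sub>R b))) = (CLINT f|Pi\<^sub>M Basis (\<lambda>_. lborel). \<Prod>b\<in>Basis. h b (f b))"
    proof (rule Bochner_Integration.integral_cong[OF refl])
      fix f :: "'a \<Rightarrow> real"
      have "iexp (a \<bullet> (\<Sum>b\<in>Basis. f b *\<^sub>R b)) = (\<Prod>b\<in>Basis. iexp ((a \<bullet> b) * f b))"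
      proof -
        have "a \<bullet> (\<Sum>b\<in>Basis. f b *\<^sub>R b) = (\<Sum>b\<in>Basis. (a \<bullet> b) * f b)"
          by (simp only: inner_sum_right inner_scaleR_right mult.commute)
        then show ?thesis by (simp only: of_real_sum sum_distrib_left exp_sum[OF finite_Basis])
      qed
      then show "(\<Prod>b\<in>Basis. std_normal_density ((\<Sum>b\<in>Basis. f b *\<^sub>R b) \<bullet> b)) *\<^sub>R iexp (a \<bullet> (\<Sum>b\<in>Basis. f b *\<^sub>R b))
          = (\<Prod>b\<in>Basis. h b (f b))"
        by (simp add: h_def scaleR_conv_of_real prod.distrib cong: prod.cong)
    qed
  qed auto
  also have "\<dots> = (\<Prod>b\<in>Basis. CLINT x|lborel. h b x)"
    by (rule product_integral_prod) (auto intro: hint)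
  also have "\<dots> = complex_of_real (exp (\<Sum>b\<in>Basis. - ((a \<bullet> b)\<^sup>2) / 2))"
    by (simp add: h exp_sum)
  also have "(\<Sum>b\<in>Basis. - ((a \<bullet> b)\<^sup>2) / 2) = - ((norm a)\<^sup>2) / 2"
    by (rule sum_Basis_neg_half_square)
  finally show ?thesis .
qed

text \<open>Frequency 1 suffices for projections, since the vector \<open>a\<close> already enters
  through the variance. The point mass for \<open>s2 = 0\<close> follows the same formula.\<close>

lemma char_normal_law:
  assumes "s2 \<ge> 0"
  shows "(CLINT x|normal_law s2. iexp x) = complex_of_real (exp (- s2 / 2))"
proof (cases "s2 = 0")
  case True
  then show ?thesis by (simp add: normal_law_def integral_return)
next
  case False
  define \<sigma> where "\<sigma> = sqrt s2"
  have \<sigma>: "\<sigma> > 0" "\<sigma>\<^sup>2 = s2" using assms False by (auto simp: \<sigma>_def)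
  have "(CLINT x|normal_law s2. iexp x) = (CLINT x|lborel. normal_density 0 \<sigma> x *\<^sub>R iexp x)"
    using False unfolding normal_law_def \<sigma>_def by (simp, subst integral_density) auto
  also have "\<dots> = \<bar>\<sigma>\<bar> *\<^sub>R (CLINT x|lborel. normal_density 0 \<sigma> (0 + \<sigma> * x) *\<^sub>R iexp (0 + \<sigma> * x))"
    using \<sigma> by (intro lborel_integral_real_affine) auto
  also have "\<dots> = (CLINT x|lborel. std_normal_density x *\<^sub>R iexp (\<sigma> * x))"
  proof -
    have "\<sigma> * normal_density 0 \<sigma> (\<sigma> * x) = std_normal_density x" for x
      using \<sigma>(1) by (simp add: normal_density_def real_sqrt_mult power_mult_distrib)
    then have "\<sigma> *\<^sub>R (normal_density 0 \<sigma> (0 + \<sigma> * x) *\<^sub>R iexp (0 + \<sigma> * x)) = std_normal_density x *\<^sub>R iexp (\<sigma> * x)" for x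
      by simp
    then show ?thesis using \<sigma> by (subst integral_scaleR_right[symmetric]) simp
  qed
  also have "\<dots> = char std_normal_distribution \<sigma>"
    unfolding char_def by (subst integral_density) auto
  finally show ?thesis by (simp add: char_std_normal_distribution \<sigma>)
qed

text \<open>The Cramer-Wold idea: the characteristic function at \<open>a\<close> depends only on
  the law of the projection along \<open>a\<close>, whose variance is the squared norm of
  \<open>transpose L *v a\<close>. The same number governs the image of the standard Gaussian, also
  when \<Sigma> is singular.\<close>

lemma centered_gaussian_distr:
  fixes \<xi> :: "'o \<Rightarrow> real^'m"
  assumes M: "prob_space M" and \<xi>: "centered_gaussian M \<xi> \<Sigma>" and L: "L ** transpose L = \<Sigma>"
  shows "distr M borel \<xi> = distr std_gaussian borel (\<lambda>z. L *v z)"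
proof (rule char_determines_measure)
  interpret prob_space M by (rule M)
  have [measurable]: "\<xi> \<in> borel_measurable M"
    and proj: "distr M borel (\<lambda>\<omega>. a \<bullet> \<xi> \<omega>) = normal_law (a \<bullet> (\<Sigma> *v a))" for a
    using \<xi> by (auto simp: centered_gaussian_def)
  have [measurable]: "(\<lambda>z. L *v z) \<in> borel \<rightarrow>\<^sub>M borel"
    by (intro borel_measurable_continuous_onI linear_continuous_on matrix_vector_mul_bounded_linear)
  show "finite_measure (distr M borel \<xi>)"
    by (intro prob_space.finite_measure prob_space_distr) measurable
  show "finite_measure (distr std_gaussian borel (\<lambda>z. L *v z))"
  proof -
    have "(\<lambda>z. L *v z) \<in> std_gaussian \<rightarrow>\<^sub>M borel" by measurable
    then show ?thesis by (intro prob_space.finite_measure[OF prob_space.prob_space_distr[OF prob_space_std_gaussian]])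
  qed
  fix a :: "real^'m"
  have s2: "a \<bullet> (\<Sigma> *v a) = (norm (transpose L *v a))\<^sup>2"
    unfolding L[symmetric] power2_norm_eq_inner
    by (simp add: matrix_vector_mul_assoc[symmetric] dot_lmul_matrix[symmetric] transpose_matrix_vector)
  have "(CLINT x|distr M borel \<xi>. iexp (a \<bullet> x)) = (CLINT x|distr M borel (\<lambda>\<omega>. a \<bullet> \<xi> \<omega>). iexp x)"
    by (subst (1 2) integral_distr) auto
  also have "\<dots> = complex_of_real (exp (- ((norm (transpose L *v a))\<^sup>2) / 2))"
    unfolding proj s2 by (rule char_normal_law) simp
  also have "\<dots> = (CLINT z|std_gaussian. iexp ((transpose L *v a) \<bullet> z))"
    by (rule char_std_gaussian[symmetric])
  also have "\<dots> = (CLINT x|distr std_gaussian borel (\<lambda>z. L *v z). iexp (a \<bullet> x))"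
    by (subst integral_distr) (auto simp: dot_lmul_matrix[symmetric] transpose_matrix_vector)
  finally show "(CLINT x|distr M borel \<xi>. iexp (a \<bullet> x)) = (CLINT x|distr std_gaussian borel (\<lambda>z. L *v z). iexp (a \<bullet> x))" .
qed auto

text \<open>Because \<open>L\<close> commutes with scaling, the set of radii in
  \<open>radial_prob\<close> is the section along \<open>v\<close> of the set where
  \<open>g u (L *v z) \<le> 0\<close>, so the polar formula applies to that set.\<close>

lemma radial_decomposition:
  fixes \<xi> :: "'o \<Rightarrow> real^'m" and g :: "'u \<Rightarrow> real^'m \<Rightarrow> real"
  assumes M: "prob_space M" and \<xi>: "centered_gaussian M \<xi> \<Sigma>" and L: "L ** transpose L = \<Sigma>"
    and cont: "continuous_on UNIV (g u)"
  shows "integrable uniform_sphere (radial_prob g L u)"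
    "measure M {\<omega> \<in> space M. g u (\<xi> \<omega>) \<le> 0} = (\<integral>v. radial_prob g L u v \<partial>uniform_sphere)"
proof -
  interpret U: prob_space "uniform_sphere :: (real^'m) measure" by (rule prob_space_uniform_sphere)
  interpret C: prob_space "chi_measure CARD('m)"
    using prob_space_chi_measure[where 'a = "real^'m"] by simp
  have [measurable]: "\<xi> \<in> borel_measurable M" using \<xi> by (auto simp: centered_gaussian_def)
  have [measurable]: "(\<lambda>z. L *v z) \<in> borel \<rightarrow>\<^sub>M borel"
    by (intro borel_measurable_continuous_onI linear_continuous_on matrix_vector_mul_bounded_linear)
  have [measurable]: "g u \<in> borel_measurable borel" by (rule borel_measurable_continuous_onI[OF cont])
  have [measurable_cong]: "sets (chi_measure CARD('m)) = sets borel" by (simp add: chi_measure_def)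
  have e: "ennreal (radial_prob g L u v) = emeasure (chi_measure CARD('m)) {r. 0 \<le> r \<and> r *\<^sub>R v \<in> {z. g u (L *v z) \<le> 0}}" for v
    by (simp add: radial_prob_def C.emeasure_eq_measure matrix_vector_mult_scaleR)
  have "(\<lambda>v. ennreal (radial_prob g L u v)) \<in> borel_measurable uniform_sphere"
  proof -
    \<comment> \<open>Writing the value as an integral over \<open>r\<close> of a jointly measurable
      indicator yields measurability in \<open>v\<close> by Tonelli.\<close>
    have "ennreal (radial_prob g L u v)
        = (\<integral>\<^sup>+r. indicator {p. 0 \<le> snd p \<and> g u (L *v (snd p *\<^sub>R fst p)) \<le> 0} (v, r) \<partial>chi_measure CARD('m))" for v
    proof -
      have [measurable]: "{r. 0 \<le> r \<and> g u (L *v (r *\<^sub>R v)) \<le> 0} \<in> sets borel" by measurable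
      have "(\<integral>\<^sup>+r. indicator {p. 0 \<le> snd p \<and> g u (L *v (snd p *\<^sub>R fst p)) \<le> 0} (v, r) \<partial>chi_measure CARD('m))
          = (\<integral>\<^sup>+r. indicator {r. 0 \<le> r \<and> g u (L *v (r *\<^sub>R v)) \<le> 0} r \<partial>chi_measure CARD('m))"
        by (intro nn_integral_cong) (auto split: split_indicator)
      also have "\<dots> = emeasure (chi_measure CARD('m)) {r. 0 \<le> r \<and> g u (L *v (r *\<^sub>R v)) \<le> 0}"
        by (rule nn_integral_indicator) measurable
      finally show ?thesis unfolding e by simp
    qed
    moreover have "(\<lambda>v. \<integral>\<^sup>+r. indicator {p. 0 \<le> snd p \<and> g u (L *v (snd p *\<^sub>R fst p)) \<le> 0} (v, r) \<partial>chi_measure CARD('m))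
        \<in> borel_measurable (uniform_sphere :: (real^'m) measure)"
      by measurable
    ultimately show ?thesis by simp
  qed
  then have "(\<lambda>v. enn2real (ennreal (radial_prob g L u v))) \<in> borel_measurable uniform_sphere" by measurable
  moreover have "radial_prob g L u v \<ge> 0" for v by (simp add: radial_prob_def)
  ultimately have m: "radial_prob g L u \<in> borel_measurable uniform_sphere" by simp
  show int: "integrable uniform_sphere (radial_prob g L u)"
    by (rule U.integrable_const_bound[OF _ m, of 1]) (simp add: radial_prob_def)
  have [measurable]: "{z. g u z \<le> 0} \<in> sets borel" by measurable
  have "emeasure M {\<omega> \<in> space M. g u (\<xi> \<omega>) \<le> 0} = emeasure (distr M borel \<xi>) {z. g u z \<le> 0}"
    by (subst emeasure_distr) (auto intro!: arg_cong[where f = "emeasure M"])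
  also have "\<dots> = emeasure std_gaussian {z. g u (L *v z) \<le> 0}"
    unfolding centered_gaussian_distr[OF M \<xi> L] by (subst emeasure_distr) (auto simp: vimage_def)
  also have "\<dots> = (\<integral>\<^sup>+v. ennreal (radial_prob g L u v) \<partial>uniform_sphere)"
    unfolding e by (subst std_gaussian_polar) auto
  also have "\<dots> = ennreal (\<integral>v. radial_prob g L u v \<partial>uniform_sphere)"
    by (rule nn_integral_eq_integral[OF int]) (simp add: radial_prob_def)
  finally have "emeasure M {\<omega> \<in> space M. g u (\<xi> \<omega>) \<le> 0} = ennreal (\<integral>v. radial_prob g L u v \<partial>uniform_sphere)" .
  moreover have "0 \<le> (\<integral>v. radial_prob g L u v \<partial>uniform_sphere)"
    by (rule Bochner_Integration.integral_nonneg) (simp add: radial_prob_def)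
  ultimately show "measure M {\<omega> \<in> space M. g u (\<xi> \<omega>) \<le> 0} = (\<integral>v. radial_prob g L u v \<partial>uniform_sphere)"
    by (simp only: measure_def enn2real_ennreal)
qed

theorem theorem2p3:
  fixes M :: "'o measure"
    and \<xi> :: "'o \<Rightarrow> real^'m"
    and \<Sigma> L :: "real^'m^'m"
    and g :: "'u::banach \<Rightarrow> real^'m \<Rightarrow> real"
    and ubar :: 'u
  assumes "reflexive_space TYPE('u)"
    and "separable_space TYPE('u)"
    and "prob_space M"
    and "centered_gaussian M \<xi> \<Sigma>"
    and "L ** transpose L = \<Sigma>"
    and "locally_lipschitz (\<lambda>p. g (fst p) (snd p))"
    and "convex_on UNIV (\<lambda>p. g (fst p) (snd p))"
    and "g ubar 0 < 0"
    and "bounded {z. g ubar z \<le> 0}"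
  shows "clarke_subdiff (\<lambda>u. measure M {\<omega> \<in> space M. g u (\<xi> \<omega>) \<le> 0}) ubar =
         aumann_integral uniform_sphere (\<lambda>v. clarke_subdiff (\<lambda>u. radial_prob g L u v) ubar)"
proof -
  have cont: "continuous_on UNIV (g u)" for u
    using continuous_on_compose2[OF locally_lipschitz_imp_continuous[OF assms(6)], of UNIV "\<lambda>z. (u, z)"]
    by (simp add: continuous_intros)
  note dec = radial_decomposition[where g = g, OF assms(3,4,5) cont]
  obtain \<delta> C where *: "\<delta> > 0" "C \<ge> 0"
    "\<And>u w v. u \<in> ball ubar \<delta> \<Longrightarrow> w \<in> ball ubar \<delta> \<Longrightarrow>
      \<bar>radial_prob g L u v - radial_prob g L w v\<bar> \<le> C * norm (u - w)"
    "\<And>v. \<exists>p. concave_regular (\<lambda>u. radial_prob g L u v) ubar p"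
    using radial_prob_regular[OF assms(6-9), where L = L] by blast
  show ?thesis
    unfolding dec(2)
    by (rule clarke_subdiff_integral[OF assms(1,2) prob_space.finite_measure[OF prob_space_uniform_sphere] dec(1) *])
qed

end
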